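(* Assume that $\{\omega_x\}_{x\in\mathbb{Z}}$ are i.i.d. under $P$ with $P(\omega_0\in[c,1-c])=1$ for some $c>0$, and that $E_P[\rho_0]<1$, where $\rho_x=\frac{1-\omega_x}{\omega_x}$; let $\mathrm{v}_P=\frac{1-E_P[\rho_0]}{1+E_P[\rho_0]}$. If $\nu:\Omega\to\Upsilon$ is a measurable function such that $\mathbb{E}_\nu(\eta_0(0))<\infty$, then $\mathbb{P}_\nu(\eta_n\in\cdot)$ converges weakly, in the space of probability measures on $(\mathbb{Z}_+)^{\mathbb{Z}}$, to $\mathbb{P}_{\pi_\alpha}(\eta_0\in\cdot)$ as $n\to\infty$, with $\alpha=\mathrm{v}_P\,\mathbb{E}_\nu(\eta_0(0))$.
   Context: An environment is an element $\omega=\{\omega_x\}_{x\in\mathbb{Z}}$ of $\Omega=[0,1]^{\mathbb{Z}}$. Given $\omega$, under the quenched law $P_\omega$, $\{X^{x,i}_\cdot\}_{x\in\mathbb{Z},\,i\ge 1}$ is an independent collection of nearest-neighbor Markov chains on $\mathbb{Z}$ with $P_\omega(X^{x,i}_0=x)=1$, and from a site $y$ each chain steps to $y+1$ with probability $\omega_y$ and to $y-1$ with probability $1-\omega_y$. $P$ is a probability measure on $\Omega$ with expectation $E_P$. $\mathbb{Z}_+$ is the set of non-negative integers; $\Upsilon$ is the space of probability distributions on $\mathbb{Z}_+$ with the topology of convergence in distribution; $(\theta^x\omega)_y=\omega_{x+y}$ is the shift on environments. For measurable $\nu:\Omega\to\Upsilon$, let $\nu^\omega=\bigotimes_{x\in\mathbb{Z}}\nu(\theta^x\omega)$.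 $P_{\omega,\nu^\omega}$ is the quenched law of the system in which, given $\omega$, the initial configuration $\eta_0\in(\mathbb{Z}_+)^{\mathbb{Z}}$ has law $\nu^\omega$ (i.e. the $\eta_0(x)$ are independent with $\eta_0(x)\sim\nu(\theta^x\omega)$) and is independent of the walks; and $\mathbb{P}_\nu(\cdot)=\int_\Omega P_{\omega,\nu^\omega}(\cdot)\,P(d\omega)$, with expectation $\mathbb{E}_\nu$. The configuration at time $n$ is $\eta_n(x)=\sum_{y\in\mathbb{Z}}\sum_{i=1}^{\eta_0(y)}\mathbf{1}\{X^{y,i}_n=x\}$. The space $(\mathbb{Z}_+)^{\mathbb{Z}}$ carries the product topology. For $\alpha\ge0$, $\pi_\alpha:\Omega\to\Upsilon$ is defined by $\pi_\alpha(\omega)=\mathrm{Poisson}(\alpha f(\omega))$, where $f(\omega)=\frac{1}{\omega_0}\left(1+\sum_{i=1}^\infty\prod_{j=1}^i\rho_j\right)$, which is finite for $P$-a.e. $\omega$ ($\mathrm{Poisson}(0)$ is the point mass at $0$). *)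

theory Defs
  imports "HOL-Probability.Probability"
begin

type_synonym env = "int \<Rightarrow> real"

type_synonym config = "int \<Rightarrow> nat"

(* walks (x, i) n is the position at time n of the i-th walk started at x *)
type_synonym walks = "int \<times> nat \<Rightarrow> nat \<Rightarrow> int"

definition env_space :: "env measure" where
  "env_space = (\<Pi>\<^sub>M x\<in>UNIV. restrict_space borel {0..1})"

definition shift :: "int \<Rightarrow> env \<Rightarrow> env" where
  "shift x \<omega> = (\<lambda>y. \<omega> (x + y))"

definition rho :: "env \<Rightarrow> int \<Rightarrow> real" where
  "rho \<omega> x = (1 - \<omega> x) / \<omega> x"

definition step :: "env \<Rightarrow> int \<Rightarrow> int pmf" where
  "step \<omega> y = map_pmf (\<lambda>b. if b then y + 1 else y - 1) (bernoulli_pmf (\<omega> y))"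

definition walk_kernel :: "env \<Rightarrow> int \<Rightarrow> nat \<Rightarrow> (nat \<Rightarrow> int) \<Rightarrow> int measure" where
  "walk_kernel \<omega> x n h = measure_pmf (if n = 0 then return_pmf x else step \<omega> (h (n - 1)))"

interpretation walk: Ionescu_Tulcea "walk_kernel \<omega> x" "\<lambda>_. count_space UNIV" for \<omega> x
proof (rule Ionescu_Tulcea.intro)
  fix i
  show "walk_kernel \<omega> x i \<in> (\<Pi>\<^sub>M j\<in>{0..<i}. count_space UNIV) \<rightarrow>\<^sub>M subprob_algebra (count_space UNIV)"
  proof (cases "i = 0")
    case True
    then show ?thesis
      by (simp add: walk_kernel_def[abs_def] measure_pmf_in_subprob_algebra)
  next
    case False
    then have "(\<lambda>h. h (i - 1)) \<in> (\<Pi>\<^sub>M j\<in>{0..<i}. count_space (UNIV :: int set)) \<rightarrow>\<^sub>M count_space UNIV"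
      by (intro measurable_component_singleton) auto
    from measurable_compose[OF this, of "\<lambda>y. measure_pmf (step \<omega> y)"] False
    show ?thesis
      by (simp add: walk_kernel_def[abs_def] measure_pmf_in_subprob_algebra)
  qed
qed (unfold walk_kernel_def, rule prob_space_measure_pmf)

(* law on path space of the Markov chain started at x with transition probabilities step \<omega> *)
definition walk_law :: "env \<Rightarrow> int \<Rightarrow> (nat \<Rightarrow> int) measure" where
  "walk_law \<omega> x = walk.PF.lim \<omega> x"

definition quenched :: "(env \<Rightarrow> nat pmf) \<Rightarrow> env \<Rightarrow> (config \<times> walks) measure" where
  "quenched \<nu> \<omega> =
     (\<Pi>\<^sub>M x\<in>UNIV. measure_pmf (\<nu> (shift x \<omega>))) \<Otimes>\<^sub>M (\<Pi>\<^sub>M (x, i)\<in>UNIV \<times> {1..}. walk_law \<omega> x)"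

definition annealed :: "env measure \<Rightarrow> (env \<Rightarrow> nat pmf) \<Rightarrow> (config \<times> walks) measure" where
  "annealed P \<nu> = P \<bind> quenched \<nu>"

abbreviation eta0 :: "config \<times> walks \<Rightarrow> config" where
  "eta0 \<equiv> fst"

(* Only finitely many summands are nonzero almost surely, since the walks are nearest-neighbour;
   on the exceptional null set the infinite sum is 0 by convention. *)
definition eta :: "nat \<Rightarrow> config \<times> walks \<Rightarrow> config" where
  "eta n = (\<lambda>(\<eta>\<^sub>0, X) x. \<Sum>\<^sub>\<infinity>y. \<Sum>i=1..\<eta>\<^sub>0 y. of_bool (X (y, i) n = x))"

(* the topology of convergence in distribution *)
definition distr_topology :: "nat pmf topology" where
  "distr_topology = topology_generated_by
     {{p. measure_pmf.expectation p g \<in> U} | (g :: nat \<Rightarrow> real) U.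
        continuous_on UNIV g \<and> bounded (range g) \<and> open U}"

definition Upsilon :: "nat pmf measure" where
  "Upsilon = sigma UNIV {U. openin distr_topology U}"

(* The topology on the type int \<Rightarrow> nat is the product of discrete topologies. *)
definition weakly_converges :: "(nat \<Rightarrow> config measure) \<Rightarrow> config measure \<Rightarrow> bool" where
  "weakly_converges \<mu> \<mu>' \<longleftrightarrow>
     (\<forall>n. prob_space (\<mu> n) \<and> sets (\<mu> n) = sets borel) \<and>
     prob_space \<mu>' \<and> sets \<mu>' = sets borel \<and>
     (\<forall>F :: config \<Rightarrow> real. continuous_on UNIV F \<and> bounded (range F) \<longrightarrow>
        (\<lambda>n. \<integral>\<eta>. F \<eta> \<partial>\<mu> n) \<longlonglongrightarrow> (\<integral>\<eta>. F \<eta> \<partial>\<mu>'))"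

definition speed :: "env measure \<Rightarrow> real" where
  "speed P = (1 - (\<integral>\<omega>. rho \<omega> 0 \<partial>P)) / (1 + (\<integral>\<omega>. rho \<omega> 0 \<partial>P))"

definition env_f :: "env \<Rightarrow> real" where
  "env_f \<omega> = 1 / \<omega> 0 * (1 + (\<Sum>i. \<Prod>j=1..Suc i. rho \<omega> (int j)))"

(* poisson_pmf requires a positive rate *)
definition poisson :: "real \<Rightarrow> nat pmf" where
  "poisson r = (if r > 0 then poisson_pmf r else return_pmf 0)"

definition pi_alpha :: "real \<Rightarrow> env \<Rightarrow> nat pmf" where
  "pi_alpha \<alpha> \<omega> = poisson (\<alpha> * env_f \<omega>)"

(* The remaining lemmas check that the measures above are what they should be: walk_law has the
   finite-dimensional distributions of the Markov chain, all kernels and random variables are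
   measurable, so that the bind in annealed is the mixture of the quenched laws over P. *)

lemma sets_walk_law [simp, measurable_cong]:
  "sets (walk_law \<omega> x) = sets (\<Pi>\<^sub>M n\<in>UNIV. count_space UNIV)"
  by (simp add: walk_law_def)

lemma space_walk_law [simp]: "space (walk_law \<omega> x) = UNIV"
  by (simp add: walk_law_def space_PiM)

lemma walk_C_cylinder:
  "emeasure (walk.C \<omega> x 0 n (\<lambda>_. undefined)) {restrict a {0..<n}} =
     (\<Prod>k<n. emeasure (walk_kernel \<omega> x k a) {a k})"
proof (induction n)
  case 0
  have "{\<lambda>_. undefined::int} \<in> sets (\<Pi>\<^sub>M i\<in>{0..<0::nat}. count_space UNIV)"
    by (simp add: sets_PiM_empty)
  then show ?case by (simp add: restrict_def)
next
  case (Suc n)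
  let ?P = "\<lambda>n. \<Pi>\<^sub>M i\<in>{0..<n}. count_space (UNIV :: int set)"
  have S: "{restrict a {0..<m}} \<in> sets (?P m)" for m
    using sets_PiM_I_finite[of "{0..<m}" "\<lambda>i. {a i}" "\<lambda>_. count_space (UNIV :: int set)"]
    by (simp add: PiE_singleton[of "restrict a {0..<m}" "{0..<m}", symmetric] extensional_def cong: PiE_cong)
  have "emeasure (walk.C \<omega> x 0 (Suc n) (\<lambda>_. undefined)) {restrict a {0..<Suc n}} =
    (\<integral>\<^sup>+h. emeasure (walk.eP \<omega> x n h) {restrict a {0..<Suc n}} \<partial>walk.C \<omega> x 0 n (\<lambda>_. undefined))"
    using S[of "Suc n"]
    unfolding walk.C.simps
    by (subst emeasure_bind[where N="?P (Suc n)"])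
       (auto simp: walk.space_C space_PiM PiE_iff extensional_def measurable_cong_sets[OF walk.sets_C refl]
          intro: exI[of _ "\<lambda>_. undefined"] walk.measurable_eP)
  also have "\<dots> = (\<integral>\<^sup>+h. emeasure (walk_kernel \<omega> x n a) {a n} * indicator {restrict a {0..<n}} h
      \<partial>walk.C \<omega> x 0 n (\<lambda>_. undefined))"
  proof (rule nn_integral_cong)
    fix h assume "h \<in> space (walk.C \<omega> x 0 n (\<lambda>_. undefined))"
    then have h: "h \<in> space (?P n)" by (simp add: walk.space_C)
    have e: "(\<lambda>y. h(n := y)) -` {restrict a {0..<Suc n}} = (if h = restrict a {0..<n} then {a n} else {})"
    proof -
      have "h = restrict a {0..<n}" if "h(n := y) = restrict a {0..<Suc n}" for y
      proof
        fix k show "h k = restrict a {0..<n} k"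
          using fun_cong[OF that, of k] h by (cases "k < n") (auto simp: space_PiM PiE_iff extensional_def split: if_splits)
      qed
      moreover have "y = a n" if "h(n := y) = restrict a {0..<Suc n}" for y
        using fun_cong[OF that, of n] by simp
      moreover have "(restrict a {0..<n})(n := a n) = restrict a {0..<Suc n}"
        by (auto simp: fun_eq_iff)
      ultimately show ?thesis by auto
    qed
    have K: "walk_kernel \<omega> x n (restrict a {0..<n}) = walk_kernel \<omega> x n a"
      by (auto simp: walk_kernel_def)
    show "emeasure (walk.eP \<omega> x n h) {restrict a {0..<Suc n}} =
        emeasure (walk_kernel \<omega> x n a) {a n} * indicator {restrict a {0..<n}} h"
      by (subst walk.emeasure_eP[OF h S]) (auto simp: e K split: split_indicator)
  qed
  also have "\<dots> = emeasure (walk_kernel \<omega> x n a) {a n} * emeasure (walk.C \<omega> x 0 n (\<lambda>_. undefined)) {restrict a {0..<n}}"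
    using S[of n] by (subst nn_integral_cmult_indicator) (auto simp: walk.sets_C space_PiM)
  finally show ?case unfolding prod.lessThan_Suc Suc.IH by (simp only: mult.commute)
qed

lemma emeasure_walk_law_cylinder:
  "emeasure (walk_law \<omega> x) {p. \<forall>k\<le>n. p k = a k} =
     indicator {x} (a 0) * (\<Prod>k<n. ennreal (pmf (step \<omega> (a k)) (a (Suc k))))"
proof -
  let ?J = "{0..<Suc n}" and ?M = "\<lambda>_. count_space (UNIV :: int set)"
  have X: "{restrict a ?J} \<in> sets (\<Pi>\<^sub>M i\<in>?J. count_space (UNIV :: int set))"
    using sets_PiM_I_finite[of ?J "\<lambda>i. {a i}" ?M]
    by (simp add: PiE_singleton[of "restrict a ?J" ?J, symmetric] extensional_def cong: PiE_cong)
  have "{p. \<forall>k\<le>n. p k = a k} = prod_emb UNIV ?M ?J {restrict a ?J}"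
    unfolding prod_emb_def space_PiM
    by (auto simp: fun_eq_iff restrict_def less_Suc_eq_le) metis
  then have "emeasure (walk_law \<omega> x) {p. \<forall>k\<le>n. p k = a k} = emeasure (walk.CI \<omega> x ?J) {restrict a ?J}"
    using walk.lim[OF _ X] by (simp add: walk_law_def)
  also have "\<dots> = emeasure (walk.C \<omega> x 0 (Suc n) (\<lambda>_. undefined)) {restrict a ?J}"
    by (subst walk.emeasure_CI[OF order_refl X]) (use sets.sets_into_space[OF X] in \<open>simp add: prod_emb_id space_PiM\<close>)
  also have "\<dots> = (\<Prod>k<Suc n. emeasure (walk_kernel \<omega> x k a) {a k})"
    by (rule walk_C_cylinder)
  also have "\<dots> = emeasure (return_pmf x) {a 0} * (\<Prod>k<n. ennreal (pmf (step \<omega> (a k)) (a (Suc k))))"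
    by (subst prod.lessThan_Suc_shift) (simp add: walk_kernel_def emeasure_pmf_single)
  finally show ?thesis by (simp add: indicator_def emeasure_pmf_single eq_commute)
qed

lemma prob_space_walk_law: "prob_space (walk_law \<omega> x)"
proof -
  have "prob_space (distr (walk.PF.lim \<omega> x) (\<Pi>\<^sub>M i\<in>{}. count_space UNIV) (\<lambda>p. restrict p {}))"
    by (subst walk.distr_lim) (auto intro: walk.PF.prob_space_P)
  then show ?thesis
    unfolding walk_law_def
    by (rule prob_space_distrD[rotated]) (intro measurable_restrict, auto)
qed

lemma pmf_step: "0 \<le> \<omega> y \<Longrightarrow> \<omega> y \<le> 1 \<Longrightarrow>
   pmf (step \<omega> y) z = (if z = y + 1 then \<omega> y else if z = y - 1 then 1 - \<omega> y else 0)"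
proof -
  assume a: "0 \<le> \<omega> y" "\<omega> y \<le> 1"
  have "(\<lambda>b. if b then y + 1 else y - 1) -` {z} = (if z = y + 1 then {True} else if z = y - 1 then {False} else {})"
    by (auto split: if_splits)
  then show ?thesis using a
    by (simp add: step_def pmf_map measure_pmf_single)
qed

lemma measurable_component_env: "(\<lambda>\<omega>. \<omega> y) \<in> env_space \<rightarrow>\<^sub>M borel"
  using measurable_component_singleton[of y UNIV "\<lambda>_. restrict_space borel {0..1::real}"]
  by (auto simp: env_space_def measurable_restrict_space2_iff)

lemma space_env_space: "space env_space = UNIV \<rightarrow> {0..1}"
  by (auto simp: env_space_def space_PiM space_restrict_space)

lemma measurable_walk_law:
  "(\<lambda>\<omega>. walk_law \<omega> x) \<in> env_space \<rightarrow>\<^sub>M prob_algebra (\<Pi>\<^sub>M n\<in>UNIV. count_space UNIV)"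
proof (rule measurable_prob_algebra_generated)
  let ?N = "\<Pi>\<^sub>M n\<in>(UNIV :: nat set). count_space (UNIV :: int set)"
  define Z where "Z n a = {p :: nat \<Rightarrow> int. \<forall>k\<le>n. p k = a k}" for n and a :: "nat \<Rightarrow> int"
  let ?G = "insert {} (\<Union>n. range (Z n))"
  have Z_Int: "Z m a \<inter> Z n b \<in> ?G" if "m \<le> n" for m n a b
  proof (cases "\<forall>k\<le>m. a k = b k")
    case True
    then have "Z m a \<inter> Z n b = Z n b" using that by (auto simp: Z_def)
    then show ?thesis by auto
  next
    case False
    then have "Z m a \<inter> Z n b = {}" using that unfolding Z_def by fastforce
    then show ?thesis by auto
  qed
  show "Int_stable ?G"
  proof (rule Int_stableI)
    have I: "Z m a \<inter> Z n b \<in> ?G" for m n a b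
      using Z_Int[of m n a b] Z_Int[of n m b a] by (cases "m \<le> n") (simp_all add: Int_commute)
    fix A B assume A: "A \<in> ?G" and B: "B \<in> ?G"
    show "A \<inter> B \<in> ?G"
    proof (cases "A = {} \<or> B = {}")
      case False
      then obtain m a n b where "A = Z m a" "B = Z n b" using A B by blast
      then show ?thesis using I by simp
    qed auto
  qed
  show "?G \<subseteq> Pow UNIV" by auto
  show "sets ?N = sigma_sets UNIV ?G"
  proof
    have "Z n a \<in> sets ?N" for n a
    proof -
      have "Z n a = {p \<in> space ?N. \<forall>k\<in>{..n}. p k = a k}" by (auto simp: Z_def space_PiM)
      also have "\<dots> \<in> sets ?N" by measurable
      finally show ?thesis .
    qed
    then show "sigma_sets UNIV ?G \<subseteq> sets ?N"
      using sets.sigma_sets_subset[of ?G ?N] by (auto simp: space_PiM)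
    have "{p. p k \<in> A} \<in> sigma_sets UNIV ?G" for k A
    proof -
      define B where "B = {xs :: int list. length xs = Suc k \<and> xs ! k \<in> A}"
      have "p \<in> (\<Union>xs\<in>B. Z k (\<lambda>j. xs ! j))" if "p k \<in> A" for p
      proof
        show "map p [0..<Suc k] \<in> B" using that by (simp add: B_def del: upt_Suc)
        show "p \<in> Z k (\<lambda>j. map p [0..<Suc k] ! j)" by (simp add: Z_def del: upt_Suc)
      qed
      then have "{p. p k \<in> A} = (\<Union>xs\<in>B. Z k (\<lambda>j. xs ! j))"
        by (auto simp: B_def Z_def)
      also have "\<dots> \<in> sigma_sets UNIV ?G"
        by (rule sigma_algebra.countable_Union[OF sigma_algebra_sigma_sets]) (auto intro: sigma_sets.Basic)
      finally show ?thesis .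
    qed
    then show "sets ?N \<subseteq> sigma_sets UNIV ?G"
      unfolding sets_PiM_single by (simp only: space_count_space PiE_UNIV_domain Pi_UNIV) (intro sigma_sets_mono, auto)
  qed
  fix A assume "A \<in> ?G"
  moreover have "(\<lambda>\<omega>. emeasure (walk_law \<omega> x) (Z n a)) \<in> borel_measurable env_space" for n a
  proof -
    have "(\<lambda>\<omega>. pmf (step \<omega> y) z) \<in> borel_measurable env_space" for y z
    proof -
      have "(\<lambda>\<omega>. if z = y + 1 then \<omega> y else if z = y - 1 then 1 - \<omega> y else 0) \<in> borel_measurable env_space"
        using measurable_component_env[of y] by auto
      then show ?thesis
        by (subst measurable_cong) (auto simp: pmf_step space_env_space Pi_iff)
    qed
    then show ?thesis
      unfolding Z_def emeasure_walk_law_cylinder by measurable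
  qed
  ultimately show "(\<lambda>\<omega>. emeasure (walk_law \<omega> x) A) \<in> borel_measurable env_space" by auto
qed (simp_all add: prob_space_walk_law)

lemma measurable_PiM_kernel:
  assumes K: "\<And>i. i \<in> I \<Longrightarrow> K i \<in> M \<rightarrow>\<^sub>M prob_algebra (N i)"
  shows "(\<lambda>\<omega>. \<Pi>\<^sub>M i\<in>I. K i \<omega>) \<in> M \<rightarrow>\<^sub>M prob_algebra (\<Pi>\<^sub>M i\<in>I. N i)"
proof (rule measurable_prob_algebra_generated[OF sets_PiM Int_stable_prod_algebra prod_algebra_sets_into_space])
  have KN: "prob_space (K i \<omega>)" "sets (K i \<omega>) = sets (N i)" if "i \<in> I" "\<omega> \<in> space M" for i \<omega>
    using measurable_space[OF K] that by (auto simp: space_prob_algebra)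
  fix \<omega> assume \<omega>: "\<omega> \<in> space M"
  show "prob_space (\<Pi>\<^sub>M i\<in>I. K i \<omega>)" using KN \<omega> by (intro prob_space_PiM) auto
  show "sets (\<Pi>\<^sub>M i\<in>I. K i \<omega>) = sets (\<Pi>\<^sub>M i\<in>I. N i)" using KN \<omega> by (intro sets_PiM_cong) auto
next
  have KN: "prob_space (K i \<omega>)" "sets (K i \<omega>) = sets (N i)" if "i \<in> I" "\<omega> \<in> space M" for i \<omega>
    using measurable_space[OF K] that by (auto simp: space_prob_algebra)
  fix A assume "A \<in> prod_algebra I N"
  then obtain J E where A: "A = prod_emb I N J (Pi\<^sub>E J E)" and J: "finite J" "J \<subseteq> I"
    and E: "\<And>i. i \<in> J \<Longrightarrow> E i \<in> sets (N i)"
    by (auto elim!: prod_algebraE)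
  have "emeasure (\<Pi>\<^sub>M i\<in>I. K i \<omega>) A = (\<Prod>i\<in>J. emeasure (K i \<omega>) (E i))" if "\<omega> \<in> space M" for \<omega>
  proof -
    have "A = prod_emb I (\<lambda>i. K i \<omega>) J (Pi\<^sub>E J E)"
      unfolding A prod_emb_def using KN(2)[OF _ that, THEN sets_eq_imp_space_eq] by (simp cong: PiE_cong)
    then show ?thesis
      using KN that J E by (simp add: emeasure_PiM_emb subset_eq)
  qed
  moreover have "(\<lambda>\<omega>. \<Prod>i\<in>J. emeasure (K i \<omega>) (E i)) \<in> borel_measurable M"
    by (intro borel_measurable_prod_ennreal measurable_emeasure_kernel[OF measurable_prob_algebraD[OF K]])
       (use J E in auto)
  ultimately show "(\<lambda>\<omega>. emeasure (\<Pi>\<^sub>M i\<in>I. K i \<omega>) A) \<in> borel_measurable M"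
    by (simp cong: measurable_cong)
qed

lemma measurable_Upsilon_imp_kernel:
  assumes "\<nu> \<in> M \<rightarrow>\<^sub>M Upsilon"
  shows "(\<lambda>\<omega>. measure_pmf (\<nu> \<omega>)) \<in> M \<rightarrow>\<^sub>M prob_algebra (count_space UNIV)"
proof (rule measurable_compose[OF assms], rule measurable_prob_algebraI)
  show "measure_pmf \<in> Upsilon \<rightarrow>\<^sub>M subprob_algebra (count_space UNIV)"
  proof (rule measurable_subprob_algebra)
    fix A :: "nat set"
    let ?g = "indicator A :: nat \<Rightarrow> real"
    have "(\<lambda>p. measure_pmf.expectation p ?g) \<in> borel_measurable Upsilon"
    proof (rule borel_measurableI)
      fix U :: "real set" assume "open U"
      moreover have "bounded (range ?g)"
        by (rule boundedI[of _ 1]) (auto split: split_indicator)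
      moreover have "continuous_on UNIV ?g" by simp
      ultimately have "openin distr_topology {p. measure_pmf.expectation p ?g \<in> U}"
        unfolding distr_topology_def by (intro topology_generated_by_Basis) blast
      then show "(\<lambda>p. measure_pmf.expectation p ?g) -` U \<inter> space Upsilon \<in> sets Upsilon"
        by (auto simp: Upsilon_def vimage_def space_measure_of_conv intro: sigma_sets.Basic)
    qed
    then show "(\<lambda>p. emeasure (measure_pmf p) A) \<in> borel_measurable Upsilon"
      by (simp add: measure_pmf.emeasure_eq_measure)
  qed (auto simp: measure_pmf.subprob_space_axioms)
qed (simp add: prob_space_measure_pmf)

lemma measurable_shift: "shift x \<in> env_space \<rightarrow>\<^sub>M env_space"
  unfolding env_space_def shift_def[abs_def]
  by (rule measurable_PiM_single') (auto simp: space_PiM)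

lemma measurable_quenched:
  assumes "(\<lambda>\<omega>. measure_pmf (\<nu> \<omega>)) \<in> env_space \<rightarrow>\<^sub>M prob_algebra (count_space UNIV)"
  shows "quenched \<nu> \<in> env_space \<rightarrow>\<^sub>M prob_algebra
    ((\<Pi>\<^sub>M x\<in>UNIV. count_space UNIV) \<Otimes>\<^sub>M (\<Pi>\<^sub>M j\<in>UNIV \<times> {1..}. \<Pi>\<^sub>M n\<in>UNIV. count_space UNIV))"
  unfolding quenched_def[abs_def] case_prod_unfold
  by (intro measurable_pair_prob measurable_PiM_kernel measurable_walk_law
        measurable_compose[OF measurable_shift assms])

lemma measurable_nat_add:
  fixes g h :: "'a \<Rightarrow> nat"
  assumes "g \<in> M \<rightarrow>\<^sub>M count_space UNIV" "h \<in> M \<rightarrow>\<^sub>M count_space UNIV"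
  shows "(\<lambda>s. g s + h s) \<in> M \<rightarrow>\<^sub>M count_space UNIV"
  by (rule measurable_compose_countable[OF _ assms(1)]) (rule measurable_compose[OF assms(2)], simp)

lemma measurable_eta:
  "eta n \<in> (\<Pi>\<^sub>M x\<in>UNIV. count_space UNIV) \<Otimes>\<^sub>M (\<Pi>\<^sub>M j\<in>UNIV \<times> {1..}. \<Pi>\<^sub>M n\<in>UNIV. count_space UNIV) \<rightarrow>\<^sub>M borel"
  (is "_ \<in> ?S \<rightarrow>\<^sub>M _")
proof (rule measurable_coordinatewise_then_product)
  fix x
  define g where "g y s = (\<Sum>i=1..fst s y. of_bool (snd s (y, i) n = x) :: nat)" for y and s :: "config \<times> walks"
  have g: "g y \<in> ?S \<rightarrow>\<^sub>M count_space UNIV" for y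
  proof -
    have X: "(\<lambda>s. snd s (y, i) n) \<in> ?S \<rightarrow>\<^sub>M count_space UNIV" if "i \<in> {1..}" for i
    proof -
      have "(\<lambda>X. X (y, i)) \<in> (\<Pi>\<^sub>M j\<in>UNIV \<times> {1..}. \<Pi>\<^sub>M n\<in>UNIV. count_space UNIV) \<rightarrow>\<^sub>M (\<Pi>\<^sub>M n\<in>(UNIV::nat set). count_space (UNIV :: int set))"
        using that by (intro measurable_component_singleton) auto
      moreover have "(\<lambda>p. p n) \<in> (\<Pi>\<^sub>M n\<in>(UNIV::nat set). count_space (UNIV :: int set)) \<rightarrow>\<^sub>M count_space UNIV"
        by (intro measurable_component_singleton) auto
      ultimately show ?thesis
        by (rule measurable_compose[OF measurable_compose[OF measurable_snd]])
    qed
    have e: "(\<lambda>s. fst s y) \<in> ?S \<rightarrow>\<^sub>M count_space UNIV"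
      by (rule measurable_compose[OF measurable_fst measurable_component_singleton]) simp
    have "(\<lambda>s. \<Sum>i=1..m. of_bool (snd s (y, i) n = x) :: nat) \<in> ?S \<rightarrow>\<^sub>M count_space UNIV" for m
    proof (induction m)
      case (Suc m)
      have "(\<lambda>s. of_bool (snd s (y, Suc m) n = x) :: nat) \<in> ?S \<rightarrow>\<^sub>M count_space UNIV"
        by (rule measurable_compose[OF X]) auto
      from measurable_nat_add[OF Suc this] show ?case by simp
    qed simp
    from measurable_compose_countable[OF this e] show ?thesis
      by (simp add: g_def[abs_def])
  qed
  have "eta n s x = (if finite {y. g y s \<noteq> 0} then \<Sum>y | g y s \<noteq> 0. g y s else 0)" for s
  proof -
    have *: "eta n s x = infsum (\<lambda>y. g y s) UNIV" by (simp add: eta_def g_def case_prod_unfold)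
    show ?thesis
    proof (cases "finite {y. g y s \<noteq> 0}")
      case True
      have "infsum (\<lambda>y. g y s) UNIV = infsum (\<lambda>y. g y s) {y. g y s \<noteq> 0}"
        by (rule infsum_cong_neutral) auto
      with True show ?thesis by (simp add: *)
    next
      case False
      have "\<not> (\<lambda>y. g y s) summable_on UNIV"
      proof
        assume "(\<lambda>y. g y s) summable_on UNIV"
        then obtain l where "((\<lambda>y. g y s) has_sum l) UNIV" by (auto simp: summable_on_def)
        then have "eventually (\<lambda>F. sum (\<lambda>y. g y s) F = l) (finite_subsets_at_top UNIV)"
          unfolding has_sum_def by (simp add: tendsto_discrete)
        then obtain F where F: "finite F" "\<And>F'. finite F' \<Longrightarrow> F \<subseteq> F' \<Longrightarrow> sum (\<lambda>y. g y s) F' = l"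
          unfolding eventually_finite_subsets_at_top by auto
        obtain y where y: "g y s \<noteq> 0" "y \<notin> F"
          using False F(1) by (metis (mono_tags, lifting) finite_subset mem_Collect_eq subsetI)
        then show False using F(2)[of F] F(2)[of "insert y F"] F(1) by auto
      qed
      then show ?thesis using False by (simp add: * infsum_not_exists)
    qed
  qed
  moreover have "(\<lambda>s. if finite {y. g y s \<noteq> 0} then \<Sum>y | g y s \<noteq> 0. g y s else 0) \<in> ?S \<rightarrow>\<^sub>M count_space UNIV"
  proof -
    have p[measurable]: "Measurable.pred ?S (\<lambda>s. g y s \<noteq> 0)" for y
      by (rule measurable_compose[OF g]) simp
    have e: "(if finite {y. g y s \<noteq> 0} then \<Sum>y | g y s \<noteq> 0. g y s else 0) = k \<longleftrightarrow>
       (\<exists>ys. (\<forall>y. y \<in> set ys \<longleftrightarrow> g y s \<noteq> 0) \<and> (\<Sum>y\<in>set ys. g y s) = k) \<or>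
          k = 0 \<and> \<not> (\<exists>ys. \<forall>y. y \<in> set ys \<longleftrightarrow> g y s \<noteq> 0)" for k s
    proof -
      have *: "(\<forall>y. y \<in> set ys \<longleftrightarrow> g y s \<noteq> 0) \<longleftrightarrow> set ys = {y. g y s \<noteq> 0}" for ys by auto
      show ?thesis
        unfolding * by (auto dest: finite_list)
    qed
    have q[measurable]: "Measurable.pred ?S (\<lambda>s. (\<Sum>y\<in>F. g y s) = k)" if "finite F" for F k
    proof -
      have "(\<lambda>s. \<Sum>y\<in>F. g y s) \<in> ?S \<rightarrow>\<^sub>M count_space UNIV"
        using that
      proof (induction F rule: finite_induct)
        case (insert y F)
        from measurable_nat_add[OF g insert.IH] insert.hyps show ?case by simp
      qed simp
      from measurable_compose[OF this, of "\<lambda>m. m = k" "count_space UNIV"] show ?thesis by simp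
    qed
    have "Measurable.pred ?S (\<lambda>s. (\<exists>ys. (\<forall>y. y \<in> set ys \<longleftrightarrow> g y s \<noteq> 0) \<and> (\<Sum>y\<in>set ys. g y s) = k) \<or>
          k = 0 \<and> \<not> (\<exists>ys. \<forall>y. y \<in> set ys \<longleftrightarrow> g y s \<noteq> 0))" for k
      by measurable
    then have "{s \<in> space ?S. (if finite {y. g y s \<noteq> 0} then \<Sum>y | g y s \<noteq> 0. g y s else 0) = k} \<in> sets ?S" for k
      unfolding e by (rule predE)
    then show ?thesis
      by (subst measurable_count_space_eq2_countable) (auto simp: vimage_def Int_def conj_commute)
  qed
  ultimately show "(\<lambda>s. eta n s x) \<in> ?S \<rightarrow>\<^sub>M borel"
    by (simp add: measurable_cong_sets[OF refl sets_borel_eq_count_space])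
qed

lemma measurable_pi_alpha:
  "(\<lambda>\<omega>. measure_pmf (pi_alpha \<alpha> \<omega>)) \<in> env_space \<rightarrow>\<^sub>M prob_algebra (count_space UNIV)"
proof (rule measurable_prob_algebraI, simp add: prob_space_measure_pmf, rule measurable_subprob_algebra)
  note [measurable] = measurable_component_env
  fix A :: "nat set"
  have [measurable]: "env_f \<in> borel_measurable env_space"
    unfolding env_f_def[abs_def] rho_def[abs_def] by measurable
  have p: "pmf (poisson r) k = (if r > 0 then r ^ k / fact k * exp (- r) else of_bool (k = 0))" for r k
    by (simp add: poisson_def)
  have [measurable]: "(\<lambda>\<omega>. pmf (pi_alpha \<alpha> \<omega>) k) \<in> borel_measurable env_space" for k
    unfolding pi_alpha_def p by measurable
  have "emeasure (measure_pmf q) A = (\<Sum>k. ennreal (pmf q k) * indicator A k)" for q :: "nat pmf"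
    by (simp add: nn_integral_indicator[of A "measure_pmf q", symmetric] nn_integral_measure_pmf
         nn_integral_count_space_nat del: nn_integral_indicator)
  then show "(\<lambda>\<omega>. emeasure (measure_pmf (pi_alpha \<alpha> \<omega>)) A) \<in> borel_measurable env_space"
    by simp
qed (auto simp: measure_pmf.subprob_space_axioms)

lemma
  assumes "prob_space P" "sets P = sets env_space"
    and "(\<lambda>\<omega>. measure_pmf (\<nu> \<omega>)) \<in> env_space \<rightarrow>\<^sub>M prob_algebra (count_space UNIV)"
  shows prob_space_annealed: "prob_space (annealed P \<nu>)"
    and sets_annealed: "sets (annealed P \<nu>) = sets
      ((\<Pi>\<^sub>M x\<in>UNIV. count_space UNIV) \<Otimes>\<^sub>M (\<Pi>\<^sub>M j\<in>UNIV \<times> {1..}. \<Pi>\<^sub>M n\<in>UNIV. count_space UNIV))"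
    and emeasure_annealed: "A \<in> sets (annealed P \<nu>) \<Longrightarrow> emeasure (annealed P \<nu>) A = (\<integral>\<^sup>+\<omega>. emeasure (quenched \<nu> \<omega>) A \<partial>P)"
proof -
  have P: "P \<in> space (prob_algebra env_space)" using assms by (simp add: space_prob_algebra)
  note Q = measurable_quenched[OF assms(3)]
  show "prob_space (annealed P \<nu>)" unfolding annealed_def by (rule prob_space_bind'[OF P Q])
  show s: "sets (annealed P \<nu>) = sets
      ((\<Pi>\<^sub>M x\<in>UNIV. count_space UNIV) \<Otimes>\<^sub>M (\<Pi>\<^sub>M j\<in>UNIV \<times> {1..}. \<Pi>\<^sub>M n\<in>UNIV. count_space UNIV))"
    unfolding annealed_def by (rule sets_bind'[OF P Q])
  show "A \<in> sets (annealed P \<nu>) \<Longrightarrow> emeasure (annealed P \<nu>) A = (\<integral>\<^sup>+\<omega>. emeasure (quenched \<nu> \<omega>) A \<partial>P)"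
    unfolding s unfolding annealed_def by (rule emeasure_bind_prob_algebra[OF P Q])
qed

lemma measurable_eta0:
  "eta0 \<in> (\<Pi>\<^sub>M x\<in>UNIV. count_space UNIV) \<Otimes>\<^sub>M (\<Pi>\<^sub>M j\<in>UNIV \<times> {1..}. \<Pi>\<^sub>M n\<in>UNIV. count_space UNIV) \<rightarrow>\<^sub>M borel"
  by (rule measurable_coordinatewise_then_product)
     (simp add: measurable_cong_sets[OF refl sets_borel_eq_count_space])

end

theory Submission
  imports Defs "HOL-Real_Asymp.Real_Asymp"
begin

text \<open>
  For a finite set \<open>J\<close> of sites and \<open>0 \<le> s x \<le> 1\<close>, the quenched expectation of \<open>\<Prod>x\<in>J. s x ^ \<eta>\<^sub>n x\<close> is a
  product over the starting sites, and it is close to the exponential of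
  \<open>- (\<Sum>x\<in>J. (1 - s x) * u\<^sub>n x)\<close>, where \<open>u\<^sub>n x\<close> is the quenched mean number of particles at \<open>x\<close>, as
  soon as the transition probabilities are small. So everything reduces to the \<open>L\<^sup>1(P)\<close>-convergence of
  \<open>u\<^sub>n 0 = push\<^sup>n m\<close> to \<open>\<alpha> * env_f\<close>, where \<open>m\<close> is the mean of \<open>\<nu>\<close>.

  Since \<open>env_f\<close> is a fixed point of \<open>push\<close>, the ratio \<open>u\<^sub>n / env_f\<close> evolves by a two-point Markov operator
  \<open>T\<close> (the time reversal of the environment chain) on \<open>L\<^sup>2\<close> of the invariant law. It loses energy at
  a rate controlled by the gradient \<open>v (shift 1 \<omega>) - v (shift (-1) \<omega>)\<close>; hence the gradients of
  \<open>T\<^sup>n v\<close> tend to \<open>0\<close>, and so does \<open>T\<^sup>n (T\<^sup>2 v - v)\<close>. By the mean ergodic theorem for \<open>T\<^sup>2\<close>, whose fixed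
  points have zero gradient and are therefore constant by mixing, \<open>T\<^sup>n v\<close> converges to the mean of \<open>v\<close>.
  The same energy estimate for a fixed environment shows that the transition probabilities are
  uniformly small.
\<close>

subsection \<open>Two-point Markov operators\<close>

text \<open>Why the limit depends on \<open>\<nu>\<close> only through its mean: \<open>push\<close>
  preserves the \<open>P\<close>-integral and \<open>env_f\<close> has integral
  \<open>1 / speed P\<close>, so \<open>\<alpha>\<close> is forced once the quenched means converge
  to a multiple of \<open>env_f\<close>; small transition probabilities then make every starting
  site a source of rare events, which erases the rest of the initial law. Two obstacles shape the
  proof. The first is parity: the walk changes parity at each step, so the energy loss controls only
  differences across two sites. Hence the even powers of \<open>T\<close>, and hence mixing:
  ergodicity of a shift does not pass to its square, mixing does. The second is that
  \<open>\<nu>\<close> has a first moment and nothing more. The L^2 theory is applied to truncated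
  ratios, and the L^1 contraction of \<open>push\<close> removes the truncation; the Poisson error
  is a second moment truncated at scale \<open>1 / \<delta>\<close>. Mass cannot escape in the weak
  limit because the limit is known in advance to be a probability measure, so convergence of
  generating functions suffices.\<close>

locale two_point_operator =
  fixes Q :: "'a measure" and \<theta> \<theta>' :: "'a \<Rightarrow> 'a" and p :: "'a \<Rightarrow> real" and \<kappa> :: real
  assumes measurable_fwd [measurable]: "\<theta> \<in> Q \<rightarrow>\<^sub>M Q"
    and measurable_bwd [measurable]: "\<theta>' \<in> Q \<rightarrow>\<^sub>M Q"
    and measurable_p [measurable]: "p \<in> borel_measurable Q"
    and fwd_bwd [simp]: "\<And>\<omega>. \<theta> (\<theta>' \<omega>) = \<omega>"
    and bwd_fwd [simp]: "\<And>\<omega>. \<theta>' (\<theta> \<omega>) = \<omega>"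
    and kappa_pos: "\<kappa> > 0"
    and p_ge: "\<And>\<omega>. \<kappa> \<le> p \<omega>"
    and p_le: "\<And>\<omega>. p \<omega> \<le> 1 - \<kappa>"
    and invariant: "\<And>v :: 'a \<Rightarrow> real. integrable Q v \<Longrightarrow>
       integrable Q (\<lambda>\<omega>. p \<omega> * v (\<theta> \<omega>) + (1 - p \<omega>) * v (\<theta>' \<omega>)) \<and>
       (\<integral>\<omega>. p \<omega> * v (\<theta> \<omega>) + (1 - p \<omega>) * v (\<theta>' \<omega>) \<partial>Q) = (\<integral>\<omega>. v \<omega> \<partial>Q)"
begin

text \<open>\<open>Q\<close> may have infinite mass in this locale: the operator is used on the law
  of the environment and also on a weighted counting measure on the integers. The bounds on
  \<open>p\<close> hold at every point, so the estimates are free of exceptional sets;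
  \<open>rev_p\<close> is clamped later to meet them.\<close>

definition T :: "('a \<Rightarrow> real) \<Rightarrow> 'a \<Rightarrow> real" where
  "T v = (\<lambda>\<omega>. p \<omega> * v (\<theta> \<omega>) + (1 - p \<omega>) * v (\<theta>' \<omega>))"

lemma p_nonneg: "0 \<le> p \<omega>" and p_le_1: "p \<omega> \<le> 1"
  using p_ge[of \<omega>] p_le[of \<omega>] kappa_pos by auto

lemma integrable_T: "integrable Q v \<Longrightarrow> integrable Q (T v)"
  and integral_T: "integrable Q v \<Longrightarrow> (\<integral>\<omega>. T v \<omega> \<partial>Q) = (\<integral>\<omega>. v \<omega> \<partial>Q)"
  using invariant[of v] by (auto simp: T_def)

lemma measurable_T [measurable]:
  assumes [measurable]: "v \<in> borel_measurable Q"
  shows "T v \<in> borel_measurable Q"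
  unfolding T_def by measurable

lemma T_add: "T (\<lambda>\<omega>. u \<omega> + v \<omega>) = (\<lambda>\<omega>. T u \<omega> + T v \<omega>)"
  by (auto simp: T_def algebra_simps)

lemma T_diff: "T (\<lambda>\<omega>. u \<omega> - v \<omega>) = (\<lambda>\<omega>. T u \<omega> - T v \<omega>)"
  by (auto simp: T_def algebra_simps)

lemma T_const: "T (\<lambda>\<omega>. a) = (\<lambda>\<omega>. a)"
  by (auto simp: T_def algebra_simps)

lemma T_cmult: "T (\<lambda>\<omega>. a * v \<omega>) = (\<lambda>\<omega>. a * T v \<omega>)"
  by (auto simp: T_def algebra_simps)

lemma T_sum: "T (\<lambda>\<omega>. \<Sum>j\<in>J. v j \<omega>) = (\<lambda>\<omega>. \<Sum>j\<in>J. T (v j) \<omega>)"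
proof (induction J rule: infinite_finite_induct)
  case (insert j J)
  then show ?case by (simp add: T_add)
qed (simp_all add: T_const)

lemma T_mono: "(\<And>\<omega>. u \<omega> \<le> v \<omega>) \<Longrightarrow> T u \<omega> \<le> T v \<omega>"
  unfolding T_def by (intro add_mono mult_left_mono) (auto simp: p_nonneg p_le_1)

lemma abs_T_le: "\<bar>T v \<omega>\<bar> \<le> T (\<lambda>\<omega>. \<bar>v \<omega>\<bar>) \<omega>"
  unfolding T_def by (rule order_trans[OF abs_triangle_ineq]) (simp add: abs_mult p_nonneg p_le_1)

lemma abs_T_bound: "(\<And>\<omega>. \<bar>v \<omega>\<bar> \<le> B) \<Longrightarrow> \<bar>T v \<omega>\<bar> \<le> B"
  using abs_T_le[of v \<omega>] T_mono[of "\<lambda>\<omega>. \<bar>v \<omega>\<bar>" "\<lambda>_. B" \<omega>] by (simp add: T_const)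

lemma measurable_T_pow [measurable]: "v \<in> borel_measurable Q \<Longrightarrow> (T ^^ n) v \<in> borel_measurable Q"
  by (induction n) auto

lemma integrable_T_pow: "integrable Q v \<Longrightarrow> integrable Q ((T ^^ n) v)"
  by (induction n) (auto intro: integrable_T)

lemma integral_T_pow: "integrable Q v \<Longrightarrow> (\<integral>\<omega>. (T ^^ n) v \<omega> \<partial>Q) = (\<integral>\<omega>. v \<omega> \<partial>Q)"
  by (induction n) (auto simp: integral_T integrable_T_pow)

lemma abs_T_pow_bound: "(\<And>\<omega>. \<bar>v \<omega>\<bar> \<le> B) \<Longrightarrow> \<bar>(T ^^ n) v \<omega>\<bar> \<le> B"
  by (induction n arbitrary: \<omega>) (auto intro: abs_T_bound)

lemma T_pow_diff: "(T ^^ n) (\<lambda>\<omega>. u \<omega> - v \<omega>) = (\<lambda>\<omega>. (T ^^ n) u \<omega> - (T ^^ n) v \<omega>)"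
  by (induction n) (simp_all add: T_diff)

lemma T_pow_const: "(T ^^ n) (\<lambda>\<omega>. a) = (\<lambda>\<omega>. a)"
  by (induction n) (simp_all add: T_const)

lemma T_pow_cmult: "(T ^^ n) (\<lambda>\<omega>. a * v \<omega>) = (\<lambda>\<omega>. a * (T ^^ n) v \<omega>)"
  by (induction n) (simp_all add: T_cmult)

lemma T_pow_sum: "(T ^^ n) (\<lambda>\<omega>. \<Sum>j\<in>J. v j \<omega>) = (\<lambda>\<omega>. \<Sum>j\<in>J. (T ^^ n) (v j) \<omega>)"
  by (induction n) (simp_all add: T_sum)

lemma integral_abs_T_le:
  assumes "integrable Q v"
  shows "(\<integral>\<omega>. \<bar>T v \<omega>\<bar> \<partial>Q) \<le> (\<integral>\<omega>. \<bar>v \<omega>\<bar> \<partial>Q)"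
proof -
  have "(\<integral>\<omega>. \<bar>T v \<omega>\<bar> \<partial>Q) \<le> (\<integral>\<omega>. T (\<lambda>\<omega>. \<bar>v \<omega>\<bar>) \<omega> \<partial>Q)"
    using assms by (intro integral_mono abs_T_le integrable_abs integrable_T) auto
  then show ?thesis using assms by (simp add: integral_T)
qed

lemma integral_abs_T_pow_le:
  assumes "integrable Q v"
  shows "(\<integral>\<omega>. \<bar>(T ^^ n) v \<omega>\<bar> \<partial>Q) \<le> (\<integral>\<omega>. \<bar>v \<omega>\<bar> \<partial>Q)"
  by (induction n) (auto intro: order_trans[OF integral_abs_T_le] integrable_T_pow assms)

section \<open>Energy dissipation\<close>

definition grad :: "('a \<Rightarrow> real) \<Rightarrow> 'a \<Rightarrow> real" where
  "grad v = (\<lambda>\<omega>. v (\<theta> \<omega>) - v (\<theta>' \<omega>))"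

lemma measurable_grad [measurable]:
  assumes [measurable]: "v \<in> borel_measurable Q"
  shows "grad v \<in> borel_measurable Q"
  unfolding grad_def by measurable

text \<open>This is the variance of a two-point law: the gap in Jensen's inequality is known
  exactly, not just its sign.\<close>

lemma T_square: "(T v \<omega>)\<^sup>2 + p \<omega> * (1 - p \<omega>) * (grad v \<omega>)\<^sup>2 = T (\<lambda>\<omega>. (v \<omega>)\<^sup>2) \<omega>"
  unfolding T_def grad_def by (simp add: power2_eq_square algebra_simps)

lemma kappa_sq_le: "\<kappa>\<^sup>2 \<le> p \<omega> * (1 - p \<omega>)"
  unfolding power2_eq_square using p_ge[of \<omega>] p_le[of \<omega>] kappa_pos
  by (intro mult_mono) auto

lemma T_square_ge: "(T v \<omega>)\<^sup>2 + \<kappa>\<^sup>2 * (grad v \<omega>)\<^sup>2 \<le> T (\<lambda>\<omega>. (v \<omega>)\<^sup>2) \<omega>"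
  using T_square[of v \<omega>] mult_right_mono[OF kappa_sq_le[of \<omega>], of "(grad v \<omega>)\<^sup>2"] by simp

text \<open>Integrate \<open>T_square_ge\<close>; invariance turns the integral of \<open>T\<close>
  of the square into the energy of \<open>v\<close>. The same pointwise bound dominates both
  nonnegative summands by an integrable function, which yields the two integrability claims.\<close>

lemma
  assumes [measurable]: "v \<in> borel_measurable Q" and v: "integrable Q (\<lambda>\<omega>. (v \<omega>)\<^sup>2)"
  shows integrable_T_square: "integrable Q (\<lambda>\<omega>. (T v \<omega>)\<^sup>2)"
    and integrable_grad_square: "integrable Q (\<lambda>\<omega>. (grad v \<omega>)\<^sup>2)"
    and energy_dissipation:
      "(\<integral>\<omega>. (T v \<omega>)\<^sup>2 \<partial>Q) + \<kappa>\<^sup>2 * (\<integral>\<omega>. (grad v \<omega>)\<^sup>2 \<partial>Q) \<le> (\<integral>\<omega>. (v \<omega>)\<^sup>2 \<partial>Q)"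
proof -
  note I = integrable_T[OF v]
  show 1: "integrable Q (\<lambda>\<omega>. (T v \<omega>)\<^sup>2)"
  proof (rule Bochner_Integration.integrable_bound[OF I])
    show "AE \<omega> in Q. norm ((T v \<omega>)\<^sup>2) \<le> norm (T (\<lambda>\<omega>. (v \<omega>)\<^sup>2) \<omega>)"
    proof (rule AE_I2)
      fix \<omega>
      have "0 \<le> \<kappa>\<^sup>2 * (grad v \<omega>)\<^sup>2" by simp
      then have "(T v \<omega>)\<^sup>2 \<le> T (\<lambda>\<omega>. (v \<omega>)\<^sup>2) \<omega>"
        using T_square_ge[of v \<omega>] by linarith
      then show "norm ((T v \<omega>)\<^sup>2) \<le> norm (T (\<lambda>\<omega>. (v \<omega>)\<^sup>2) \<omega>)" by simp
    qed
  qed simp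
  have "integrable Q (\<lambda>\<omega>. \<kappa>\<^sup>2 * (grad v \<omega>)\<^sup>2)"
  proof (rule Bochner_Integration.integrable_bound[OF I])
    show "AE \<omega> in Q. norm (\<kappa>\<^sup>2 * (grad v \<omega>)\<^sup>2) \<le> norm (T (\<lambda>\<omega>. (v \<omega>)\<^sup>2) \<omega>)"
    proof (rule AE_I2)
      fix \<omega>
      have "0 \<le> (T v \<omega>)\<^sup>2" by simp
      then have "\<kappa>\<^sup>2 * (grad v \<omega>)\<^sup>2 \<le> T (\<lambda>\<omega>. (v \<omega>)\<^sup>2) \<omega>"
        using T_square_ge[of v \<omega>] by linarith
      then show "norm (\<kappa>\<^sup>2 * (grad v \<omega>)\<^sup>2) \<le> norm (T (\<lambda>\<omega>. (v \<omega>)\<^sup>2) \<omega>)" by (simp add: abs_mult)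
    qed
  qed simp
  then show 2: "integrable Q (\<lambda>\<omega>. (grad v \<omega>)\<^sup>2)" using kappa_pos by simp
  have "(\<integral>\<omega>. (T v \<omega>)\<^sup>2 \<partial>Q) + \<kappa>\<^sup>2 * (\<integral>\<omega>. (grad v \<omega>)\<^sup>2 \<partial>Q)
      = (\<integral>\<omega>. (T v \<omega>)\<^sup>2 + \<kappa>\<^sup>2 * (grad v \<omega>)\<^sup>2 \<partial>Q)"
    using 1 2 by simp
  also have "\<dots> \<le> (\<integral>\<omega>. T (\<lambda>\<omega>. (v \<omega>)\<^sup>2) \<omega> \<partial>Q)"
    using 1 2 I by (intro integral_mono T_square_ge) auto
  also have "\<dots> = (\<integral>\<omega>. (v \<omega>)\<^sup>2 \<partial>Q)" by (rule integral_T[OF v])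
  finally show "(\<integral>\<omega>. (T v \<omega>)\<^sup>2 \<partial>Q) + \<kappa>\<^sup>2 * (\<integral>\<omega>. (grad v \<omega>)\<^sup>2 \<partial>Q) \<le> (\<integral>\<omega>. (v \<omega>)\<^sup>2 \<partial>Q)" .
qed

lemma integrable_T_pow_square:
  assumes [measurable]: "v \<in> borel_measurable Q" and v: "integrable Q (\<lambda>\<omega>. (v \<omega>)\<^sup>2)"
  shows "integrable Q (\<lambda>\<omega>. ((T ^^ n) v \<omega>)\<^sup>2)"
  by (induction n) (auto intro!: integrable_T_square v)

lemma sum_energy_dissipation:
  assumes [measurable]: "v \<in> borel_measurable Q" and v: "integrable Q (\<lambda>\<omega>. (v \<omega>)\<^sup>2)"
  shows "(\<integral>\<omega>. ((T ^^ n) v \<omega>)\<^sup>2 \<partial>Q) + \<kappa>\<^sup>2 * (\<Sum>k<n. \<integral>\<omega>. (grad ((T ^^ k) v) \<omega>)\<^sup>2 \<partial>Q) \<le> (\<integral>\<omega>. (v \<omega>)\<^sup>2 \<partial>Q)"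
proof (induction n)
  case (Suc n)
  have "(\<integral>\<omega>. (T ((T ^^ n) v) \<omega>)\<^sup>2 \<partial>Q) + \<kappa>\<^sup>2 * (\<integral>\<omega>. (grad ((T ^^ n) v) \<omega>)\<^sup>2 \<partial>Q) \<le> (\<integral>\<omega>. ((T ^^ n) v \<omega>)\<^sup>2 \<partial>Q)"
    by (intro energy_dissipation integrable_T_pow_square v) auto
  with Suc show ?case by (simp add: distrib_left)
qed simp

lemma integral_T_pow_square_antimono:
  assumes [measurable]: "v \<in> borel_measurable Q" and v: "integrable Q (\<lambda>\<omega>. (v \<omega>)\<^sup>2)" and "k \<le> n"
  shows "(\<integral>\<omega>. ((T ^^ n) v \<omega>)\<^sup>2 \<partial>Q) \<le> (\<integral>\<omega>. ((T ^^ k) v \<omega>)\<^sup>2 \<partial>Q)"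
  using \<open>k \<le> n\<close>
proof (induction n rule: dec_induct)
  case (step n)
  have "(\<integral>\<omega>. (T ((T ^^ n) v) \<omega>)\<^sup>2 \<partial>Q) + \<kappa>\<^sup>2 * (\<integral>\<omega>. (grad ((T ^^ n) v) \<omega>)\<^sup>2 \<partial>Q) \<le> (\<integral>\<omega>. ((T ^^ n) v \<omega>)\<^sup>2 \<partial>Q)"
    by (intro energy_dissipation integrable_T_pow_square v) auto
  moreover have "0 \<le> \<kappa>\<^sup>2 * (\<integral>\<omega>. (grad ((T ^^ n) v) \<omega>)\<^sup>2 \<partial>Q)" by simp
  ultimately have "(\<integral>\<omega>. (T ((T ^^ n) v) \<omega>)\<^sup>2 \<partial>Q) \<le> (\<integral>\<omega>. ((T ^^ k) v \<omega>)\<^sup>2 \<partial>Q)"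
    using step.IH by linarith
  then show ?case by simp
qed simp

text \<open>The losses telescope, so their sum is at most the initial energy over the square of
  \<open>\<kappa>\<close>, and the terms of a convergent series vanish.\<close>

lemma grad_tendsto_0:
  assumes [measurable]: "v \<in> borel_measurable Q" and v: "integrable Q (\<lambda>\<omega>. (v \<omega>)\<^sup>2)"
  shows "(\<lambda>n. \<integral>\<omega>. (grad ((T ^^ n) v) \<omega>)\<^sup>2 \<partial>Q) \<longlonglongrightarrow> 0"
proof (rule summable_LIMSEQ_zero, rule summableI_nonneg_bounded)
  fix n
  have "0 \<le> (\<integral>\<omega>. ((T ^^ n) v \<omega>)\<^sup>2 \<partial>Q)" by simp
  then have "\<kappa>\<^sup>2 * (\<Sum>k<n. \<integral>\<omega>. (grad ((T ^^ k) v) \<omega>)\<^sup>2 \<partial>Q) \<le> (\<integral>\<omega>. (v \<omega>)\<^sup>2 \<partial>Q)"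
    using sum_energy_dissipation[OF assms, of n] by linarith
  then show "(\<Sum>k<n. \<integral>\<omega>. (grad ((T ^^ k) v) \<omega>)\<^sup>2 \<partial>Q) \<le> (\<integral>\<omega>. (v \<omega>)\<^sup>2 \<partial>Q) / \<kappa>\<^sup>2"
    using kappa_pos by (simp add: field_simps)
qed simp

text \<open>Two steps either return to the start or move two sites away. Subtracting
  \<open>v \<omega>\<close> removes the returns and leaves differences across two sites, which are
  gradients at the neighbours of \<open>\<omega>\<close>. For \<open>T v - v\<close> there is no
  such bound, as the function 1 on even and -1 on odd integers shows.\<close>

lemma abs_T_T_diff_le: "\<bar>T (T v) \<omega> - v \<omega>\<bar> \<le> T (\<lambda>\<omega>. \<bar>grad v \<omega>\<bar>) \<omega>"
proof -
  have "T (T v) \<omega> - v \<omega> = p \<omega> * (p (\<theta> \<omega>) * grad v (\<theta> \<omega>)) - (1 - p \<omega>) * ((1 - p (\<theta>' \<omega>)) * grad v (\<theta>' \<omega>))"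
    unfolding T_def grad_def by (simp add: algebra_simps)
  also have "\<bar>\<dots>\<bar> \<le> p \<omega> * \<bar>p (\<theta> \<omega>) * grad v (\<theta> \<omega>)\<bar> + (1 - p \<omega>) * \<bar>(1 - p (\<theta>' \<omega>)) * grad v (\<theta>' \<omega>)\<bar>"
    by (rule order_trans[OF abs_triangle_ineq4]) (simp add: abs_mult p_nonneg p_le_1)
  also have "\<dots> \<le> p \<omega> * \<bar>grad v (\<theta> \<omega>)\<bar> + (1 - p \<omega>) * \<bar>grad v (\<theta>' \<omega>)\<bar>"
    by (intro add_mono mult_left_mono) (auto simp: p_nonneg p_le_1 abs_mult intro!: mult_left_le_one_le)
  finally show ?thesis by (simp add: T_def)
qed

end

section \<open>The mean ergodic theorem for even powers and convergence of all powers\<close>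

locale ergodic_two_point_operator = two_point_operator + prob_space Q +
  assumes ergodic: "\<And>v :: 'a \<Rightarrow> real. v \<in> borel_measurable Q \<Longrightarrow> (AE \<omega> in Q. v (\<theta> \<omega>) = v (\<theta>' \<omega>)) \<Longrightarrow>
     \<exists>a. AE \<omega> in Q. v \<omega> = a"
begin

definition avg :: "nat \<Rightarrow> ('a \<Rightarrow> real) \<Rightarrow> 'a \<Rightarrow> real" where
  "avg K v = (\<lambda>\<omega>. (\<Sum>k<K. (T ^^ (2 * k)) v \<omega>) / K)"

lemma measurable_avg [measurable]:
  assumes [measurable]: "v \<in> borel_measurable Q"
  shows "avg K v \<in> borel_measurable Q"
  unfolding avg_def by measurable

lemma integrable_bounded:
  fixes v :: "'a \<Rightarrow> real"
  assumes "v \<in> borel_measurable Q" "\<And>\<omega>. \<bar>v \<omega>\<bar> \<le> B"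
  shows "integrable Q v"
  by (rule integrable_const_bound[of _ B]) (use assms in auto)

lemma integrable_square_bounded:
  fixes v :: "'a \<Rightarrow> real"
  assumes "v \<in> borel_measurable Q" "\<And>\<omega>. \<bar>v \<omega>\<bar> \<le> B"
  shows "integrable Q (\<lambda>\<omega>. (v \<omega>)\<^sup>2)"
proof (rule integrable_bounded[of _ "B\<^sup>2"])
  show "\<bar>(v \<omega>)\<^sup>2\<bar> \<le> B\<^sup>2" for \<omega>
    using assms(2)[of \<omega>] by (simp add: abs_le_square_iff[symmetric])
qed (use assms(1) in simp)

lemma abs_avg_bound:
  assumes "\<And>\<omega>. \<bar>v \<omega>\<bar> \<le> B"
  shows "\<bar>avg K v \<omega>\<bar> \<le> B"
proof (cases "K = 0")
  case True
  then show ?thesis using order_trans[OF abs_ge_zero assms] by (simp add: avg_def)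
next
  case False
  have "\<bar>\<Sum>k<K. (T ^^ (2 * k)) v \<omega>\<bar> \<le> (\<Sum>k<K. \<bar>(T ^^ (2 * k)) v \<omega>\<bar>)"
    by (rule sum_abs)
  also have "\<dots> \<le> (\<Sum>k<K. B)" by (intro sum_mono abs_T_pow_bound assms)
  finally show ?thesis using False by (simp add: avg_def divide_simps mult.commute)
qed

lemma avg_diff: "avg K (\<lambda>\<omega>. u \<omega> - v \<omega>) = (\<lambda>\<omega>. avg K u \<omega> - avg K v \<omega>)"
  by (simp add: avg_def T_pow_diff sum_subtractf diff_divide_distrib)

lemma avg_cmult: "avg K (\<lambda>\<omega>. a * v \<omega>) = (\<lambda>\<omega>. a * avg K v \<omega>)"
  by (simp add: avg_def T_pow_cmult sum_distrib_left)

lemma T_pow_avg: "(T ^^ n) (avg K v) \<omega> = (\<Sum>k<K. (T ^^ (n + 2 * k)) v \<omega>) / K"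
  using T_pow_cmult[of n "1 / K" "\<lambda>\<omega>. \<Sum>k<K. (T ^^ (2 * k)) v \<omega>"]
  by (simp add: avg_def T_pow_sum funpow_add)

text \<open>Two more applications of \<open>T\<close> inside the average exchange its first term for
  a new last one, at a cost of two terms of size \<open>B\<close> out of \<open>M\<close>;
  \<open>j\<close> such shifts cost \<open>j\<close> times as much.\<close>

lemma avg_T_pow_diff_le:
  assumes "\<And>\<omega>. \<bar>v \<omega>\<bar> \<le> B"
  shows "\<bar>avg M ((T ^^ (2 * j)) v) \<omega> - avg M v \<omega>\<bar> \<le> 2 * real j * B / M"
proof (induction j)
  case (Suc j)
  let ?a = "\<lambda>k. (T ^^ (2 * (k + j))) v \<omega>"
  have "avg M ((T ^^ (2 * Suc j)) v) \<omega> - avg M ((T ^^ (2 * j)) v) \<omega> = (\<Sum>k<M. ?a (Suc k) - ?a k) / M"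
    by (simp add: avg_def sum_subtractf diff_divide_distrib funpow_add distrib_left
          funpow_swap1)
  also have "\<dots> = (?a M - ?a 0) / M"
    by (subst sum_lessThan_telescope) simp
  also have "\<bar>\<dots>\<bar> \<le> 2 * B / M"
    using abs_T_pow_bound[of v B "2 * (M + j)" \<omega>] abs_T_pow_bound[of v B "2 * (0 + j)" \<omega>] assms
    by (auto simp: abs_divide intro!: divide_right_mono)
  finally show ?case using Suc by (simp add: distrib_right add_divide_distrib)
qed simp

text \<open>Interchanging the sums shows that \<open>avg M (avg K v)\<close> is a mean over
  \<open>j < K\<close> of averages of shifted orbits, each close to \<open>avg M v\<close>. For
  fixed \<open>K\<close> the error vanishes as \<open>M\<close> grows.\<close>

lemma avg_avg_diff_le:
  assumes "\<And>\<omega>. \<bar>v \<omega>\<bar> \<le> B" "K > 0"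
  shows "\<bar>avg M (avg K v) \<omega> - avg M v \<omega>\<bar> \<le> 2 * real K * B / M"
proof -
  have B: "0 \<le> B" using order_trans[OF abs_ge_zero assms(1)] .
  have "avg M (avg K v) \<omega> = (\<Sum>k<M. (\<Sum>j<K. (T ^^ (2 * k + 2 * j)) v \<omega>) / K) / M"
    by (simp add: avg_def[of M "avg K v"] T_pow_avg)
  also have "\<dots> = (\<Sum>j<K. avg M ((T ^^ (2 * j)) v) \<omega>) / K"
    unfolding avg_def sum_divide_distrib by (subst sum.swap) (simp add: funpow_add mult.commute)
  finally have eq: "avg M (avg K v) \<omega> - avg M v \<omega> = (\<Sum>j<K. avg M ((T ^^ (2 * j)) v) \<omega> - avg M v \<omega>) / K"
    using \<open>K > 0\<close> by (simp add: sum_subtractf diff_divide_distrib)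
  have "\<bar>avg M (avg K v) \<omega> - avg M v \<omega>\<bar> \<le> (\<Sum>j<K. \<bar>avg M ((T ^^ (2 * j)) v) \<omega> - avg M v \<omega>\<bar>) / K"
    unfolding eq by (simp add: abs_divide divide_right_mono sum_abs)
  also have "(\<Sum>j<K. \<bar>avg M ((T ^^ (2 * j)) v) \<omega> - avg M v \<omega>\<bar>) / K \<le> (\<Sum>j<K. 2 * real K * B / M) / K"
  proof (rule divide_right_mono)
    show "(\<Sum>j<K. \<bar>avg M ((T ^^ (2 * j)) v) \<omega> - avg M v \<omega>\<bar>) \<le> (\<Sum>j<K. 2 * real K * B / M)"
    proof (rule sum_mono)
      fix j assume "j \<in> {..<K}"
      then have "2 * real j * B \<le> 2 * real K * B" using B by (intro mult_right_mono) auto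
    then have "2 * real j * B / M \<le> 2 * real K * B / M" by (rule divide_right_mono) simp
    with avg_T_pow_diff_le[where v=v and M=M and j=j and \<omega>=\<omega>, OF assms(1)]
    show "\<bar>avg M ((T ^^ (2 * j)) v) \<omega> - avg M v \<omega>\<bar> \<le> 2 * real K * B / M"
      by (rule order_trans)
    qed
  qed simp
  also have "\<dots> = 2 * real K * B / M" using \<open>K > 0\<close> by simp
  finally show ?thesis .
qed

text \<open>Cauchy-Schwarz over the \<open>M\<close> terms; then each power of \<open>T\<close>
  contracts the energy.\<close>

lemma integral_avg_square_le:
  assumes [measurable]: "w \<in> borel_measurable Q" and w: "\<And>\<omega>. \<bar>w \<omega>\<bar> \<le> B"
  shows "(\<integral>\<omega>. (avg M w \<omega>)\<^sup>2 \<partial>Q) \<le> (\<integral>\<omega>. (w \<omega>)\<^sup>2 \<partial>Q)"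
proof (cases "M = 0")
  case False
  note sq = integrable_square_bounded[where B=B]
  have "(\<integral>\<omega>. (avg M w \<omega>)\<^sup>2 \<partial>Q) \<le> (\<integral>\<omega>. (\<Sum>k<M. ((T ^^ (2 * k)) w \<omega>)\<^sup>2) / M \<partial>Q)"
  proof (rule integral_mono)
    show "integrable Q (\<lambda>\<omega>. (avg M w \<omega>)\<^sup>2)" by (rule sq) (auto intro: abs_avg_bound w)
    show "integrable Q (\<lambda>\<omega>. (\<Sum>k<M. ((T ^^ (2 * k)) w \<omega>)\<^sup>2) / M)"
      by (intro integrable_divide Bochner_Integration.integrable_sum sq abs_T_pow_bound w) auto
    fix \<omega>
    have "(\<Sum>k<M. (T ^^ (2 * k)) w \<omega>)\<^sup>2 \<le> (\<Sum>k<M. ((T ^^ (2 * k)) w \<omega>)\<^sup>2) * M"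
      using sum_squared_le_sum_of_squares[of "\<lambda>k. (T ^^ (2 * k)) w \<omega>" "{..<M}"] by simp
    then show "(avg M w \<omega>)\<^sup>2 \<le> (\<Sum>k<M. ((T ^^ (2 * k)) w \<omega>)\<^sup>2) / M"
      using False by (simp add: avg_def power_divide divide_simps power2_eq_square)
  qed
  also have "\<dots> = (\<Sum>k<M. \<integral>\<omega>. ((T ^^ (2 * k)) w \<omega>)\<^sup>2 \<partial>Q) / M"
    by (subst Bochner_Integration.integral_divide_zero, subst Bochner_Integration.integral_sum)
       (auto intro!: sq abs_T_pow_bound w)
  also have "\<dots> \<le> (\<Sum>k<M. \<integral>\<omega>. (w \<omega>)\<^sup>2 \<partial>Q) / M"
    using integral_T_pow_square_antimono[of w 0] sq[of w] w by (intro divide_right_mono sum_mono) auto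
  also have "\<dots> = (\<integral>\<omega>. (w \<omega>)\<^sup>2 \<partial>Q)" using False by simp
  finally show ?thesis .
qed (simp add: avg_def)

lemma integral_square_bounded_diff_le:
  fixes B :: real
  assumes [measurable]: "u \<in> borel_measurable Q" "v \<in> borel_measurable Q"
    and "\<And>\<omega>. \<bar>u \<omega>\<bar> \<le> B" "\<And>\<omega>. \<bar>v \<omega>\<bar> \<le> B" and d: "\<And>\<omega>. \<bar>u \<omega> - v \<omega>\<bar> \<le> d"
  shows "(\<integral>\<omega>. (u \<omega>)\<^sup>2 \<partial>Q) \<le> (\<integral>\<omega>. (v \<omega>)\<^sup>2 \<partial>Q) + 2 * B * d"
proof -
  note sq = integrable_square_bounded[where B=B]
  have "(\<integral>\<omega>. (u \<omega>)\<^sup>2 \<partial>Q) \<le> (\<integral>\<omega>. (v \<omega>)\<^sup>2 + 2 * B * d \<partial>Q)"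
  proof (rule integral_mono)
    fix \<omega>
    have "(u \<omega>)\<^sup>2 - (v \<omega>)\<^sup>2 = (u \<omega> - v \<omega>) * (u \<omega> + v \<omega>)" by (simp add: power2_eq_square algebra_simps)
    also have "\<dots> \<le> \<bar>u \<omega> - v \<omega>\<bar> * \<bar>u \<omega> + v \<omega>\<bar>" by (metis abs_ge_self abs_mult)
    also have "\<dots> \<le> d * (2 * B)"
      using assms(3)[of \<omega>] assms(4)[of \<omega>] d[of \<omega>] by (intro mult_mono) auto
    finally show "(u \<omega>)\<^sup>2 \<le> (v \<omega>)\<^sup>2 + 2 * B * d" by (simp add: algebra_simps)
  qed (use assms in \<open>auto intro!: sq\<close>)
  then show ?thesis using assms by (simp add: sq prob_space)
qed

text \<open>Pointwise, either the absolute value is at most \<open>\<epsilon>\<close> or it is at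
  most the square over \<open>\<epsilon>\<close>. Once the energy is below the square of
  \<open>\<epsilon>\<close> the bound is below \<open>2 * \<epsilon>\<close>: this is how L^2
  estimates become L^1 estimates below.\<close>

lemma integral_abs_le_square:
  fixes B :: real
  assumes [measurable]: "u \<in> borel_measurable Q" and "\<And>\<omega>. \<bar>u \<omega>\<bar> \<le> B" and "\<epsilon> > 0"
  shows "(\<integral>\<omega>. \<bar>u \<omega>\<bar> \<partial>Q) \<le> \<epsilon> + (\<integral>\<omega>. (u \<omega>)\<^sup>2 \<partial>Q) / \<epsilon>"
proof -
  have sq: "integrable Q (\<lambda>\<omega>. (u \<omega>)\<^sup>2)"
    by (rule integrable_square_bounded[of u B]) (use assms in auto)
  have "(\<integral>\<omega>. \<bar>u \<omega>\<bar> \<partial>Q) \<le> (\<integral>\<omega>. \<epsilon> + (u \<omega>)\<^sup>2 / \<epsilon> \<partial>Q)"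
  proof (rule integral_mono)
    fix \<omega>
    show "\<bar>u \<omega>\<bar> \<le> \<epsilon> + (u \<omega>)\<^sup>2 / \<epsilon>"
    proof (cases "\<bar>u \<omega>\<bar> \<le> \<epsilon>")
      case True
      then show ?thesis using \<open>\<epsilon> > 0\<close> by (smt (verit) divide_nonneg_pos zero_le_power2)
    next
      case False
      then have "\<epsilon> * \<bar>u \<omega>\<bar> \<le> \<bar>u \<omega>\<bar> * \<bar>u \<omega>\<bar>" by (intro mult_right_mono) auto
      then have "\<bar>u \<omega>\<bar> \<le> (u \<omega>)\<^sup>2 / \<epsilon>" using \<open>\<epsilon> > 0\<close> by (simp add: field_simps power2_eq_square)
      then show ?thesis using \<open>\<epsilon> > 0\<close> by linarith
    qed
  qed (use sq in \<open>auto intro!: integrable_abs integrable_bounded assms\<close>)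
  then show ?thesis using sq by (simp add: prob_space)
qed

text \<open>The averages are asymptotically norm-minimal among all convex combinations of the orbit, so
  the parallelogram law makes them a Cauchy sequence in \<open>L\<^sup>2\<close>.\<close>
lemma avg_Cauchy:
  assumes [measurable]: "v \<in> borel_measurable Q" and v: "\<And>\<omega>. \<bar>v \<omega>\<bar> \<le> B" and "e > 0"
  shows "\<exists>M0. \<forall>K\<ge>M0. \<forall>L\<ge>M0. (\<integral>\<omega>. (avg K v \<omega> - avg L v \<omega>)\<^sup>2 \<partial>Q) < e"
proof -
  have B: "0 \<le> B" using order_trans[OF abs_ge_zero v] .
  define N where "N u = (\<integral>\<omega>. (u \<omega>)\<^sup>2 \<partial>Q)" for u :: "'a \<Rightarrow> real"
  note sq = integrable_square_bounded
  \<comment> \<open>The infimum runs over averages alone, yet \<open>d_le_mid\<close> extends it to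
    midpoints of two averages: averaging a midpoint over a long time gives back an ordinary
    average.\<close>
  define d where "d = Inf ((\<lambda>M. N (avg M v)) ` {0<..})"
  have bdd: "bdd_below ((\<lambda>M. N (avg M v)) ` {0<..})"
    by (rule bdd_belowI[of _ 0]) (auto simp: N_def)
  have d_le: "d \<le> N (avg M v)" if "M > 0" for M
    unfolding d_def using that by (intro cInf_lower bdd) auto
  define mid where "mid K L = (\<lambda>\<omega>. (avg K v \<omega> + avg L v \<omega>) / 2)" for K L
  have mid_bound: "\<bar>mid K L \<omega>\<bar> \<le> B" for K L \<omega>
    using abs_avg_bound[where v=v and K=K and \<omega>=\<omega>, OF v] abs_avg_bound[where v=v and K=L and \<omega>=\<omega>, OF v] by (simp add: mid_def)
  have mid_meas [measurable]: "mid K L \<in> borel_measurable Q" for K L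
    unfolding mid_def by measurable
  have avg_mid: "avg M (mid K L) \<omega> = (avg M (avg K v) \<omega> + avg M (avg L v) \<omega>) / 2" for M K L \<omega>
  proof -
    have *: "mid K L = (\<lambda>\<omega>. (1/2) * avg K v \<omega> - (- (1/2)) * avg L v \<omega>)" by (auto simp: mid_def)
    show ?thesis unfolding * avg_diff avg_cmult by simp
  qed
  have mid_ineq: "\<bar>a - x\<bar> \<le> r \<Longrightarrow> \<bar>b - x\<bar> \<le> s \<Longrightarrow> \<bar>x - (a + b) / 2\<bar> \<le> r + s" for a b x r s :: real
    unfolding abs_le_iff by (simp add: field_simps)
  \<comment> \<open>Averaging over \<open>M\<close> does not raise the energy of the midpoint, and
    the result differs from \<open>avg M v\<close> by a multiple of \<open>1 / M\<close>.\<close>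
  have le_mid: "N (avg M v) \<le> N (mid K L) + 2 * B * (2 * (real K + real L) * B / M)"
    if "K > 0" "L > 0" for M K L :: nat
  proof -
    have "\<bar>avg M v \<omega> - avg M (mid K L) \<omega>\<bar> \<le> 2 * (real K + real L) * B / M" for \<omega>
    proof -
      have "\<bar>avg M v \<omega> - avg M (mid K L) \<omega>\<bar> \<le> 2 * real K * B / M + 2 * real L * B / M"
        using avg_avg_diff_le[where v=v and M=M and \<omega>=\<omega>, OF v \<open>K > 0\<close>] avg_avg_diff_le[where v=v and M=M and \<omega>=\<omega>, OF v \<open>L > 0\<close>]
        unfolding avg_mid by (rule mid_ineq)
      then show ?thesis by (simp add: distrib_left distrib_right add_divide_distrib)
    qed
    then have "N (avg M v) \<le> N (avg M (mid K L)) + 2 * B * (2 * (real K + real L) * B / M)"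
      unfolding N_def by (intro integral_square_bounded_diff_le abs_avg_bound v mid_bound) auto
    also have "N (avg M (mid K L)) \<le> N (mid K L)"
      unfolding N_def by (intro integral_avg_square_le[of _ B] mid_bound) auto
    finally show ?thesis by simp
  qed
  have lim: "(\<lambda>M. a + 2 * B * (2 * (real K + real L) * B / real M)) \<longlonglongrightarrow> a + 0" for a and K L :: nat
    by (intro tendsto_add tendsto_const) real_asymp
  have d_le_mid: "d \<le> N (mid K L)" if "K > 0" "L > 0" for K L :: nat
  proof -
    have "d \<le> N (mid K L) + 0"
    proof (rule tendsto_lowerbound[OF lim[of "N (mid K L)" K L]])
      show "\<forall>\<^sub>F M in sequentially. d \<le> N (mid K L) + 2 * B * (2 * (real K + real L) * B / real M)"
        by (rule eventually_sequentiallyI[of 1]) (rule order_trans[OF d_le le_mid[OF that]], simp)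
    qed simp
    then show ?thesis by simp
  qed
  \<comment> \<open>One nearly minimal average makes all late ones nearly minimal, by
    \<open>le_mid\<close> with both averages equal to \<open>avg K0 v\<close>. In the parallelogram
    identity the two excesses of \<open>e / 8\<close> count twice each, which gives
    \<open>e / 2\<close>.\<close>
  obtain K0 :: nat where K0: "K0 > 0" "N (avg K0 v) < d + e / 8"
    using cInf_lessD[of "(\<lambda>M. N (avg M v)) ` {0<..}" "d + e / 8"] \<open>e > 0\<close> by (auto simp: d_def)
  have "eventually (\<lambda>M. N (avg K0 v) + 2 * B * (2 * (real K0 + real K0) * B / real M) < d + e / 8) sequentially"
    by (rule order_tendstoD(2)[OF lim]) (use K0 in simp)
  then obtain M0 where M0: "\<And>M. M \<ge> M0 \<Longrightarrow> N (avg K0 v) + 2 * B * (2 * (real K0 + real K0) * B / real M) < d + e / 8"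
    by (auto simp: eventually_sequentially)
  have mm: "mid K0 K0 = avg K0 v" by (auto simp: mid_def)
  have near: "N (avg M v) < d + e / 8" if "M \<ge> M0" for M
    using le_mid[of K0 K0 M] M0[OF that] K0(1) unfolding mm by simp
  have "N (\<lambda>\<omega>. avg K v \<omega> - avg L v \<omega>) < e" if "K \<ge> Suc M0" "L \<ge> Suc M0" for K L
  proof -
    have "N (\<lambda>\<omega>. avg K v \<omega> - avg L v \<omega>) = (\<integral>\<omega>. 2 * (avg K v \<omega>)\<^sup>2 + 2 * (avg L v \<omega>)\<^sup>2 - 4 * (mid K L \<omega>)\<^sup>2 \<partial>Q)"
      unfolding N_def mid_def by (intro Bochner_Integration.integral_cong) (auto simp: power2_eq_square field_simps)
    also have "\<dots> = 2 * N (avg K v) + 2 * N (avg L v) - 4 * N (mid K L)"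
      using sq[of "avg K v" B, OF _ abs_avg_bound[OF v]] sq[of "avg L v" B, OF _ abs_avg_bound[OF v]] sq[of "mid K L" B, OF _ mid_bound]
      unfolding N_def by simp
    also have "\<dots> < e"
      using near[of K] near[of L] d_le_mid[of K L] that \<open>e > 0\<close> by simp
    finally show ?thesis .
  qed
  then show ?thesis unfolding N_def by blast
qed

lemma avg_converges:
  assumes [measurable]: "v \<in> borel_measurable Q" and v: "\<And>\<omega>. \<bar>v \<omega>\<bar> \<le> B"
  obtains \<psi> where "\<psi> \<in> borel_measurable Q" "\<And>\<omega>. \<bar>\<psi> \<omega>\<bar> \<le> B"
    "(\<lambda>K. \<integral>\<omega>. \<bar>avg K v \<omega> - \<psi> \<omega>\<bar> \<partial>Q) \<longlonglongrightarrow> 0"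
proof -
  have B: "0 \<le> B" using order_trans[OF abs_ge_zero v] .
  have diff_bound: "\<bar>avg K v \<omega> - avg L v \<omega>\<bar> \<le> 2 * B" for K L \<omega>
    using abs_avg_bound[where v=v and K=K and \<omega>=\<omega>, OF v] abs_avg_bound[where v=v and K=L and \<omega>=\<omega>, OF v] by linarith
  have C: "\<exists>M0. \<forall>K\<ge>M0. \<forall>L\<ge>M0. (\<integral>\<omega>. norm (avg K v \<omega> - avg L v \<omega>) \<partial>Q) < e" if "e > 0" for e
  proof -
    from \<open>e > 0\<close> have "(e / 2)\<^sup>2 > 0" by simp
    from avg_Cauchy[of v B, OF _ v this] obtain M0 where
      M0: "\<And>K L. K \<ge> M0 \<Longrightarrow> L \<ge> M0 \<Longrightarrow> (\<integral>\<omega>. (avg K v \<omega> - avg L v \<omega>)\<^sup>2 \<partial>Q) < (e / 2)\<^sup>2" by auto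
    have "(\<integral>\<omega>. norm (avg K v \<omega> - avg L v \<omega>) \<partial>Q) < e" if "K \<ge> M0" "L \<ge> M0" for K L
    proof -
      have "(\<integral>\<omega>. \<bar>avg K v \<omega> - avg L v \<omega>\<bar> \<partial>Q) \<le> e / 2 + (\<integral>\<omega>. (avg K v \<omega> - avg L v \<omega>)\<^sup>2 \<partial>Q) / (e / 2)"
        by (rule integral_abs_le_square[OF _ diff_bound]) (use \<open>e > 0\<close> in auto)
      also have "\<dots> < e / 2 + (e / 2)\<^sup>2 / (e / 2)"
        using M0[OF that] \<open>e > 0\<close> by (intro add_strict_left_mono divide_strict_right_mono) auto
      also have "\<dots> = e" by (simp add: power2_eq_square)
      finally show ?thesis by simp
    qed
    then show ?thesis by blast
  qed
  have int: "integrable Q (avg K v)" for K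
    by (rule integrable_bounded[OF _ abs_avg_bound[OF v]]) auto
  obtain r where r: "strict_mono r" "AE \<omega> in Q. Cauchy (\<lambda>i. avg (r i) v \<omega>)"
    by (rule cauchy_L1_AE_cauchy_subseq[OF int C]) auto
  \<comment> \<open>Clamping makes the bound \<open>B\<close> valid at every point, as the lemmas on
    bounded functions require, and changes nothing where the subsequence converges.\<close>
  define \<psi> where "\<psi> \<omega> = max (- B) (min B (lim (\<lambda>i. avg (r i) v \<omega>)))" for \<omega>
  have \<psi>_meas [measurable]: "\<psi> \<in> borel_measurable Q" unfolding \<psi>_def by measurable
  have \<psi>_bound: "\<bar>\<psi> \<omega>\<bar> \<le> B" for \<omega> using B by (auto simp: \<psi>_def)
  have conv: "AE \<omega> in Q. (\<lambda>i. avg (r i) v \<omega>) \<longlonglongrightarrow> \<psi> \<omega>"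
    using r(2)
  proof eventually_elim
    case (elim \<omega>)
    then have l: "(\<lambda>i. avg (r i) v \<omega>) \<longlonglongrightarrow> lim (\<lambda>i. avg (r i) v \<omega>)"
      by (simp add: Cauchy_convergent_iff convergent_LIMSEQ_iff)
    have "(\<lambda>i. max (- B) (min B (avg (r i) v \<omega>))) \<longlonglongrightarrow> \<psi> \<omega>"
      unfolding \<psi>_def by (intro tendsto_max tendsto_min tendsto_const l)
    moreover have "max (- B) (min B (avg (r i) v \<omega>)) = avg (r i) v \<omega>" for i
      using abs_avg_bound[where v=v and K="r i" and \<omega>=\<omega>, OF v] by auto
    ultimately show ?case by simp
  qed
  have lim: "(\<lambda>i. \<integral>\<omega>. \<bar>avg K v \<omega> - avg (r i) v \<omega>\<bar> \<partial>Q) \<longlonglongrightarrow> (\<integral>\<omega>. \<bar>avg K v \<omega> - \<psi> \<omega>\<bar> \<partial>Q)" for K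
  proof (rule integral_dominated_convergence[of _ _ _ "\<lambda>_. 2 * B"])
    show "AE \<omega> in Q. (\<lambda>i. \<bar>avg K v \<omega> - avg (r i) v \<omega>\<bar>) \<longlonglongrightarrow> \<bar>avg K v \<omega> - \<psi> \<omega>\<bar>"
      using conv by eventually_elim (intro tendsto_intros)
  qed (auto simp: diff_bound)
  have "(\<lambda>K. \<integral>\<omega>. \<bar>avg K v \<omega> - \<psi> \<omega>\<bar> \<partial>Q) \<longlonglongrightarrow> 0"
  proof (rule LIMSEQ_I)
    fix e :: real assume "e > 0"
    then have "e / 2 > 0" by simp
    from C[OF this] obtain M0 where
      M0: "\<And>K L. K \<ge> M0 \<Longrightarrow> L \<ge> M0 \<Longrightarrow> (\<integral>\<omega>. \<bar>avg K v \<omega> - avg L v \<omega>\<bar> \<partial>Q) < e / 2" by auto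
    have "(\<integral>\<omega>. \<bar>avg K v \<omega> - \<psi> \<omega>\<bar> \<partial>Q) \<le> e / 2" if "K \<ge> M0" for K
    proof (rule tendsto_upperbound[OF lim])
      have "(\<integral>\<omega>. \<bar>avg K v \<omega> - avg (r i) v \<omega>\<bar> \<partial>Q) \<le> e / 2" if "i \<ge> M0" for i
        using M0[OF \<open>K \<ge> M0\<close>, of "r i"] that seq_suble[OF r(1), of i] by simp
      then show "\<forall>\<^sub>F i in sequentially. (\<integral>\<omega>. \<bar>avg K v \<omega> - avg (r i) v \<omega>\<bar> \<partial>Q) \<le> e / 2"
        by (rule eventually_sequentiallyI)
    qed simp
    then show "\<exists>no. \<forall>n\<ge>no. norm ((\<integral>\<omega>. \<bar>avg n v \<omega> - \<psi> \<omega>\<bar> \<partial>Q) - 0) < e"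
      using \<open>e > 0\<close> by (intro exI[of _ M0]) (force simp: abs_of_nonneg)
  qed
  with \<psi>_meas \<psi>_bound show ?thesis by (rule that)
qed

text \<open>Invariance removes the outer \<open>T\<close> from the bound of
  \<open>abs_T_T_diff_le\<close>, so it is enough that the gradients vanish.\<close>

lemma integral_abs_T_pow_diff_tendsto_0:
  assumes [measurable]: "v \<in> borel_measurable Q" and v: "\<And>\<omega>. \<bar>v \<omega>\<bar> \<le> B"
  shows "(\<lambda>n. \<integral>\<omega>. \<bar>(T ^^ (n + 2)) v \<omega> - (T ^^ n) v \<omega>\<bar> \<partial>Q) \<longlonglongrightarrow> 0"
proof (rule LIMSEQ_I)
  fix e :: real assume "e > 0"
  have sq: "integrable Q (\<lambda>\<omega>. (v \<omega>)\<^sup>2)"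
    by (rule integrable_square_bounded[of v B]) (use assms in auto)
  have grad_bound: "\<bar>grad ((T ^^ n) v) \<omega>\<bar> \<le> 2 * B" for n \<omega>
    using abs_T_pow_bound[where v=v and n=n and \<omega>="\<theta> \<omega>", OF v] abs_T_pow_bound[where v=v and n=n and \<omega>="\<theta>' \<omega>", OF v]
    unfolding grad_def by linarith
  have "eventually (\<lambda>n. (\<integral>\<omega>. (grad ((T ^^ n) v) \<omega>)\<^sup>2 \<partial>Q) < (e / 2)\<^sup>2) sequentially"
    using grad_tendsto_0[OF _ sq] \<open>e > 0\<close> by (intro order_tendstoD) auto
  then obtain n0 where n0: "\<And>n. n \<ge> n0 \<Longrightarrow> (\<integral>\<omega>. (grad ((T ^^ n) v) \<omega>)\<^sup>2 \<partial>Q) < (e / 2)\<^sup>2"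
    by (auto simp: eventually_sequentially)
  have "(\<integral>\<omega>. \<bar>(T ^^ (n + 2)) v \<omega> - (T ^^ n) v \<omega>\<bar> \<partial>Q) < e" if "n \<ge> n0" for n
  proof -
    have G: "integrable Q (\<lambda>\<omega>. \<bar>grad ((T ^^ n) v) \<omega>\<bar>)"
      by (intro integrable_abs integrable_bounded[OF _ grad_bound]) simp
    have "(\<integral>\<omega>. \<bar>(T ^^ (n + 2)) v \<omega> - (T ^^ n) v \<omega>\<bar> \<partial>Q) \<le> (\<integral>\<omega>. T (\<lambda>\<omega>. \<bar>grad ((T ^^ n) v) \<omega>\<bar>) \<omega> \<partial>Q)"
    proof (rule integral_mono)
      show "integrable Q (\<lambda>\<omega>. \<bar>(T ^^ (n + 2)) v \<omega> - (T ^^ n) v \<omega>\<bar>)"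
        by (intro integrable_abs Bochner_Integration.integrable_diff integrable_T_pow integrable_bounded[OF _ v]) auto
      show "\<bar>(T ^^ (n + 2)) v \<omega> - (T ^^ n) v \<omega>\<bar> \<le> T (\<lambda>\<omega>. \<bar>grad ((T ^^ n) v) \<omega>\<bar>) \<omega>" for \<omega>
        using abs_T_T_diff_le[of "(T ^^ n) v" \<omega>] by simp
    qed (rule integrable_T[OF G])
    also have "\<dots> = (\<integral>\<omega>. \<bar>grad ((T ^^ n) v) \<omega>\<bar> \<partial>Q)" by (rule integral_T[OF G])
    also have "\<dots> \<le> e / 2 + (\<integral>\<omega>. (grad ((T ^^ n) v) \<omega>)\<^sup>2 \<partial>Q) / (e / 2)"
      by (rule integral_abs_le_square[OF _ grad_bound]) (use \<open>e > 0\<close> in auto)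
    also have "\<dots> < e / 2 + (e / 2)\<^sup>2 / (e / 2)"
      using n0[OF that] \<open>e > 0\<close> by (intro add_strict_left_mono divide_strict_right_mono) auto
    also have "\<dots> = e" by (simp add: power2_eq_square)
    finally show ?thesis .
  qed
  then show "\<exists>no. \<forall>n\<ge>no. norm ((\<integral>\<omega>. \<bar>(T ^^ (n + 2)) v \<omega> - (T ^^ n) v \<omega>\<bar> \<partial>Q) - 0) < e"
    by (intro exI[of _ n0]) (simp add: abs_of_nonneg)
qed

lemma integral_abs_T_pow_even_diff_tendsto_0:
  assumes [measurable]: "v \<in> borel_measurable Q" and v: "\<And>\<omega>. \<bar>v \<omega>\<bar> \<le> B"
  shows "(\<lambda>n. \<integral>\<omega>. \<bar>(T ^^ (n + 2 * k)) v \<omega> - (T ^^ n) v \<omega>\<bar> \<partial>Q) \<longlonglongrightarrow> 0"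
proof (induction k)
  case (Suc k)
  have int: "integrable Q ((T ^^ n) v)" for n
    by (intro integrable_T_pow integrable_bounded[OF _ v]) simp
  define a where "a n k = (\<integral>\<omega>. \<bar>(T ^^ (n + 2 * k)) v \<omega> - (T ^^ n) v \<omega>\<bar> \<partial>Q)" for n k
  have "(\<lambda>n. a (n + 2 * k) 1) \<longlonglongrightarrow> 0"
    using LIMSEQ_ignore_initial_segment[OF integral_abs_T_pow_diff_tendsto_0[OF assms], of "2 * k"]
    by (simp add: a_def)
  with Suc have lim: "(\<lambda>n. a (n + 2 * k) 1 + a n k) \<longlonglongrightarrow> 0"
    unfolding a_def[symmetric] by (auto intro: tendsto_eq_intros)
  have "a n (Suc k) \<le> a (n + 2 * k) 1 + a n k" for n
  proof -
    have "a n (Suc k) \<le> (\<integral>\<omega>. \<bar>(T ^^ (n + 2 * k + 2 * 1)) v \<omega> - (T ^^ (n + 2 * k)) v \<omega>\<bar> +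
         \<bar>(T ^^ (n + 2 * k)) v \<omega> - (T ^^ n) v \<omega>\<bar> \<partial>Q)"
      unfolding a_def
    proof (rule integral_mono)
      show "\<bar>(T ^^ (n + 2 * Suc k)) v \<omega> - (T ^^ n) v \<omega>\<bar> \<le> \<bar>(T ^^ (n + 2 * k + 2 * 1)) v \<omega> - (T ^^ (n + 2 * k)) v \<omega>\<bar> +
         \<bar>(T ^^ (n + 2 * k)) v \<omega> - (T ^^ n) v \<omega>\<bar>" for \<omega> by simp
    qed (intro Bochner_Integration.integrable_add integrable_abs Bochner_Integration.integrable_diff int)+
    also have "\<dots> = a (n + 2 * k) 1 + a n k"
      unfolding a_def by (intro Bochner_Integration.integral_add integrable_abs Bochner_Integration.integrable_diff int)
    finally show ?thesis .
  qed
  then have "(\<lambda>n. a n (Suc k)) \<longlonglongrightarrow> 0"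
    by (intro real_tendsto_sandwich[OF _ _ tendsto_const lim]) (auto simp: a_def)
  then show ?case unfolding a_def .
qed simp

theorem T_pow_converges:
  assumes [measurable]: "v \<in> borel_measurable Q" and v: "\<And>\<omega>. \<bar>v \<omega>\<bar> \<le> B"
  shows "(\<lambda>n. \<integral>\<omega>. \<bar>(T ^^ n) v \<omega> - (\<integral>\<omega>. v \<omega> \<partial>Q)\<bar> \<partial>Q) \<longlonglongrightarrow> 0"
proof -
  obtain \<psi> where \<psi>_meas [measurable]: "\<psi> \<in> borel_measurable Q" and \<psi>: "\<And>\<omega>. \<bar>\<psi> \<omega>\<bar> \<le> B"
    and lim: "(\<lambda>K. \<integral>\<omega>. \<bar>avg K v \<omega> - \<psi> \<omega>\<bar> \<partial>Q) \<longlonglongrightarrow> 0"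
    using avg_converges[OF assms] by blast
  have iv: "integrable Q v" and i\<psi>: "integrable Q \<psi>" and iavg: "integrable Q (avg K v)" for K
    by (auto intro!: integrable_bounded[OF _ v] integrable_bounded[OF _ \<psi>] integrable_bounded[OF _ abs_avg_bound[OF v]])
  note iT = integrable_T_pow[OF iv] integrable_T_pow[OF i\<psi>] integrable_T_pow[OF iavg]
  \<comment> \<open>The limit of the averages is fixed by two steps: these move
    \<open>avg K v\<close> by at most \<open>2 * B / K\<close>, and since they contract L^1,
    replacing \<open>avg K v\<close> by \<open>\<psi>\<close> costs at most twice the L^1 distance
    of the two.\<close>
  have "(\<integral>\<omega>. \<bar>(T ^^ 2) \<psi> \<omega> - \<psi> \<omega>\<bar> \<partial>Q) \<le> 0"
  proof (rule tendsto_lowerbound)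
    show "(\<lambda>K. (\<integral>\<omega>. \<bar>avg K v \<omega> - \<psi> \<omega>\<bar> \<partial>Q) + 2 * B / real K + (\<integral>\<omega>. \<bar>avg K v \<omega> - \<psi> \<omega>\<bar> \<partial>Q)) \<longlonglongrightarrow> 0"
      by (rule tendsto_eq_rhs[OF tendsto_add[OF tendsto_add[OF lim] lim], of _ 0]) (real_asymp, simp)
    have "(\<integral>\<omega>. \<bar>(T ^^ 2) \<psi> \<omega> - \<psi> \<omega>\<bar> \<partial>Q) \<le> (\<integral>\<omega>. \<bar>avg K v \<omega> - \<psi> \<omega>\<bar> \<partial>Q) + 2 * B / real K + (\<integral>\<omega>. \<bar>avg K v \<omega> - \<psi> \<omega>\<bar> \<partial>Q)" for K
    proof -
      have d: "\<bar>(T ^^ 2) (avg K v) \<omega> - avg K v \<omega>\<bar> \<le> 2 * B / K" for \<omega>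
      proof -
        have "(T ^^ 2) (avg K v) \<omega> = avg K ((T ^^ (2 * 1)) v) \<omega>"
          unfolding T_pow_avg by (simp add: avg_def funpow_add[symmetric] add.commute comp_def[symmetric] flip: funpow_add)
             (simp add: numeral_2_eq_2 funpow_swap1)
        then show ?thesis using avg_T_pow_diff_le[where v=v and M=K and j=1 and \<omega>=\<omega>, OF v] by simp
      qed
      have "(\<integral>\<omega>. \<bar>(T ^^ 2) \<psi> \<omega> - \<psi> \<omega>\<bar> \<partial>Q) \<le>
         (\<integral>\<omega>. \<bar>(T ^^ 2) (\<lambda>\<omega>. avg K v \<omega> - \<psi> \<omega>) \<omega>\<bar> + 2 * B / K + \<bar>avg K v \<omega> - \<psi> \<omega>\<bar> \<partial>Q)"
      proof (rule integral_mono)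
        fix \<omega>
        show "\<bar>(T ^^ 2) \<psi> \<omega> - \<psi> \<omega>\<bar> \<le> \<bar>(T ^^ 2) (\<lambda>\<omega>. avg K v \<omega> - \<psi> \<omega>) \<omega>\<bar> + 2 * B / K + \<bar>avg K v \<omega> - \<psi> \<omega>\<bar>"
          using d[of \<omega>] unfolding T_pow_diff by linarith
      qed (intro Bochner_Integration.integrable_add integrable_abs integrable_T_pow
             Bochner_Integration.integrable_diff i\<psi> iavg integrable_const)+
      also have "\<dots> = (\<integral>\<omega>. \<bar>(T ^^ 2) (\<lambda>\<omega>. avg K v \<omega> - \<psi> \<omega>) \<omega>\<bar> \<partial>Q) + 2 * B / K + (\<integral>\<omega>. \<bar>avg K v \<omega> - \<psi> \<omega>\<bar> \<partial>Q)"
        using integrable_T_pow[of "\<lambda>\<omega>. avg K v \<omega> - \<psi> \<omega>" 2] i\<psi> iavg[of K] by (simp add: prob_space)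
      also have "\<dots> \<le> (\<integral>\<omega>. \<bar>avg K v \<omega> - \<psi> \<omega>\<bar> \<partial>Q) + 2 * B / K + (\<integral>\<omega>. \<bar>avg K v \<omega> - \<psi> \<omega>\<bar> \<partial>Q)"
        by (intro add_right_mono integral_abs_T_pow_le Bochner_Integration.integrable_diff iavg i\<psi>)
      finally show ?thesis .
    qed
    then show "\<forall>\<^sub>F K in sequentially. (\<integral>\<omega>. \<bar>(T ^^ 2) \<psi> \<omega> - \<psi> \<omega>\<bar> \<partial>Q) \<le> (\<integral>\<omega>. \<bar>avg K v \<omega> - \<psi> \<omega>\<bar> \<partial>Q) + 2 * B / real K + (\<integral>\<omega>. \<bar>avg K v \<omega> - \<psi> \<omega>\<bar> \<partial>Q)"
      by simp
  qed simp
  then have "(\<integral>\<omega>. \<bar>(T ^^ 2) \<psi> \<omega> - \<psi> \<omega>\<bar> \<partial>Q) = 0"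
    by (simp add: order_antisym)
  then have "AE \<omega> in Q. (T ^^ 2) \<psi> \<omega> = \<psi> \<omega>"
    by (subst (asm) integral_nonneg_eq_0_iff_AE) (auto intro!: iT i\<psi> simp del: funpow.simps)
  then have eq: "(\<integral>\<omega>. ((T ^^ 2) \<psi> \<omega>)\<^sup>2 \<partial>Q) = (\<integral>\<omega>. (\<psi> \<omega>)\<^sup>2 \<partial>Q)"
    by (intro integral_cong_AE) auto
  have sq: "integrable Q (\<lambda>\<omega>. (\<psi> \<omega>)\<^sup>2)"
    by (rule integrable_square_bounded[of \<psi> B]) (use assms \<psi> \<psi>_meas in auto)
  \<comment> \<open>The energies at times 0 and 2 agree and the energy at time 1 lies between them,
    so the first step loses nothing and the gradient of \<open>\<psi>\<close> vanishes.\<close>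
  have "(\<integral>\<omega>. ((T ^^ 2) \<psi> \<omega>)\<^sup>2 \<partial>Q) \<le> (\<integral>\<omega>. ((T ^^ 1) \<psi> \<omega>)\<^sup>2 \<partial>Q)"
    by (rule integral_T_pow_square_antimono[OF _ sq]) auto
  then have "\<kappa>\<^sup>2 * (\<integral>\<omega>. (grad \<psi> \<omega>)\<^sup>2 \<partial>Q) \<le> 0"
    using energy_dissipation[OF _ sq] eq by simp
  then have "(\<integral>\<omega>. (grad \<psi> \<omega>)\<^sup>2 \<partial>Q) = 0"
    using kappa_pos by (simp add: mult_le_0_iff order_antisym)
  then have "AE \<omega> in Q. (grad \<psi> \<omega>)\<^sup>2 = 0"
    by (subst (asm) integral_nonneg_eq_0_iff_AE) (auto intro!: integrable_grad_square sq)
  then have "AE \<omega> in Q. \<psi> (\<theta> \<omega>) = \<psi> (\<theta>' \<omega>)"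
    by (simp add: grad_def)
  then obtain a where a: "AE \<omega> in Q. \<psi> \<omega> = a" using ergodic[OF \<psi>_meas] by blast
  have lim_a: "(\<lambda>K. \<integral>\<omega>. \<bar>avg K v \<omega> - a\<bar> \<partial>Q) \<longlonglongrightarrow> 0"
  proof -
    have "(\<integral>\<omega>. \<bar>avg K v \<omega> - \<psi> \<omega>\<bar> \<partial>Q) = (\<integral>\<omega>. \<bar>avg K v \<omega> - a\<bar> \<partial>Q)" for K
      by (rule integral_cong_AE) (use a in auto)
    with lim show ?thesis by simp
  qed
  \<comment> \<open>Averages keep the integral of \<open>v\<close>, which identifies the constant.
    The case \<open>K = 0\<close> is left out because the empty average is 0.\<close>
  have "\<bar>(\<integral>\<omega>. v \<omega> \<partial>Q) - a\<bar> \<le> 0"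
  proof (rule tendsto_lowerbound[OF lim_a])
    have "\<bar>(\<integral>\<omega>. v \<omega> \<partial>Q) - a\<bar> \<le> (\<integral>\<omega>. \<bar>avg K v \<omega> - a\<bar> \<partial>Q)" if "K \<ge> 1" for K
    proof -
      have "(\<integral>\<omega>. avg K v \<omega> \<partial>Q) = (\<integral>\<omega>. v \<omega> \<partial>Q)"
        unfolding avg_def using that iT by (simp add: integral_T_pow iv)
      then have "\<bar>(\<integral>\<omega>. v \<omega> \<partial>Q) - a\<bar> = \<bar>\<integral>\<omega>. avg K v \<omega> - a \<partial>Q\<bar>"
        using iavg by (simp add: prob_space)
      then show ?thesis using integral_abs_bound[of Q "\<lambda>\<omega>. avg K v \<omega> - a"] by simp
    qed
    then show "\<forall>\<^sub>F K in sequentially. \<bar>(\<integral>\<omega>. v \<omega> \<partial>Q) - a\<bar> \<le> (\<integral>\<omega>. \<bar>avg K v \<omega> - a\<bar> \<partial>Q)"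
      by (rule eventually_sequentiallyI)
  qed simp
  then have a_eq: "a = (\<integral>\<omega>. v \<omega> \<partial>Q)" by simp
  \<comment> \<open>\<open>T ^^ n\<close> of an average is the average of the functions
    \<open>(T ^^ (n + 2 * k)) v\<close>. For large \<open>n\<close> it is near
    \<open>(T ^^ n) v\<close>, and by contraction it is as near to \<open>a\<close> as
    \<open>avg K v\<close> was. Hence \<open>K\<close> is fixed first and \<open>n\<close> chosen
    afterwards.\<close>
  have le: "(\<integral>\<omega>. \<bar>(T ^^ n) v \<omega> - a\<bar> \<partial>Q) \<le>
     (\<Sum>k<K. \<integral>\<omega>. \<bar>(T ^^ (n + 2 * k)) v \<omega> - (T ^^ n) v \<omega>\<bar> \<partial>Q) / K + (\<integral>\<omega>. \<bar>avg K v \<omega> - a\<bar> \<partial>Q)"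
    if "K > 0" for n K
  proof -
    have "(\<integral>\<omega>. \<bar>(T ^^ n) v \<omega> - a\<bar> \<partial>Q) \<le> (\<integral>\<omega>. (\<Sum>k<K. \<bar>(T ^^ (n + 2 * k)) v \<omega> - (T ^^ n) v \<omega>\<bar>) / K +
        \<bar>(T ^^ n) (\<lambda>\<omega>. avg K v \<omega> - a) \<omega>\<bar> \<partial>Q)"
    proof (rule integral_mono)
      fix \<omega>
      have "(T ^^ n) (\<lambda>\<omega>. avg K v \<omega> - a) \<omega> - ((T ^^ n) v \<omega> - a) = (\<Sum>k<K. (T ^^ (n + 2 * k)) v \<omega> - (T ^^ n) v \<omega>) / K"
        using that by (simp add: T_pow_diff T_pow_const T_pow_avg sum_subtractf diff_divide_distrib)
      moreover have "\<bar>(\<Sum>k<K. (T ^^ (n + 2 * k)) v \<omega> - (T ^^ n) v \<omega>) / K\<bar> \<le> (\<Sum>k<K. \<bar>(T ^^ (n + 2 * k)) v \<omega> - (T ^^ n) v \<omega>\<bar>) / K"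
        by (simp add: abs_divide divide_right_mono sum_abs)
      ultimately show "\<bar>(T ^^ n) v \<omega> - a\<bar> \<le> (\<Sum>k<K. \<bar>(T ^^ (n + 2 * k)) v \<omega> - (T ^^ n) v \<omega>\<bar>) / K +
          \<bar>(T ^^ n) (\<lambda>\<omega>. avg K v \<omega> - a) \<omega>\<bar>" by linarith
    qed (intro Bochner_Integration.integrable_add integrable_abs integrable_divide Bochner_Integration.integrable_sum
           integrable_T_pow Bochner_Integration.integrable_diff iv iavg integrable_const)+
    also have "\<dots> = (\<Sum>k<K. \<integral>\<omega>. \<bar>(T ^^ (n + 2 * k)) v \<omega> - (T ^^ n) v \<omega>\<bar> \<partial>Q) / K +
        (\<integral>\<omega>. \<bar>(T ^^ n) (\<lambda>\<omega>. avg K v \<omega> - a) \<omega>\<bar> \<partial>Q)"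
      using iT integrable_T_pow[of "\<lambda>\<omega>. avg K v \<omega> - a" n] iavg[of K]
      by (subst Bochner_Integration.integral_add) auto
    also have "\<dots> \<le> (\<Sum>k<K. \<integral>\<omega>. \<bar>(T ^^ (n + 2 * k)) v \<omega> - (T ^^ n) v \<omega>\<bar> \<partial>Q) / K + (\<integral>\<omega>. \<bar>avg K v \<omega> - a\<bar> \<partial>Q)"
      by (intro add_left_mono integral_abs_T_pow_le Bochner_Integration.integrable_diff iavg) simp
    finally show ?thesis .
  qed
  have "(\<lambda>n. \<integral>\<omega>. \<bar>(T ^^ n) v \<omega> - a\<bar> \<partial>Q) \<longlonglongrightarrow> 0"
  proof (rule LIMSEQ_I)
    fix e :: real assume "e > 0"
    have "eventually (\<lambda>K. (\<integral>\<omega>. \<bar>avg K v \<omega> - a\<bar> \<partial>Q) < e / 2 \<and> K > 0) sequentially"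
      using order_tendstoD(2)[OF lim_a, of "e / 2"] \<open>e > 0\<close> by (intro eventually_conj eventually_gt_at_top) auto
    then obtain K where K: "(\<integral>\<omega>. \<bar>avg K v \<omega> - a\<bar> \<partial>Q) < e / 2" "K > 0"
      by (auto dest: eventually_happens)
    have "(\<lambda>n. (\<Sum>k<K. \<integral>\<omega>. \<bar>(T ^^ (n + 2 * k)) v \<omega> - (T ^^ n) v \<omega>\<bar> \<partial>Q) / K) \<longlonglongrightarrow> (\<Sum>k<K. 0) / K"
      using K by (intro tendsto_divide tendsto_sum tendsto_const integral_abs_T_pow_even_diff_tendsto_0[OF assms]) auto
    from order_tendstoD(2)[OF this, of "e / 2"] \<open>e > 0\<close>
    have "\<forall>\<^sub>F n in sequentially. (\<Sum>k<K. \<integral>\<omega>. \<bar>(T ^^ (n + 2 * k)) v \<omega> - (T ^^ n) v \<omega>\<bar> \<partial>Q) / K < e / 2"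
      by simp
    then have "\<forall>\<^sub>F n in sequentially. (\<integral>\<omega>. \<bar>(T ^^ n) v \<omega> - a\<bar> \<partial>Q) < e"
      by eventually_elim (use le[OF K(2)] K(1) in \<open>smt (verit) field_sum_of_halves\<close>)
    then show "\<exists>no. \<forall>n\<ge>no. norm ((\<integral>\<omega>. \<bar>(T ^^ n) v \<omega> - a\<bar> \<partial>Q) - 0) < e"
      by (simp add: eventually_sequentially abs_of_nonneg)
  qed
  then show ?thesis unfolding a_eq .
qed

end

subsection \<open>The i.i.d. environment\<close>

lemma shift_shift [simp]: "shift x (shift y \<omega>) = shift (y + x) \<omega>"
  by (simp add: shift_def add.assoc)

lemma shift_0 [simp]: "shift 0 \<omega> = \<omega>"
  by (simp add: shift_def)

lemma rho_shift: "rho (shift x \<omega>) y = rho \<omega> (x + y)"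
  by (simp add: rho_def shift_def)

locale iid_environment = prob_space P for P :: "env measure" +
  fixes c :: real
  assumes sets_P [measurable_cong]: "sets P = sets env_space"
    and indep: "indep_vars (\<lambda>_. borel) (\<lambda>x \<omega>. \<omega> x) UNIV"
    and ident: "\<And>x. distr P borel (\<lambda>\<omega>. \<omega> x) = distr P borel (\<lambda>\<omega>. \<omega> 0)"
    and c_pos: "c > 0"
    and elliptic: "AE \<omega> in P. \<omega> 0 \<in> {c..1 - c}"
    and transient: "(\<integral>\<omega>. rho \<omega> 0 \<partial>P) < 1"
begin

lemma space_P: "space P = UNIV \<rightarrow> {0..1}"
  using sets_eq_imp_space_eq[OF sets_P] by (simp add: space_env_space)

lemma measurable_coordinate [measurable]: "(\<lambda>\<omega>. \<omega> x) \<in> borel_measurable P"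
  using measurable_component_env[of x] measurable_cong_sets[OF sets_P refl] by blast

lemma measurable_shift_P [measurable]: "shift x \<in> P \<rightarrow>\<^sub>M P"
  using measurable_shift[of x] measurable_cong_sets[OF sets_P sets_P] by blast

lemma shift_in_space: "shift x \<omega> \<in> space P \<longleftrightarrow> \<omega> \<in> space P"
  unfolding space_P shift_def by (auto simp: Pi_iff) (metis add.commute diff_add_cancel)+

definition cyl :: "int set \<Rightarrow> (int \<Rightarrow> real set) \<Rightarrow> env set" where
  "cyl J A = {\<omega> \<in> space P. \<forall>i\<in>J. \<omega> i \<in> A i}"

definition marginal :: "real set \<Rightarrow> real" where
  "marginal A = measure (distr P borel (\<lambda>\<omega>. \<omega> 0)) A"

lemma prob_coordinate: "A \<in> sets borel \<Longrightarrow> prob {\<omega> \<in> space P. \<omega> x \<in> A} = marginal A"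
  unfolding marginal_def ident[of x, symmetric]
  by (subst measure_distr) (auto intro: arg_cong[where f="measure P"])

lemma prob_cyl:
  assumes "finite J" "\<And>i. i \<in> J \<Longrightarrow> A i \<in> sets borel"
  shows "prob (cyl J A) = (\<Prod>i\<in>J. marginal (A i))"
proof (cases "J = {}")
  case True
  then show ?thesis by (simp add: cyl_def prob_space)
next
  case False
  have "cyl J A = (\<Inter>i\<in>J. (\<lambda>\<omega>. \<omega> i) -` A i \<inter> space P)"
    using False by (auto simp: cyl_def)
  also have "prob \<dots> = (\<Prod>i\<in>J. prob ((\<lambda>\<omega>. \<omega> i) -` A i \<inter> space P))"
    by (rule indep_varsD[OF indep]) (use False assms in auto)
  also have "\<dots> = (\<Prod>i\<in>J. marginal (A i))"
  proof (intro prod.cong refl)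
    fix i assume "i \<in> J"
    moreover have "(\<lambda>\<omega>. \<omega> i) -` A i \<inter> space P = {\<omega> \<in> space P. \<omega> i \<in> A i}" by auto
    ultimately show "prob ((\<lambda>\<omega>. \<omega> i) -` A i \<inter> space P) = marginal (A i)"
      using assms by (simp add: prob_coordinate)
  qed
  finally show ?thesis .
qed

lemma sets_cyl [measurable]:
  assumes "finite J" "\<And>i. i \<in> J \<Longrightarrow> A i \<in> sets borel"
  shows "cyl J A \<in> sets P"
  unfolding cyl_def using assms by measurable

lemma prod_emb_eq_cyl: "prod_emb UNIV (\<lambda>_. restrict_space borel {0..1}) J (Pi\<^sub>E J A) = cyl J A"
  by (auto simp: prod_emb_def cyl_def space_P space_restrict_space PiE_iff)

lemma restrict_borel_imp_borel: "A \<in> sets (restrict_space borel {0..1::real}) \<Longrightarrow> A \<in> sets borel"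
  by (simp add: sets_restrict_space_iff)

lemma shift_vimage_cyl: "shift k -` cyl J A \<inter> space P = cyl ((+) k ` J) (\<lambda>i. A (i - k))"
  by (auto simp: cyl_def shift_in_space) (auto simp: shift_def)

text \<open>Both measures agree on cylinders, since a shift only relabels independent, identically
  distributed coordinates.\<close>

lemma distr_shift: "distr P P (shift k) = P"
proof (rule measure_eqI_PiM_infinite[of _ UNIV "\<lambda>_. restrict_space borel {0..1}"])
  show "finite_measure (distr P P (shift k))"
    by (rule prob_space.finite_measure[OF prob_space_distr]) simp
  fix A :: "int \<Rightarrow> real set" and J :: "int set"
  assume J: "finite J" and A: "\<And>i. i \<in> J \<Longrightarrow> A i \<in> sets (restrict_space borel {0..1})"
  then have A': "\<And>i. i \<in> J \<Longrightarrow> A i \<in> sets borel" by (blast dest: restrict_borel_imp_borel)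
  have "prob (cyl ((+) k ` J) (\<lambda>i. A (i - k))) = (\<Prod>i\<in>(+) k ` J. marginal (A (i - k)))"
    using J A' by (intro prob_cyl) auto
  also have "\<dots> = (\<Prod>i\<in>J. marginal (A i))"
    by (subst prod.reindex) auto
  also have "\<dots> = prob (cyl J A)" using J A' by (intro prob_cyl[symmetric]) auto
  finally show "emeasure (distr P P (shift k)) (prod_emb UNIV (\<lambda>_. restrict_space borel {0..1}) J (Pi\<^sub>E J A)) =
     emeasure P (prod_emb UNIV (\<lambda>_. restrict_space borel {0..1}) J (Pi\<^sub>E J A))"
    unfolding prod_emb_eq_cyl using J A'
    by (subst emeasure_distr) (auto simp: shift_vimage_cyl emeasure_eq_measure)
qed (simp_all add: sets_P env_space_def)

lemma AE_shift: "(AE \<omega> in P. Q \<omega>) \<Longrightarrow> AE \<omega> in P. Q (shift k \<omega>)"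
  by (rule AE_distrD[OF measurable_shift_P[of k]]) (subst distr_shift)

lemma integrable_shift:
  fixes g :: "env \<Rightarrow> real"
  assumes "integrable P g"
  shows "integrable P (\<lambda>\<omega>. g (shift k \<omega>))"
  by (rule integrable_distr[OF measurable_shift_P]) (simp add: distr_shift assms)

lemma integral_shift:
  fixes g :: "env \<Rightarrow> real"
  assumes "g \<in> borel_measurable P"
  shows "(\<integral>\<omega>. g (shift k \<omega>) \<partial>P) = (\<integral>\<omega>. g \<omega> \<partial>P)"
  using integral_distr[OF measurable_shift_P assms, of k] by (simp add: distr_shift)

lemma prob_shift_vimage:
  assumes "A \<in> sets P"
  shows "prob (shift k -` A \<inter> space P) = prob A"
  using measure_distr[OF measurable_shift_P assms, of k] by (simp add: distr_shift)

section \<open>Mixing and ergodicity of the shift\<close>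

lemma P_induct [consumes 1, case_names cyl empty compl union]:
  assumes "B \<in> sets P"
    and cyl: "\<And>J A. finite J \<Longrightarrow> (\<And>i. i \<in> J \<Longrightarrow> A i \<in> sets borel) \<Longrightarrow> R (cyl J A)"
    and empty: "R {}"
    and compl: "\<And>A. A \<in> sets P \<Longrightarrow> R A \<Longrightarrow> R (space P - A)"
    and union: "\<And>A. disjoint_family A \<Longrightarrow> range A \<subseteq> sets P \<Longrightarrow> (\<And>i::nat. R (A i)) \<Longrightarrow> R (\<Union>i. A i)"
  shows "R B"
proof -
  let ?M = "\<lambda>_::int. restrict_space borel {0..1::real}"
  have sp: "(\<Pi>\<^sub>E i\<in>UNIV. space (?M i)) = space P"
    by (simp add: space_P space_restrict_space PiE_UNIV_domain)
  have s: "sets P = sigma_sets (space P) (prod_algebra UNIV ?M)"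
    unfolding sets_P env_space_def sets_PiM sp ..
  show ?thesis
    using Int_stable_prod_algebra prod_algebra_sets_into_space[of UNIV ?M, unfolded sp] assms(1)[unfolded s]
  proof (induction rule: sigma_sets_induct_disjoint)
    case (basic A)
    then show ?case
      by (auto elim!: prod_algebraE simp: prod_emb_eq_cyl restrict_borel_imp_borel intro!: cyl)
  qed (use empty compl union s in auto)
qed

text \<open>From \<open>n = 2 * N + 1\<close> on, the shifted cylinder uses coordinates disjoint
  from \<open>J\<close>, so independence gives equality and the limit is reached at a finite
  time.\<close>

lemma mixing_cyl:
  assumes J: "finite J" "\<And>i. i \<in> J \<Longrightarrow> A i \<in> sets borel"
    and J': "finite J'" "\<And>i. i \<in> J' \<Longrightarrow> A' i \<in> sets borel"
  shows "(\<lambda>n. prob (cyl J A \<inter> shift (int n) -` cyl J' A')) \<longlonglongrightarrow> prob (cyl J A) * prob (cyl J' A')"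
proof (rule tendsto_eventually)
  obtain N :: nat where N: "\<And>i. i \<in> J \<Longrightarrow> i \<le> int N" "\<And>i. i \<in> J' \<Longrightarrow> - i \<le> int N"
  proof -
    have "\<exists>N::int. \<forall>i\<in>J \<union> uminus ` J'. i \<le> N"
      using J(1) J'(1) by (intro bdd_above_finite[unfolded bdd_above_def]) auto
    then obtain N :: int where N: "\<forall>i\<in>J \<union> uminus ` J'. i \<le> N" ..
    show ?thesis
    proof (rule that[of "nat N"])
      show "i \<le> int (nat N)" if "i \<in> J" for i
      proof -
        have "i \<le> N" using N that by blast
        then show ?thesis by linarith
      qed
      show "- i \<le> int (nat N)" if "i \<in> J'" for i
      proof -
        have "- i \<le> N" using N that by blast
        then show ?thesis by linarith
      qed
    qed
  qed
  have "prob (cyl J A \<inter> shift (int n) -` cyl J' A') = prob (cyl J A) * prob (cyl J' A')" if "n \<ge> 2 * N + 1" for n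
  proof -
    let ?k = "int n" and ?A = "\<lambda>i. if i \<in> J then A i else A' (i - int n)"
    have disj: "J \<inter> (+) ?k ` J' = {}"
    proof -
      have False if "i \<in> J" "j \<in> J'" "i = ?k + j" for i j
        using N(1)[OF that(1)] N(2)[OF that(2)] that(3) \<open>n \<ge> 2 * N + 1\<close> by linarith
      then show ?thesis by auto
    qed
    have nin: "i \<notin> J" if "i - int n \<in> J'" for i
      using disj that by (force intro: image_eqI[of _ _ "i - int n"])
    have nin': "int n + i \<notin> J" if "i \<in> J'" for i
      using nin[of "int n + i"] that by simp
    have "cyl J A \<inter> shift ?k -` cyl J' A' = cyl J A \<inter> (shift ?k -` cyl J' A' \<inter> space P)"
      by (auto simp: cyl_def)
    also have "\<dots> = cyl (J \<union> (+) ?k ` J') ?A"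
      unfolding shift_vimage_cyl using nin' by (auto simp: cyl_def ball_Un)
    also have "prob \<dots> = (\<Prod>i\<in>J \<union> (+) ?k ` J'. marginal (?A i))"
      using J J' by (intro prob_cyl) auto
    also have "\<dots> = (\<Prod>i\<in>J. marginal (?A i)) * (\<Prod>i\<in>(+) ?k ` J'. marginal (?A i))"
      using J J' disj by (intro prod.union_disjoint) auto
    also have "(\<Prod>i\<in>J. marginal (?A i)) = (\<Prod>i\<in>J. marginal (A i))" by simp
    also have "(\<Prod>i\<in>(+) ?k ` J'. marginal (?A i)) = (\<Prod>i\<in>J'. marginal (A' i))"
      by (subst prod.reindex) (auto intro!: prod.cong simp: nin')
    also have "(\<Prod>i\<in>J. marginal (A i)) = prob (cyl J A)" using J by (simp add: prob_cyl)
    also have "(\<Prod>i\<in>J'. marginal (A' i)) = prob (cyl J' A')" using J' by (simp add: prob_cyl)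
    finally show ?thesis .
  qed
  then show "\<forall>\<^sub>F n in sequentially. prob (cyl J A \<inter> shift (int n) -` cyl J' A') = prob (cyl J A) * prob (cyl J' A')"
    by (rule eventually_sequentiallyI)
qed

lemma sets_shift_vimage:
  assumes "A \<in> sets P" "B \<in> sets P"
  shows "A \<inter> shift k -` B \<in> sets P"
proof -
  have "A \<inter> shift k -` B = A \<inter> (shift k -` B \<inter> space P)"
    using sets.sets_into_space[OF assms(1)] by auto
  then show ?thesis using assms measurable_sets[OF measurable_shift_P] by auto
qed

text \<open>Tannery's theorem exchanges the limit with the series; the probabilities of the sets
  \<open>D i\<close> are the summable majorant that keeps mass from escaping along the index
  \<open>i\<close>.\<close>

lemma prob_union_tendsto:
  fixes C :: "nat \<Rightarrow> nat \<Rightarrow> env set"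
  assumes C: "\<And>n. disjoint_family (C n)" "\<And>n i. C n i \<in> sets P" and D: "disjoint_family D" "range D \<subseteq> sets P"
    and le: "\<And>n i. prob (C n i) \<le> prob (D i)"
    and lim: "\<And>i. (\<lambda>n. prob (C n i)) \<longlonglongrightarrow> r i"
  shows "(\<lambda>n. prob (\<Union>i. C n i)) \<longlonglongrightarrow> (\<Sum>i. r i)"
proof -
  have "(\<lambda>n. \<Sum>i. prob (C n i)) \<longlonglongrightarrow> (\<Sum>i. r i)"
  proof (rule tannerys_theorem[OF lim, THEN conjunct2, THEN conjunct2])
    show "summable (\<lambda>i. prob (D i))" using finite_measure_UNION[OF D(2,1)] by (rule sums_summable)
    show "eventually (\<lambda>(i, n). norm (prob (C n i)) \<le> prob (D i)) (at_top \<times>\<^sub>F sequentially)"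
      using le by (intro always_eventually) auto
  qed simp
  moreover have "(\<Sum>i. prob (C n i)) = prob (\<Union>i. C n i)" for n
    using finite_measure_UNION[of "C n"] C by (intro sums_unique[symmetric]) auto
  ultimately show ?thesis by simp
qed

text \<open>Dynkin induction in both arguments: first \<open>B\<close> while \<open>A\<close> is a
  cylinder, then \<open>A\<close> for arbitrary \<open>B\<close>.\<close>

lemma mixing:
  assumes "A \<in> sets P" "B \<in> sets P"
  shows "(\<lambda>n. prob (A \<inter> shift (int n) -` B)) \<longlonglongrightarrow> prob A * prob B"
  using assms(1)
proof (induction A rule: P_induct)
  case (cyl J A)
  have cyl_sets: "cyl J A \<in> sets P" using cyl by (rule sets_cyl)
  show ?case using assms(2)
  proof (induction B rule: P_induct)
    case (cyl J' A')
    then show ?case using \<open>finite J\<close> \<open>\<And>i. i \<in> J \<Longrightarrow> A i \<in> sets borel\<close> by (intro mixing_cyl) auto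
  next
    case empty
    then show ?case by simp
  next
    case (compl B)
    have eq: "prob (cyl J A \<inter> shift k -` (space P - B)) = prob (cyl J A) - prob (cyl J A \<inter> shift k -` B)" for k
    proof -
      have "cyl J A \<inter> shift k -` (space P - B) = cyl J A - (cyl J A \<inter> shift k -` B)"
        by (auto simp: cyl_def shift_in_space)
      then show ?thesis
        using finite_measure_Diff[OF cyl_sets sets_shift_vimage[OF cyl_sets compl(1), of k]] by simp
    qed
    show ?case
      using tendsto_diff[OF tendsto_const[of "prob (cyl J A)"] compl(2)]
      unfolding eq prob_compl[OF compl(1)] by (simp add: right_diff_distrib)
  next
    case (union B)
    have "(\<lambda>n. prob (\<Union>i. cyl J A \<inter> shift (int n) -` B i)) \<longlonglongrightarrow> (\<Sum>i. prob (cyl J A) * prob (B i))"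
    proof (rule prob_union_tendsto[of _ B])
      show "disjoint_family (\<lambda>i. cyl J A \<inter> shift (int n) -` B i)" for n
        using union(1) by (auto simp: disjoint_family_on_def)
      show 1: "cyl J A \<inter> shift (int n) -` B i \<in> sets P" for n i
        using union by (intro sets_shift_vimage cyl_sets) auto
      \<comment> \<open>The majorant must not depend on \<open>n\<close>: stationarity removes the
        shift.\<close>
      show "prob (cyl J A \<inter> shift (int n) -` B i) \<le> prob (B i)" for n i
      proof -
        have "prob (cyl J A \<inter> shift (int n) -` B i) \<le> prob (shift (int n) -` B i \<inter> space P)"
          using union measurable_sets[OF measurable_shift_P] by (intro finite_measure_mono) (auto simp: cyl_def)
        then show ?thesis using union by (subst (asm) prob_shift_vimage) auto
      qed
    qed (use union in auto)
    also have "(\<Sum>i. prob (cyl J A) * prob (B i)) = prob (cyl J A) * prob (\<Union>i. B i)"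
      using finite_measure_UNION[OF union(2,1)] by (simp add: sums_iff suminf_mult)
    also have "(\<lambda>n. prob (\<Union>i. cyl J A \<inter> shift (int n) -` B i)) = (\<lambda>n. prob (cyl J A \<inter> shift (int n) -` (\<Union>i. B i)))"
      by (intro ext arg_cong[where f=prob]) auto
    finally show ?case .
  qed
next
  case empty
  then show ?case by simp
next
  case (compl A)
  have eq: "prob ((space P - A) \<inter> shift k -` B) = prob B - prob (A \<inter> shift k -` B)" for k
  proof -
    have B: "shift k -` B \<inter> space P \<in> sets P" using assms(2) measurable_sets[OF measurable_shift_P] by auto
    have "(space P - A) \<inter> shift k -` B = (shift k -` B \<inter> space P) - (A \<inter> shift k -` B)"
      by auto
    then show ?thesis
      using finite_measure_Diff[OF B sets_shift_vimage[OF compl(1) assms(2), of k]] sets.sets_into_space[OF compl(1)]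
      by (auto simp: prob_shift_vimage assms)
  qed
  show ?case
    using tendsto_diff[OF tendsto_const[of "prob B"] compl(2)]
    unfolding eq prob_compl[OF compl(1)] by (simp add: left_diff_distrib)
next
  case (union A)
  have "(\<lambda>n. prob (\<Union>i. A i \<inter> shift (int n) -` B)) \<longlonglongrightarrow> (\<Sum>i. prob (A i) * prob B)"
  proof (rule prob_union_tendsto[of _ A])
    show "disjoint_family (\<lambda>i. A i \<inter> shift (int n) -` B)" for n
      using union(1) by (auto simp: disjoint_family_on_def)
    show 1: "A i \<inter> shift (int n) -` B \<in> sets P" for n i
      using union assms by (intro sets_shift_vimage) auto
    show "prob (A i \<inter> shift (int n) -` B) \<le> prob (A i)" for n i
      using union by (intro finite_measure_mono) auto
  qed (use union in auto)
  also have "(\<Sum>i. prob (A i) * prob B) = prob (\<Union>i. A i) * prob B"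
    using sums_mult2[OF finite_measure_UNION[OF union(2,1)], of "prob B"] by (simp add: sums_iff)
  also have "(\<lambda>n. prob (\<Union>i. A i \<inter> shift (int n) -` B)) = (\<lambda>n. prob ((\<Union>i. A i) \<inter> shift (int n) -` B))"
    by (intro ext arg_cong[where f=prob]) auto
  finally show ?case .
qed

text \<open>Mixing along the even times gives \<open>prob A = prob A * prob A\<close>.\<close>

lemma zero_one:
  assumes A: "A \<in> sets P" and inv: "AE \<omega> in P. shift 2 \<omega> \<in> A \<longleftrightarrow> \<omega> \<in> A"
  shows "prob A = 0 \<or> prob A = 1"
proof -
  have inv_n: "AE \<omega> in P. shift (int (2 * n)) \<omega> \<in> A \<longleftrightarrow> \<omega> \<in> A" for n
  proof (induction n)
    case (Suc n)
    from AE_shift[OF inv, of "int (2 * n)"] Suc show ?case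
      by eventually_elim (simp add: algebra_simps)
  qed simp
  have "prob (A \<inter> shift (int (2 * n)) -` A) = prob A" for n
    using inv_n[of n] sets_shift_vimage[OF A A] A by (intro finite_measure_eq_AE) auto
  moreover have "(\<lambda>n. prob (A \<inter> shift (int (2 * n)) -` A)) \<longlonglongrightarrow> prob A * prob A"
    using LIMSEQ_subseq_LIMSEQ[OF mixing[OF A A], of "\<lambda>n. 2 * n"] by (simp add: strict_mono_def o_def)
  ultimately have "prob A = prob A * prob A"
    by (simp add: LIMSEQ_const_iff)
  then show ?thesis by simp
qed

lemma shift_ergodic:
  fixes v :: "env \<Rightarrow> real"
  assumes v [measurable]: "v \<in> borel_measurable P" and inv: "AE \<omega> in P. v (shift 1 \<omega>) = v (shift (-1) \<omega>)"
  shows "\<exists>a. AE \<omega> in P. v \<omega> = a"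
proof -
  \<comment> \<open>The arctangent makes \<open>v\<close> bounded, hence integrable, and is undone
    by the tangent at the end.\<close>
  define w where "w \<omega> = arctan (v \<omega>)" for \<omega>
  have [measurable]: "w \<in> borel_measurable P" unfolding w_def by measurable
  have int: "integrable P w"
  proof (rule integrable_const_bound[of _ "pi / 2"])
    show "AE \<omega> in P. norm (w \<omega>) \<le> pi / 2"
    proof (rule AE_I2)
      show "norm (w \<omega>) \<le> pi / 2" for \<omega>
        unfolding w_def real_norm_def using arctan_lbound[of "v \<omega>"] arctan_ubound[of "v \<omega>"] by linarith
    qed
  qed simp
  \<comment> \<open>Evaluating the hypothesis at \<open>shift 1 \<omega>\<close> turns it into
    invariance under the shift by 2.\<close>
  have invw: "AE \<omega> in P. w (shift 2 \<omega>) = w \<omega>"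
    using AE_shift[OF inv, of 1] by eventually_elim (simp add: w_def)
  define a where "a = (\<integral>\<omega>. w \<omega> \<partial>P)"
  have zo: "prob {\<omega> \<in> space P. w \<omega> \<in> C} = 0 \<or> prob {\<omega> \<in> space P. w \<omega> \<in> C} = 1" if "C \<in> sets borel" for C
  proof (rule zero_one)
    show "{\<omega> \<in> space P. w \<omega> \<in> C} \<in> sets P" using that by measurable
    show "AE \<omega> in P. (shift 2 \<omega> \<in> {\<omega> \<in> space P. w \<omega> \<in> C}) = (\<omega> \<in> {\<omega> \<in> space P. w \<omega> \<in> C})"
      using invw by eventually_elim (simp add: shift_in_space)
  qed
  \<comment> \<open>If this failed, the zero-one law would put \<open>w\<close> almost surely above
    its own mean.\<close>
  have "AE \<omega> in P. w \<omega> \<le> a"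
  proof (rule ccontr)
    assume "\<not> (AE \<omega> in P. w \<omega> \<le> a)"
    then have "prob {\<omega> \<in> space P. w \<omega> \<in> {..a}} \<noteq> 1"
      by (subst prob_Collect_eq_1) auto
    then have "prob {\<omega> \<in> space P. w \<omega> \<in> {..a}} = 0" using zo[of "{..a}"] by auto
    then have "AE \<omega> in P. a < w \<omega>" by (subst (asm) prob_Collect_eq_0) (auto simp: not_le)
    then have "(\<integral>\<omega>. a \<partial>P) < (\<integral>\<omega>. w \<omega> \<partial>P)"
      by (intro integral_less_AE_space) (auto simp: int emeasure_space_1)
    then show False by (simp add: a_def prob_space)
  qed
  moreover have "AE \<omega> in P. a \<le> w \<omega>"
  proof (rule ccontr)
    assume "\<not> (AE \<omega> in P. a \<le> w \<omega>)"
    then have "prob {\<omega> \<in> space P. w \<omega> \<in> {a..}} \<noteq> 1"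
      by (subst prob_Collect_eq_1) auto
    then have "prob {\<omega> \<in> space P. w \<omega> \<in> {a..}} = 0" using zo[of "{a..}"] by auto
    then have "AE \<omega> in P. w \<omega> < a" by (subst (asm) prob_Collect_eq_0) (auto simp: not_le)
    then have "(\<integral>\<omega>. w \<omega> \<partial>P) < (\<integral>\<omega>. a \<partial>P)"
      by (intro integral_less_AE_space) (auto simp: int emeasure_space_1)
    then show False by (simp add: a_def prob_space)
  qed
  ultimately have "AE \<omega> in P. v \<omega> = tan a"
    by eventually_elim (metis order_antisym tan_arctan w_def)
  then show ?thesis ..
qed

end

subsection \<open>The invariant density\<close>

context iid_environment
begin

text \<open>Bounds and summability are required at all sites at once, so that \<open>good\<close> is
  stable under \<open>shift\<close> and pointwise identities hold along a whole orbit; it still has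
  probability one (\<open>AE_good\<close>).\<close>

definition good :: "env \<Rightarrow> bool" where
  "good \<omega> \<longleftrightarrow> \<omega> \<in> space P \<and> (\<forall>x. c \<le> \<omega> x \<and> \<omega> x \<le> 1 - c) \<and>
     (\<forall>x. summable (\<lambda>i. \<Prod>j=1..Suc i. rho (shift x \<omega>) (int j)))"

lemma good_shift: "good \<omega> \<Longrightarrow> good (shift x \<omega>)"
  by (auto simp: good_def shift_in_space) (simp_all add: shift_def)

lemma good_bounds: "good \<omega> \<Longrightarrow> c \<le> \<omega> x" "good \<omega> \<Longrightarrow> \<omega> x \<le> 1 - c" "good \<omega> \<Longrightarrow> 0 < \<omega> x" "good \<omega> \<Longrightarrow> \<omega> x < 1"
  using c_pos by (auto simp: good_def intro: less_le_trans le_less_trans[where y="1 - c"])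

lemma rho_ge: "good \<omega> \<Longrightarrow> c \<le> rho \<omega> x"
proof -
  assume g: "good \<omega>"
  have "c * \<omega> x \<le> c * 1" using c_pos good_bounds[OF g, of x] by (intro mult_left_mono) auto
  then have "c * \<omega> x \<le> 1 - \<omega> x" using good_bounds[OF g, of x] by linarith
  then show ?thesis using good_bounds[OF g, of x] by (simp add: rho_def field_simps)
qed

lemma rho_pos: "good \<omega> \<Longrightarrow> 0 < rho \<omega> x"
  using rho_ge[of \<omega> x] c_pos by linarith

lemma rho_nonneg: "\<omega> \<in> space P \<Longrightarrow> 0 \<le> rho \<omega> x"
  by (auto simp: rho_def space_P Pi_iff)

definition series :: "env \<Rightarrow> real" where
  "series \<omega> = 1 + (\<Sum>i. \<Prod>j=1..Suc i. rho \<omega> (int j))"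

lemma env_f_eq: "env_f \<omega> = series \<omega> / \<omega> 0"
  by (simp add: env_f_def series_def)

lemma good_summable: "good \<omega> \<Longrightarrow> summable (\<lambda>i. \<Prod>j=1..Suc i. rho \<omega> (int j))"
  unfolding good_def by (elim conjE allE[of _ 0]) simp

lemma series_rec:
  assumes "good \<omega>"
  shows "series \<omega> = 1 + rho \<omega> 1 * series (shift 1 \<omega>)"
proof -
  have p: "(\<Prod>j=1..Suc (Suc i). rho \<omega> (int j)) = rho \<omega> 1 * (\<Prod>j=1..Suc i. rho (shift 1 \<omega>) (int j))" for i
  proof -
    have "(\<Prod>j=1..Suc (Suc i). rho \<omega> (int j)) = rho \<omega> 1 * (\<Prod>j=Suc 1..Suc (Suc i). rho \<omega> (int j))"
      by (subst prod.atLeast_Suc_atMost) auto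
    also have "(\<Prod>j=Suc 1..Suc (Suc i). rho \<omega> (int j)) = (\<Prod>j=1..Suc i. rho (shift 1 \<omega>) (int j))"
      by (subst prod.atLeast_Suc_atMost_Suc_shift) (simp add: rho_shift)
    finally show ?thesis .
  qed
  have s: "summable (\<lambda>i. \<Prod>j=1..Suc i. rho (shift 1 \<omega>) (int j))"
    by (rule good_summable[OF good_shift[OF assms]])
  have "(\<Sum>i. \<Prod>j=1..Suc i. rho \<omega> (int j)) = rho \<omega> 1 + (\<Sum>i. \<Prod>j=1..Suc (Suc i). rho \<omega> (int j))"
    using suminf_split_head[OF good_summable[OF assms]] by simp
  also have "(\<Sum>i. \<Prod>j=1..Suc (Suc i). rho \<omega> (int j)) = rho \<omega> 1 * (\<Sum>i. \<Prod>j=1..Suc i. rho (shift 1 \<omega>) (int j))"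
    unfolding p by (rule suminf_mult[OF s])
  finally show ?thesis by (simp add: series_def distrib_left)
qed

lemma series_ge_1:
  assumes "good \<omega>"
  shows "1 \<le> series \<omega>"
proof -
  have "0 \<le> (\<Sum>i. \<Prod>j=1..Suc i. rho \<omega> (int j))"
    by (intro suminf_nonneg good_summable assms prod_nonneg less_imp_le[OF rho_pos])
  then show ?thesis unfolding series_def by linarith
qed

lemma series_shift_back:
  assumes "good \<omega>"
  shows "series (shift (-1) \<omega>) = 1 + rho \<omega> 0 * series \<omega>"
  using series_rec[OF good_shift[OF assms, of "-1"]] by (simp add: rho_shift)

lemma env_f_ge_1: "good \<omega> \<Longrightarrow> 1 \<le> env_f \<omega>"
  unfolding env_f_eq using good_bounds[of \<omega> 0] series_ge_1[of \<omega>] by (simp add: field_simps)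

lemma env_f_pos: "good \<omega> \<Longrightarrow> 0 < env_f \<omega>"
  using env_f_ge_1[of \<omega>] by simp

lemma env_f_fwd: "good \<omega> \<Longrightarrow> (1 - \<omega> 1) * env_f (shift 1 \<omega>) = rho \<omega> 1 * series (shift 1 \<omega>)"
  by (simp add: env_f_eq shift_def rho_def)

lemma env_f_bwd: "good \<omega> \<Longrightarrow> \<omega> (-1) * env_f (shift (-1) \<omega>) = 1 + rho \<omega> 0 * series \<omega>"
  using good_bounds[of \<omega> "-1"] by (simp add: env_f_eq series_shift_back) (simp add: shift_def)

text \<open>By \<open>series_rec\<close> the inflow from the right is
  \<open>series \<omega> - 1\<close>, and the inflow from the left is
  \<open>1 + rho \<omega> 0 * series \<omega>\<close>. The sum is \<open>series \<omega>\<close>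
  times \<open>1 + rho \<omega> 0\<close>, which is \<open>1 / \<omega> 0\<close>.\<close>

lemma env_f_stationary:
  assumes "good \<omega>"
  shows "\<omega> (-1) * env_f (shift (-1) \<omega>) + (1 - \<omega> 1) * env_f (shift 1 \<omega>) = env_f \<omega>"
proof -
  have "\<omega> (-1) * env_f (shift (-1) \<omega>) + (1 - \<omega> 1) * env_f (shift 1 \<omega>) = (1 + rho \<omega> 0) * series \<omega>"
    unfolding env_f_fwd[OF assms] env_f_bwd[OF assms] using series_rec[OF assms] by (simp add: algebra_simps)
  also have "1 + rho \<omega> 0 = 1 / \<omega> 0" using good_bounds[OF assms, of 0] by (simp add: rho_def field_simps)
  finally show ?thesis by (simp add: env_f_eq)
qed

text \<open>The walk reversed with respect to the invariant measure \<open>env_f\<close> steps from \<open>0\<close> to \<open>1\<close> with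
  probability \<open>rev_p\<close>; outside the good environments the value is clamped.\<close>
definition kap :: real where "kap = c\<^sup>2 / 2"

definition rev_p :: "env \<Rightarrow> real" where
  "rev_p \<omega> = max kap (min (1 - kap) ((1 - \<omega> 1) * env_f (shift 1 \<omega>) / env_f \<omega>))"

text \<open>An interval that carries a probability measure is not empty.\<close>

lemma c_le: "c \<le> 1 / 2"
proof -
  have "AE \<omega> in P. c \<le> 1 - c" using elliptic by eventually_elim auto
  then have "c \<le> 1 - c" by simp
  then show ?thesis by simp
qed

lemma kap_pos: "0 < kap" and kap_le: "kap \<le> 1 / 8"
  using c_pos c_le mult_mono[of c "1/2" c "1/2"] by (auto simp: kap_def power2_eq_square)

text \<open>The clamping is inactive on good environments. With \<open>S = series \<omega>\<close>
  the ratio equals \<open>\<omega> 0 * (S - 1) / S\<close>, which is at most \<open>1 - c\<close>.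
  Since \<open>S\<close> is at least \<open>1 + c\<close>, it is also at least
  \<open>c * c / (1 + c)\<close>, hence at least half the square of \<open>c\<close>; this is the
  origin of \<open>kap\<close>.\<close>

lemma rev_p_eq:
  assumes "good \<omega>"
  shows "rev_p \<omega> = (1 - \<omega> 1) * env_f (shift 1 \<omega>) / env_f \<omega>"
proof -
  let ?p = "(1 - \<omega> 1) * env_f (shift 1 \<omega>) / env_f \<omega>"
  let ?S = "series \<omega>"
  note b = good_bounds[OF assms]
  have S: "1 + c \<le> ?S"
  proof -
    have "c * 1 \<le> rho \<omega> 1 * series (shift 1 \<omega>)"
      using c_pos rho_ge[OF assms] series_ge_1[OF good_shift[OF assms]] rho_pos[OF assms] by (intro mult_mono) (auto intro: less_imp_le)
    then show ?thesis using series_rec[OF assms] by simp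
  qed
  have p: "?p = \<omega> 0 * (?S - 1) / ?S"
    unfolding env_f_fwd[OF assms] using series_rec[OF assms] by (simp add: env_f_eq)
  have "c\<^sup>2 / 2 * ?S \<le> c * (?S - 1)"
  proof -
    have "c * (c * ?S) \<le> c * ((1/2) * ?S)" using c_le c_pos S by (intro mult_left_mono mult_right_mono) auto
    have "c / 2 * ?S \<le> ?S - 1"
    proof -
      have "c / 2 \<le> (1 - c / 2) * c" using c_le c_pos mult_right_mono[of c "1/2" c] by (simp add: field_simps)
      also have "(1 - c / 2) * c \<le> (1 - c / 2) * (?S - 1)" using S c_le by (intro mult_left_mono) auto
      finally show ?thesis by (simp add: field_simps)
    qed
    then have "c * (c / 2 * ?S) \<le> c * (?S - 1)" using c_pos by (intro mult_left_mono) auto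
    then show ?thesis by (simp add: power2_eq_square)
  qed
  also have "\<dots> \<le> \<omega> 0 * (?S - 1)" using b[of 0] S c_pos by (intro mult_right_mono) auto
  finally have lo: "kap \<le> ?p" unfolding p kap_def using S c_pos by (simp add: field_simps)
  have "?p \<le> \<omega> 0" unfolding p using S c_pos b[of 0] by (simp add: field_simps)
  also have "\<dots> \<le> 1 - c" using b by auto
  also have "c \<ge> kap" using c_le c_pos mult_right_mono[of c 2 c] by (simp add: kap_def power2_eq_square)
  then have "1 - c \<le> 1 - kap" by simp
  finally show ?thesis unfolding rev_p_def using lo by simp
qed

lemma rev_p_fwd: "good \<omega> \<Longrightarrow> env_f \<omega> * rev_p \<omega> = (1 - \<omega> 1) * env_f (shift 1 \<omega>)"
  using env_f_pos[of \<omega>] by (simp add: rev_p_eq)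

lemma rev_p_bwd: "good \<omega> \<Longrightarrow> env_f \<omega> * (1 - rev_p \<omega>) = \<omega> (-1) * env_f (shift (-1) \<omega>)"
  using rev_p_fwd[of \<omega>] env_f_stationary[of \<omega>] by (simp add: algebra_simps)

lemma rev_p_bounds: "kap \<le> rev_p \<omega>" "rev_p \<omega> \<le> 1 - kap"
  using kap_le by (auto simp: rev_p_def)

section \<open>The mean of the invariant density\<close>

lemma measurable_env_f [measurable]: "env_f \<in> borel_measurable P"
  unfolding env_f_def[abs_def] rho_def[abs_def] by measurable

lemma measurable_rho [measurable]: "(\<lambda>\<omega>. rho \<omega> x) \<in> borel_measurable P"
  unfolding rho_def by measurable

lemma measurable_rev_p [measurable]: "rev_p \<in> borel_measurable P"
  unfolding rev_p_def[abs_def] by measurable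

lemma AE_elliptic: "AE \<omega> in P. \<forall>x. c \<le> \<omega> x \<and> \<omega> x \<le> 1 - c"
  unfolding AE_all_countable
proof
  fix x
  from AE_shift[OF elliptic, of x] show "AE \<omega> in P. c \<le> \<omega> x \<and> \<omega> x \<le> 1 - c"
    by eventually_elim (simp add: shift_def)
qed

definition env_f_term :: "nat \<Rightarrow> env \<Rightarrow> real" where
  "env_f_term k \<omega> = 1 / \<omega> 0 * (\<Prod>j=1..k. rho \<omega> (int j))"

abbreviation mean_rho :: real where "mean_rho \<equiv> \<integral>\<omega>. rho \<omega> 0 \<partial>P"

lemma integrable_rho: "integrable P (\<lambda>\<omega>. rho \<omega> x)"
proof (rule integrable_const_bound[of _ "1 / c"])
  show "AE \<omega> in P. norm (rho \<omega> x) \<le> 1 / c"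
    using AE_elliptic
  proof eventually_elim
    case (elim \<omega>)
    then have "c \<le> \<omega> x" "\<omega> x \<le> 1 - c" by auto
    then have "rho \<omega> x \<le> 1 / c" unfolding rho_def using c_pos by (intro frac_le) auto
    moreover have "0 \<le> rho \<omega> x" unfolding rho_def using \<open>c \<le> \<omega> x\<close> \<open>\<omega> x \<le> 1 - c\<close> c_pos by simp
    ultimately show ?case by simp
  qed
qed simp

lemma integral_rho: "(\<integral>\<omega>. rho \<omega> x \<partial>P) = mean_rho"
  using integral_shift[of "\<lambda>\<omega>. rho \<omega> 0" x] by (simp add: rho_shift)

text \<open>Writing the prefactor through \<open>rho\<close> makes its mean computable; it becomes
  the numerator \<open>1 + mean_rho\<close> of \<open>1 / speed P\<close>.\<close>

lemma AE_inverse_eq: "AE \<omega> in P. 1 / \<omega> 0 = 1 + rho \<omega> 0"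
  using AE_elliptic
proof eventually_elim
  case (elim \<omega>)
  then have "\<omega> 0 > 0" using c_pos by (auto intro: less_le_trans)
  then show ?case by (simp add: rho_def field_simps)
qed

text \<open>The factors of a term depend on distinct coordinates, hence are independent, and the
  mean of the product factorises. \<open>Y\<close> treats coordinate 0 separately because the
  prefactor \<open>1 / \<omega> 0\<close> sits there.\<close>

lemma
  shows integrable_env_f_term: "integrable P (env_f_term k)"
    and integral_env_f_term: "(\<integral>\<omega>. env_f_term k \<omega> \<partial>P) = (1 + mean_rho) * mean_rho ^ k"
proof -
  define Y where "Y i x = (if i = 0 then 1 / x else (1 - x) / x)" for i :: int and x :: real
  define X where "X i = (\<lambda>\<omega>::env. Y i (\<omega> i))" for i
  have e: "env_f_term k = (\<lambda>\<omega>. \<Prod>i\<in>{0..int k}. X i \<omega>)"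
  proof
    fix \<omega>
    have "(\<Prod>i\<in>{0..int k}. X i \<omega>) = (\<Prod>i\<in>insert 0 (int ` {1..k}). X i \<omega>)"
    proof (rule prod.cong)
      show "{0..int k} = insert 0 (int ` {1..k})"
        unfolding image_int_atLeastAtMost by auto
    qed simp
    also have "\<dots> = X 0 \<omega> * (\<Prod>j=1..k. X (int j) \<omega>)"
      by (subst prod.insert) (auto simp: prod.reindex)
    also have "X 0 \<omega> = 1 / \<omega> 0" by (simp add: X_def Y_def)
    also have "(\<Prod>j=1..k. X (int j) \<omega>) = (\<Prod>j=1..k. rho \<omega> (int j))"
      by (rule prod.cong) (auto simp: X_def Y_def rho_def)
    finally show "env_f_term k \<omega> = (\<Prod>i\<in>{0..int k}. X i \<omega>)" by (simp only: env_f_term_def)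
  qed
  have "indep_vars (\<lambda>_. borel) (\<lambda>i \<omega>. Y i (\<omega> i)) UNIV"
    by (rule indep_vars_compose2[OF indep]) (simp add: Y_def)
  then have ind: "indep_vars (\<lambda>_. borel) X {0..int k}"
    unfolding X_def by (rule indep_vars_subset[OF _ subset_UNIV])
  have i0: "integrable P (X 0)" "(\<integral>\<omega>. X 0 \<omega> \<partial>P) = 1 + mean_rho"
  proof -
    have ae: "AE \<omega> in P. 1 + rho \<omega> 0 = X 0 \<omega>" using AE_inverse_eq by eventually_elim (simp add: X_def Y_def)
    have [measurable]: "X 0 \<in> borel_measurable P" unfolding X_def Y_def by measurable
    show "integrable P (X 0)"
      by (rule integrable_cong_AE_imp[of _ "\<lambda>\<omega>. 1 + rho \<omega> 0"]) (use ae integrable_rho in auto)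
    have "(\<integral>\<omega>. X 0 \<omega> \<partial>P) = (\<integral>\<omega>. 1 + rho \<omega> 0 \<partial>P)"
      by (rule integral_cong_AE) (use ae in auto)
    then show "(\<integral>\<omega>. X 0 \<omega> \<partial>P) = 1 + mean_rho" by (simp add: integrable_rho prob_space)
  qed
  have Xi: "X i = (\<lambda>\<omega>. rho \<omega> i)" if "i \<noteq> 0" for i
    using that by (auto simp: X_def Y_def rho_def)
  have int: "integrable P (X i)" for i
  proof (cases "i = 0")
    case True
    then show ?thesis using i0(1) by simp
  next
    case False
    show ?thesis unfolding Xi[OF False] by (rule integrable_rho)
  qed
  show "integrable P (env_f_term k)" unfolding e by (rule indep_vars_integrable[OF _ ind int]) simp
  have "(\<integral>\<omega>. env_f_term k \<omega> \<partial>P) = (\<Prod>i\<in>{0..int k}. \<integral>\<omega>. X i \<omega> \<partial>P)"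
    unfolding e by (rule indep_vars_lebesgue_integral[OF _ ind int]) simp
  also have "\<dots> = (\<integral>\<omega>. X 0 \<omega> \<partial>P) * (\<Prod>i\<in>{0<..int k}. \<integral>\<omega>. X i \<omega> \<partial>P)"
  proof -
    have "{0..int k} = insert 0 {0<..int k}" by auto
    then show ?thesis by simp
  qed
  also have "(\<Prod>i\<in>{0<..int k}. \<integral>\<omega>. X i \<omega> \<partial>P) = (\<Prod>i\<in>{0<..int k}. mean_rho)"
  proof (rule prod.cong)
    fix i assume "i \<in> {0<..int k}"
    then have "i \<noteq> 0" by simp
    show "(\<integral>\<omega>. X i \<omega> \<partial>P) = mean_rho" unfolding Xi[OF \<open>i \<noteq> 0\<close>] by (rule integral_rho)
  qed simp
  also have "\<dots> = mean_rho ^ k" by simp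
  finally show "(\<integral>\<omega>. env_f_term k \<omega> \<partial>P) = (1 + mean_rho) * mean_rho ^ k" unfolding i0(2) .
qed

lemma env_f_term_nonneg: "\<omega> \<in> space P \<Longrightarrow> 0 \<le> env_f_term k \<omega>"
  unfolding env_f_term_def by (intro mult_nonneg_nonneg prod_nonneg) (auto simp: rho_nonneg space_P Pi_iff)

lemma mean_rho_nonneg: "0 \<le> mean_rho"
  by (intro integral_nonneg_AE AE_I2 rho_nonneg)

text \<open>The expected sum is a geometric series with ratio \<open>mean_rho < 1\<close>, so the
  sum is finite almost surely.\<close>

lemma AE_summable_term: "AE \<omega> in P. summable (\<lambda>k. env_f_term k \<omega>)"
proof -
  have m: "mean_rho < 1" by (rule transient)
  have "(\<integral>\<^sup>+\<omega>. (\<Sum>k. ennreal (env_f_term k \<omega>)) \<partial>P) = (\<Sum>k. \<integral>\<^sup>+\<omega>. env_f_term k \<omega> \<partial>P)"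
    using integrable_env_f_term by (intro nn_integral_suminf) auto
  also have "\<dots> = (\<Sum>k. ennreal ((1 + mean_rho) * mean_rho ^ k))"
    by (intro suminf_cong) (simp add: nn_integral_eq_integral[OF integrable_env_f_term] env_f_term_nonneg integral_env_f_term)
  also have "\<dots> \<noteq> \<infinity>"
    using m mean_rho_nonneg unfolding infinity_ennreal_def
    by (intro ennreal_suminf_neq_top summable_mult summable_geometric) auto
  finally have "AE \<omega> in P. (\<Sum>k. ennreal (env_f_term k \<omega>)) \<noteq> \<infinity>"
    using integrable_env_f_term by (intro nn_integral_PInf_AE) auto
  then show ?thesis
    using AE_space by eventually_elim (auto intro: summable_suminf_not_top env_f_term_nonneg)
qed

lemma AE_good: "AE \<omega> in P. good \<omega>"
proof -
  have "AE \<omega> in P. \<forall>x. summable (\<lambda>k. env_f_term k (shift x \<omega>))"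
    unfolding AE_all_countable using AE_shift[OF AE_summable_term] by blast
  then show ?thesis
    using AE_elliptic AE_space
  proof eventually_elim
    case (elim \<omega>)
    have "summable (\<lambda>i. \<Prod>j=1..Suc i. rho (shift x \<omega>) (int j))" for x
    proof -
      have "\<omega> x \<noteq> 0" using elim(2) c_pos by (metis not_less)
      moreover have "summable (\<lambda>i. shift x \<omega> 0 * env_f_term (Suc i) (shift x \<omega>))"
        using elim(1) by (intro summable_mult) (subst summable_Suc_iff, simp)
      ultimately show ?thesis by (simp add: env_f_term_def shift_def)
    qed
    with elim show ?case by (auto simp: good_def)
  qed
qed

lemma
  shows integrable_env_f: "integrable P env_f"
    and integral_env_f: "(\<integral>\<omega>. env_f \<omega> \<partial>P) = 1 / speed P"
proof -
  have m: "mean_rho < 1" by (rule transient)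
  have nn: "norm (env_f_term k \<omega>) = env_f_term k \<omega>" if "\<omega> \<in> space P" for k \<omega>
    using env_f_term_nonneg[OF that] by simp
  have s: "AE \<omega> in P. summable (\<lambda>k. norm (env_f_term k \<omega>))"
    using AE_summable_term AE_space by eventually_elim (simp add: nn del: real_norm_def)
  have geo: "summable (\<lambda>k. mean_rho ^ k)" "(\<Sum>k. mean_rho ^ k) = 1 / (1 - mean_rho)"
    using m mean_rho_nonneg by (auto intro: summable_geometric suminf_geometric)
  have norm_term: "(\<integral>\<omega>. norm (env_f_term k \<omega>) \<partial>P) = (1 + mean_rho) * mean_rho ^ k" for k
  proof -
    have "(\<integral>\<omega>. norm (env_f_term k \<omega>) \<partial>P) = (\<integral>\<omega>. env_f_term k \<omega> \<partial>P)"
      by (rule Bochner_Integration.integral_cong) (simp_all only: nn)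
    then show ?thesis by (simp only: integral_env_f_term)
  qed
  have s': "summable (\<lambda>k. \<integral>\<omega>. norm (env_f_term k \<omega>) \<partial>P)"
    unfolding norm_term by (rule summable_mult[OF geo(1)])
  have ae: "AE \<omega> in P. (\<Sum>k. env_f_term k \<omega>) = env_f \<omega>"
    using AE_good
  proof eventually_elim
    case (elim \<omega>)
    have "(\<lambda>i. 1 / \<omega> 0 * (\<Prod>j=1..Suc i. rho \<omega> (int j))) sums (1 / \<omega> 0 * (\<Sum>i. \<Prod>j=1..Suc i. rho \<omega> (int j)))"
      by (intro sums_mult summable_sums good_summable elim)
    then have "(\<lambda>i. env_f_term i \<omega>) sums (1 / \<omega> 0 * (\<Sum>i. \<Prod>j=1..Suc i. rho \<omega> (int j)) + env_f_term 0 \<omega>)"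
      unfolding env_f_term_def by (rule sums_Suc)
    then have "(\<Sum>k. env_f_term k \<omega>) = 1 / \<omega> 0 * (\<Sum>i. \<Prod>j=1..Suc i. rho \<omega> (int j)) + env_f_term 0 \<omega>"
      by (rule sums_unique[symmetric])
    also have "env_f_term 0 \<omega> = 1 / \<omega> 0" by (simp add: env_f_term_def)
    finally show ?case unfolding env_f_def by (simp only: distrib_left mult_1_right add.commute)
  qed
  note [measurable] = borel_measurable_integrable[OF integrable_env_f_term]
  have "integrable P (\<lambda>\<omega>. \<Sum>k. env_f_term k \<omega>)"
    by (rule integrable_suminf[OF integrable_env_f_term s s'])
  then show "integrable P env_f"
    by (rule integrable_cong_AE_imp) (use ae in \<open>auto\<close>)
  have "(\<integral>\<omega>. env_f \<omega> \<partial>P) = (\<integral>\<omega>. (\<Sum>k. env_f_term k \<omega>) \<partial>P)"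
    by (rule integral_cong_AE) (use ae in auto)
  also have "\<dots> = (\<Sum>k. \<integral>\<omega>. env_f_term k \<omega> \<partial>P)"
    by (rule integral_suminf[OF integrable_env_f_term s s'])
  also have "\<dots> = (1 + mean_rho) * (1 / (1 - mean_rho))"
    unfolding integral_env_f_term suminf_mult[OF geo(1)] geo(2) ..
  finally show "(\<integral>\<omega>. env_f \<omega> \<partial>P) = 1 / speed P" by (simp add: speed_def)
qed

lemma speed_pos: "0 < speed P"
  using transient mean_rho_nonneg by (simp add: speed_def)

end

subsection \<open>Transport of densities\<close>

text \<open>One step of the forward equation: if \<open>\<phi> (shift y \<omega>)\<close> is the
  quenched mean number of particles at \<open>y\<close>, then
  \<open>push \<phi> (shift x \<omega>)\<close> is the mean number at \<open>x\<close> one step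
  later.\<close>

definition push :: "(env \<Rightarrow> real) \<Rightarrow> env \<Rightarrow> real" where
  "push \<phi> = (\<lambda>\<omega>. \<omega> (-1) * \<phi> (shift (-1) \<omega>) + (1 - \<omega> 1) * \<phi> (shift 1 \<omega>))"

lemma push_apply: "push \<phi> \<omega> = \<omega> (-1) * \<phi> (shift (-1) \<omega>) + (1 - \<omega> 1) * \<phi> (shift 1 \<omega>)"
  by (simp add: push_def)

lemma push_diff: "push (\<lambda>\<omega>. \<phi> \<omega> - \<psi> \<omega>) = (\<lambda>\<omega>. push \<phi> \<omega> - push \<psi> \<omega>)"
  by (auto simp: push_def algebra_simps)

lemma push_pow_diff: "(push ^^ n) (\<lambda>\<omega>. \<phi> \<omega> - \<psi> \<omega>) = (\<lambda>\<omega>. (push ^^ n) \<phi> \<omega> - (push ^^ n) \<psi> \<omega>)"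
  by (induction n) (simp_all add: push_diff)

context iid_environment
begin

lemma measurable_push [measurable]:
  assumes [measurable]: "\<phi> \<in> borel_measurable P"
  shows "push \<phi> \<in> borel_measurable P"
  unfolding push_def by measurable

lemma integrable_coordinate_mult:
  assumes "integrable P \<phi>"
  shows "integrable P (\<lambda>\<omega>. \<omega> 0 * \<phi> \<omega>)" "integrable P (\<lambda>\<omega>. (1 - \<omega> 0) * \<phi> \<omega>)"
proof -
  note [measurable] = borel_measurable_integrable[OF assms]
  have le: "\<bar>a * b\<bar> \<le> \<bar>b\<bar>" if "0 \<le> a" "a \<le> 1" for a b :: real
    using that by (simp add: abs_mult mult_left_le_one_le)
  show "integrable P (\<lambda>\<omega>. \<omega> 0 * \<phi> \<omega>)"
    by (rule Bochner_Integration.integrable_bound[OF assms]) (auto simp: space_P Pi_iff intro!: AE_I2 le)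
  show "integrable P (\<lambda>\<omega>. (1 - \<omega> 0) * \<phi> \<omega>)"
    by (rule Bochner_Integration.integrable_bound[OF assms]) (auto simp: space_P Pi_iff intro!: AE_I2 le)
qed

text \<open>Stationarity moves both terms back to the origin, where the coefficients add up to 1:
  particles are conserved.\<close>

lemma
  assumes \<phi>: "integrable P \<phi>"
  shows integrable_push: "integrable P (push \<phi>)"
    and integral_push: "(\<integral>\<omega>. push \<phi> \<omega> \<partial>P) = (\<integral>\<omega>. \<phi> \<omega> \<partial>P)"
proof -
  note [measurable] = borel_measurable_integrable[OF \<phi>]
  note i = integrable_coordinate_mult[OF \<phi>]
  have 1: "integrable P (\<lambda>\<omega>. \<omega> (-1) * \<phi> (shift (-1) \<omega>))"
    using integrable_shift[OF i(1), of "-1"] by (simp add: shift_def)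
  have 2: "integrable P (\<lambda>\<omega>. (1 - \<omega> 1) * \<phi> (shift 1 \<omega>))"
    using integrable_shift[OF i(2), of 1] by (simp add: shift_def)
  show "integrable P (push \<phi>)" unfolding push_def using 1 2 by simp
  have "(\<integral>\<omega>. push \<phi> \<omega> \<partial>P) = (\<integral>\<omega>. \<omega> (-1) * \<phi> (shift (-1) \<omega>) \<partial>P) + (\<integral>\<omega>. (1 - \<omega> 1) * \<phi> (shift 1 \<omega>) \<partial>P)"
    unfolding push_def using 1 2 by simp
  also have "(\<integral>\<omega>. \<omega> (-1) * \<phi> (shift (-1) \<omega>) \<partial>P) = (\<integral>\<omega>. \<omega> 0 * \<phi> \<omega> \<partial>P)"
    using integral_shift[OF borel_measurable_integrable[OF i(1)], of "-1"] by (simp add: shift_def)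
  also have "(\<integral>\<omega>. (1 - \<omega> 1) * \<phi> (shift 1 \<omega>) \<partial>P) = (\<integral>\<omega>. (1 - \<omega> 0) * \<phi> \<omega> \<partial>P)"
    using integral_shift[OF borel_measurable_integrable[OF i(2)], of 1] by (simp add: shift_def)
  also have "(\<integral>\<omega>. \<omega> 0 * \<phi> \<omega> \<partial>P) + (\<integral>\<omega>. (1 - \<omega> 0) * \<phi> \<omega> \<partial>P) = (\<integral>\<omega>. \<phi> \<omega> \<partial>P)"
    using i by (subst Bochner_Integration.integral_add[symmetric]) (auto simp: algebra_simps)
  finally show "(\<integral>\<omega>. push \<phi> \<omega> \<partial>P) = (\<integral>\<omega>. \<phi> \<omega> \<partial>P)" .
qed

lemma integrable_push_pow: "integrable P \<phi> \<Longrightarrow> integrable P ((push ^^ n) \<phi>)"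
  by (induction n) (auto intro: integrable_push)

lemma integral_push_pow: "integrable P \<phi> \<Longrightarrow> (\<integral>\<omega>. (push ^^ n) \<phi> \<omega> \<partial>P) = (\<integral>\<omega>. \<phi> \<omega> \<partial>P)"
  by (induction n) (auto simp: integral_push integrable_push_pow)

lemma abs_push_pow_le:
  "\<omega> \<in> space P \<Longrightarrow> \<bar>(push ^^ n) \<phi> \<omega>\<bar> \<le> (push ^^ n) (\<lambda>\<omega>. \<bar>\<phi> \<omega>\<bar>) \<omega>"
proof (induction n arbitrary: \<omega>)
  case (Suc n)
  have b: "0 \<le> \<omega> x" "\<omega> x \<le> 1" for x using Suc.prems by (auto simp: space_P Pi_iff)
  have "\<bar>push ((push ^^ n) \<phi>) \<omega>\<bar> \<le> \<omega> (-1) * \<bar>(push ^^ n) \<phi> (shift (-1) \<omega>)\<bar> + (1 - \<omega> 1) * \<bar>(push ^^ n) \<phi> (shift 1 \<omega>)\<bar>"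
    unfolding push_apply[of "(push ^^ n) \<phi>"] by (rule order_trans[OF abs_triangle_ineq]) (simp add: abs_mult b)
  also have "\<dots> \<le> push ((push ^^ n) (\<lambda>\<omega>. \<bar>\<phi> \<omega>\<bar>)) \<omega>"
    unfolding push_apply[of "(push ^^ n) (\<lambda>\<omega>. \<bar>\<phi> \<omega>\<bar>)"] using Suc.prems by (intro add_mono mult_left_mono Suc.IH) (auto simp: b shift_in_space)
  finally show ?case by simp
qed simp

lemma integral_abs_push_pow_le:
  assumes "integrable P \<phi>"
  shows "(\<integral>\<omega>. \<bar>(push ^^ n) \<phi> \<omega>\<bar> \<partial>P) \<le> (\<integral>\<omega>. \<bar>\<phi> \<omega>\<bar> \<partial>P)"
proof -
  have "(\<integral>\<omega>. \<bar>(push ^^ n) \<phi> \<omega>\<bar> \<partial>P) \<le> (\<integral>\<omega>. (push ^^ n) (\<lambda>\<omega>. \<bar>\<phi> \<omega>\<bar>) \<omega> \<partial>P)"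
    by (intro integral_mono integrable_abs integrable_push_pow assms abs_push_pow_le)
  also have "\<dots> = (\<integral>\<omega>. \<bar>\<phi> \<omega>\<bar> \<partial>P)"
    by (intro integral_push_pow integrable_abs assms)
  finally show ?thesis .
qed

text \<open>The invariant law of the environment seen from the walk.\<close>
definition inv_law :: "env measure" where
  "inv_law = density P (\<lambda>\<omega>. ennreal (speed P * env_f \<omega>))"

lemma sets_inv_law [measurable_cong]: "sets inv_law = sets P"
  by (simp add: inv_law_def)

lemma AE_density_nonneg: "AE \<omega> in P. 0 \<le> speed P * env_f \<omega>"
  using AE_good by eventually_elim (simp add: less_imp_le[OF speed_pos] less_imp_le[OF env_f_pos])

lemma integrable_inv_law:
  fixes v :: "env \<Rightarrow> real"
  assumes [measurable]: "v \<in> borel_measurable P"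
  shows "integrable inv_law v \<longleftrightarrow> integrable P (\<lambda>\<omega>. env_f \<omega> * v \<omega>)"
  unfolding inv_law_def
  by (subst integrable_density) (use AE_density_nonneg speed_pos in \<open>auto simp: mult.assoc\<close>)

lemma integral_inv_law:
  fixes v :: "env \<Rightarrow> real"
  assumes [measurable]: "v \<in> borel_measurable P"
  shows "(\<integral>\<omega>. v \<omega> \<partial>inv_law) = speed P * (\<integral>\<omega>. env_f \<omega> * v \<omega> \<partial>P)"
  unfolding inv_law_def
  by (subst integral_density) (use AE_density_nonneg in \<open>auto simp: mult.assoc\<close>)

lemma prob_space_inv_law: "prob_space inv_law"
proof
  have "emeasure inv_law (space inv_law) = (\<integral>\<^sup>+\<omega>. ennreal (speed P * env_f \<omega>) \<partial>P)"
    by (simp add: inv_law_def emeasure_density cong: nn_integral_cong)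
  also have "\<dots> = ennreal (\<integral>\<omega>. speed P * env_f \<omega> \<partial>P)"
    using integrable_env_f AE_density_nonneg by (intro nn_integral_eq_integral) auto
  also have "\<dots> = 1" using speed_pos by (simp add: integral_env_f)
  finally show "emeasure inv_law (space inv_law) = 1" .
qed

text \<open>The density is positive almost everywhere, so the two laws have the same null
  sets.\<close>

lemma AE_inv_law: "(AE \<omega> in inv_law. R \<omega>) \<longleftrightarrow> (AE \<omega> in P. R \<omega>)"
proof -
  have "(AE \<omega> in inv_law. R \<omega>) \<longleftrightarrow> (AE \<omega> in P. 0 < ennreal (speed P * env_f \<omega>) \<longrightarrow> R \<omega>)"
    unfolding inv_law_def by (rule AE_density) simp
  also have "\<dots> \<longleftrightarrow> (AE \<omega> in P. R \<omega>)"
  proof -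
    have "AE \<omega> in P. 0 < ennreal (speed P * env_f \<omega>)"
      using AE_good by eventually_elim (simp add: speed_pos env_f_pos)
    then have "AE \<omega> in P. (0 < ennreal (speed P * env_f \<omega>) \<longrightarrow> R \<omega>) = R \<omega>"
      by eventually_elim simp
    then show ?thesis by (rule eventually_subst)
  qed
  finally show ?thesis .
qed

lemma env_f_mult_rev:
  assumes "good \<omega>"
  shows "env_f \<omega> * (rev_p \<omega> * v (shift 1 \<omega>) + (1 - rev_p \<omega>) * v (shift (-1) \<omega>)) = push (\<lambda>\<omega>. env_f \<omega> * v \<omega>) \<omega>"
proof -
  have "env_f \<omega> * (rev_p \<omega> * v (shift 1 \<omega>) + (1 - rev_p \<omega>) * v (shift (-1) \<omega>)) =
     (env_f \<omega> * rev_p \<omega>) * v (shift 1 \<omega>) + (env_f \<omega> * (1 - rev_p \<omega>)) * v (shift (-1) \<omega>)"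
    by (simp add: algebra_simps)
  also have "\<dots> = push (\<lambda>\<omega>. env_f \<omega> * v \<omega>) \<omega>"
    unfolding rev_p_fwd[OF assms] rev_p_bwd[OF assms] push_def by (simp add: algebra_simps)
  finally show ?thesis .
qed

text \<open>Through \<open>env_f_mult_rev\<close>, invariance of \<open>inv_law\<close> is the
  conservation of mass by \<open>push\<close>, applied to \<open>env_f\<close> times
  \<open>v\<close>. Ergodicity comes from \<open>shift_ergodic\<close>, as \<open>P\<close> and
  \<open>inv_law\<close> have the same null sets.\<close>

sublocale rev: ergodic_two_point_operator inv_law "shift 1" "shift (-1)" rev_p kap
proof -
  interpret Q: prob_space inv_law by (rule prob_space_inv_law)
  show "ergodic_two_point_operator inv_law (shift 1) (shift (-1)) rev_p kap"
  proof
    show "shift 1 \<in> inv_law \<rightarrow>\<^sub>M inv_law" "shift (-1) \<in> inv_law \<rightarrow>\<^sub>M inv_law"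
      using measurable_shift_P measurable_cong_sets[OF sets_inv_law sets_inv_law] by blast+
    show "rev_p \<in> borel_measurable inv_law"
      using measurable_rev_p measurable_cong_sets[OF sets_inv_law refl] by blast
    show "0 < kap" by (rule kap_pos)
    show "kap \<le> rev_p \<omega>" "rev_p \<omega> \<le> 1 - kap" for \<omega> by (rule rev_p_bounds)+
  next
    fix v :: "env \<Rightarrow> real"
    let ?T = "\<lambda>\<omega>. rev_p \<omega> * v (shift 1 \<omega>) + (1 - rev_p \<omega>) * v (shift (-1) \<omega>)"
    assume v: "integrable inv_law v"
    then have [measurable]: "v \<in> borel_measurable P"
      using measurable_cong_sets[OF sets_inv_law refl] borel_measurable_integrable by blast
    have fv: "integrable P (\<lambda>\<omega>. env_f \<omega> * v \<omega>)" using v by (simp add: integrable_inv_law)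
    have ae: "AE \<omega> in P. push (\<lambda>\<omega>. env_f \<omega> * v \<omega>) \<omega> = env_f \<omega> * ?T \<omega>"
      using AE_good by eventually_elim (simp add: env_f_mult_rev)
    have "integrable P (\<lambda>\<omega>. env_f \<omega> * ?T \<omega>)"
      by (rule integrable_cong_AE_imp[OF integrable_push[OF fv]]) (use ae in auto)
    moreover have "(\<integral>\<omega>. env_f \<omega> * ?T \<omega> \<partial>P) = (\<integral>\<omega>. env_f \<omega> * v \<omega> \<partial>P)"
    proof -
      have "(\<integral>\<omega>. env_f \<omega> * ?T \<omega> \<partial>P) = (\<integral>\<omega>. push (\<lambda>\<omega>. env_f \<omega> * v \<omega>) \<omega> \<partial>P)"
        by (rule integral_cong_AE) (use ae in auto)
      then show ?thesis by (simp add: integral_push[OF fv])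
    qed
    ultimately show "integrable inv_law ?T \<and> (\<integral>\<omega>. ?T \<omega> \<partial>inv_law) = (\<integral>\<omega>. v \<omega> \<partial>inv_law)"
      by (simp add: integrable_inv_law integral_inv_law)
  next
    fix v :: "env \<Rightarrow> real"
    assume "v \<in> borel_measurable inv_law" and "AE \<omega> in inv_law. v (shift 1 \<omega>) = v (shift (-1) \<omega>)"
    then show "\<exists>a. AE \<omega> in inv_law. v \<omega> = a"
      unfolding AE_inv_law using measurable_cong_sets[OF sets_inv_law refl] by (intro shift_ergodic) auto
  qed simp_all
qed

lemma push_pow_env_f_mult:
  "good \<omega> \<Longrightarrow> (push ^^ n) (\<lambda>\<omega>. env_f \<omega> * v \<omega>) \<omega> = env_f \<omega> * (rev.T ^^ n) v \<omega>"
proof (induction n arbitrary: \<omega>)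
  case (Suc n)
  have "push ((push ^^ n) (\<lambda>\<omega>. env_f \<omega> * v \<omega>)) \<omega> = push (\<lambda>\<omega>. env_f \<omega> * (rev.T ^^ n) v \<omega>) \<omega>"
    unfolding push_apply Suc.IH[OF good_shift[OF Suc.prems]] ..
  also have "\<dots> = env_f \<omega> * rev.T ((rev.T ^^ n) v) \<omega>"
    unfolding env_f_mult_rev[OF Suc.prems, symmetric] rev.T_def ..
  finally show ?case by simp
qed simp

text \<open>After factoring out \<open>env_f\<close>, the distance in L^1(P) is the distance in L^1
  of \<open>inv_law\<close> divided by \<open>speed P\<close>, and \<open>\<alpha>\<close> is the
  mean of \<open>v\<close> under \<open>inv_law\<close>.\<close>

lemma push_pow_bounded_density:
  assumes [measurable]: "v \<in> borel_measurable P" and v: "\<And>\<omega>. \<bar>v \<omega>\<bar> \<le> B"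
  defines "\<alpha> \<equiv> speed P * (\<integral>\<omega>. env_f \<omega> * v \<omega> \<partial>P)"
  shows "(\<lambda>n. \<integral>\<omega>. \<bar>(push ^^ n) (\<lambda>\<omega>. env_f \<omega> * v \<omega>) \<omega> - \<alpha> * env_f \<omega>\<bar> \<partial>P) \<longlonglongrightarrow> 0"
proof -
  have \<alpha>: "\<alpha> = (\<integral>\<omega>. v \<omega> \<partial>inv_law)" by (simp add: \<alpha>_def integral_inv_law)
  have [measurable]: "(rev.T ^^ n) v \<in> borel_measurable P" for n
    using rev.measurable_T_pow[of v n] assms(1) measurable_cong_sets[OF sets_inv_law refl] by blast
  have "(\<integral>\<omega>. \<bar>(push ^^ n) (\<lambda>\<omega>. env_f \<omega> * v \<omega>) \<omega> - \<alpha> * env_f \<omega>\<bar> \<partial>P) =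
      (\<integral>\<omega>. \<bar>(rev.T ^^ n) v \<omega> - \<alpha>\<bar> \<partial>inv_law) / speed P" for n
  proof -
    have fv: "integrable P (\<lambda>\<omega>. env_f \<omega> * v \<omega>)"
      using rev.integrable_bounded[of v B] v integrable_inv_law[of v] assms(1) measurable_cong_sets[OF sets_inv_law refl] by blast
    note [measurable] = borel_measurable_integrable[OF integrable_push_pow[OF fv, of n]]
    have "(\<integral>\<omega>. \<bar>(rev.T ^^ n) v \<omega> - \<alpha>\<bar> \<partial>inv_law) = speed P * (\<integral>\<omega>. env_f \<omega> * \<bar>(rev.T ^^ n) v \<omega> - \<alpha>\<bar> \<partial>P)"
      by (rule integral_inv_law) measurable
    also have "(\<integral>\<omega>. env_f \<omega> * \<bar>(rev.T ^^ n) v \<omega> - \<alpha>\<bar> \<partial>P) = (\<integral>\<omega>. \<bar>(push ^^ n) (\<lambda>\<omega>. env_f \<omega> * v \<omega>) \<omega> - \<alpha> * env_f \<omega>\<bar> \<partial>P)"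
    proof (rule integral_cong_AE)
      show "AE \<omega> in P. env_f \<omega> * \<bar>(rev.T ^^ n) v \<omega> - \<alpha>\<bar> = \<bar>(push ^^ n) (\<lambda>\<omega>. env_f \<omega> * v \<omega>) \<omega> - \<alpha> * env_f \<omega>\<bar>"
        using AE_good
      proof eventually_elim
        case (elim \<omega>)
        have "(push ^^ n) (\<lambda>\<omega>. env_f \<omega> * v \<omega>) \<omega> - \<alpha> * env_f \<omega> = env_f \<omega> * ((rev.T ^^ n) v \<omega> - \<alpha>)"
          by (simp add: push_pow_env_f_mult[OF elim] right_diff_distrib mult.commute)
        then show ?case using env_f_pos[OF elim] by (simp add: abs_mult)
      qed
    qed measurable
    finally show ?thesis using speed_pos by simp
  qed
  moreover have "(\<lambda>n. (\<integral>\<omega>. \<bar>(rev.T ^^ n) v \<omega> - \<alpha>\<bar> \<partial>inv_law) / speed P) \<longlonglongrightarrow> 0 / speed P"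
    unfolding \<alpha> using speed_pos assms(1) measurable_cong_sets[OF sets_inv_law refl]
    by (intro tendsto_divide tendsto_const rev.T_pow_converges[OF _ v]) auto
  ultimately show ?thesis by simp
qed

theorem push_pow_converges:
  assumes \<phi>: "integrable P \<phi>"
  defines "\<alpha> \<equiv> speed P * (\<integral>\<omega>. \<phi> \<omega> \<partial>P)"
  shows "(\<lambda>n. \<integral>\<omega>. \<bar>(push ^^ n) \<phi> \<omega> - \<alpha> * env_f \<omega>\<bar> \<partial>P) \<longlonglongrightarrow> 0"
proof (rule LIMSEQ_I)
  fix e :: real assume "e > 0"
  note [measurable] = borel_measurable_integrable[OF \<phi>]
  \<comment> \<open>Convergence is known for densities whose ratio to \<open>env_f\<close> is
    bounded, so the ratio is truncated at level \<open>B\<close>. The resulting L^1 error is paid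
    twice, once for the evolved density, which \<open>push\<close> contracts, and once for the
    constant \<open>\<alpha>\<close>; with the convergence error this makes three parts below
    \<open>e / 4\<close>.\<close>
  define v where "v B \<omega> = max (- real B) (min (real B) (\<phi> \<omega> / env_f \<omega>))" for B \<omega>
  have [measurable]: "v B \<in> borel_measurable P" for B unfolding v_def by measurable
  have v_bound: "\<bar>v B \<omega>\<bar> \<le> real B" for B \<omega> by (auto simp: v_def)
  define \<phi>' where "\<phi>' B \<omega> = env_f \<omega> * v B \<omega>" for B \<omega>
  have [measurable]: "\<phi>' B \<in> borel_measurable P" for B unfolding \<phi>'_def by measurable
  have bound: "AE \<omega> in P. \<bar>\<phi>' B \<omega>\<bar> \<le> \<bar>\<phi> \<omega>\<bar>" for B
    using AE_good
  proof eventually_elim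
    case (elim \<omega>)
    have "\<bar>max (- real B) (min (real B) x)\<bar> \<le> \<bar>x\<bar>" for x :: real by linarith
    then have "\<bar>v B \<omega>\<bar> \<le> \<bar>\<phi> \<omega> / env_f \<omega>\<bar>" unfolding v_def .
    then have "env_f \<omega> * \<bar>v B \<omega>\<bar> \<le> env_f \<omega> * \<bar>\<phi> \<omega> / env_f \<omega>\<bar>"
      using env_f_pos[OF elim] by (intro mult_left_mono) auto
    then show ?case using env_f_pos[OF elim] by (simp add: \<phi>'_def abs_mult)
  qed
  have int': "integrable P (\<phi>' B)" for B
    by (rule Bochner_Integration.integrable_bound[OF \<phi>]) (use bound in auto)
  have "(\<lambda>B. \<integral>\<omega>. \<bar>\<phi> \<omega> - \<phi>' B \<omega>\<bar> \<partial>P) \<longlonglongrightarrow> (\<integral>\<omega>. 0 \<partial>P)"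
  proof (rule integral_dominated_convergence[where w="\<lambda>\<omega>. 2 * \<bar>\<phi> \<omega>\<bar>"])
    show "AE \<omega> in P. (\<lambda>B. \<bar>\<phi> \<omega> - \<phi>' B \<omega>\<bar>) \<longlonglongrightarrow> 0"
      using AE_good
    proof eventually_elim
      case (elim \<omega>)
      have "\<forall>\<^sub>F B in sequentially. \<bar>\<phi> \<omega> - \<phi>' B \<omega>\<bar> = 0"
      proof (rule eventually_sequentiallyI)
        fix B assume "nat \<lceil>\<bar>\<phi> \<omega> / env_f \<omega>\<bar>\<rceil> \<le> B"
        then have "\<bar>\<phi> \<omega> / env_f \<omega>\<bar> \<le> real B" by linarith
        then have "v B \<omega> = \<phi> \<omega> / env_f \<omega>" unfolding v_def by linarith
        then show "\<bar>\<phi> \<omega> - \<phi>' B \<omega>\<bar> = 0" using env_f_pos[OF elim] by (simp add: \<phi>'_def)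
      qed
      then show ?case by (rule tendsto_eventually)
    qed
    show "AE \<omega> in P. norm \<bar>\<phi> \<omega> - \<phi>' B \<omega>\<bar> \<le> 2 * \<bar>\<phi> \<omega>\<bar>" for B
      using bound[of B] by eventually_elim auto
  qed (use \<phi> in auto)
  then have "\<forall>\<^sub>F B in sequentially. (\<integral>\<omega>. \<bar>\<phi> \<omega> - \<phi>' B \<omega>\<bar> \<partial>P) < e / 4"
    using \<open>e > 0\<close> by (intro order_tendstoD) auto
  then obtain B where B: "(\<integral>\<omega>. \<bar>\<phi> \<omega> - \<phi>' B \<omega>\<bar> \<partial>P) < e / 4"
    by (auto dest: eventually_happens)
  define \<beta> where "\<beta> = speed P * (\<integral>\<omega>. \<phi>' B \<omega> \<partial>P)"
  have "(\<lambda>n. \<integral>\<omega>. \<bar>(push ^^ n) (\<phi>' B) \<omega> - \<beta> * env_f \<omega>\<bar> \<partial>P) \<longlonglongrightarrow> 0"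
    unfolding \<beta>_def \<phi>'_def by (rule push_pow_bounded_density[OF _ v_bound]) simp
  then have "\<forall>\<^sub>F n in sequentially. (\<integral>\<omega>. \<bar>(push ^^ n) (\<phi>' B) \<omega> - \<beta> * env_f \<omega>\<bar> \<partial>P) < e / 4"
    using \<open>e > 0\<close> by (intro order_tendstoD) auto
  then have "\<forall>\<^sub>F n in sequentially. (\<integral>\<omega>. \<bar>(push ^^ n) \<phi> \<omega> - \<alpha> * env_f \<omega>\<bar> \<partial>P) < e"
  proof eventually_elim
    case (elim n)
    have d: "integrable P (\<lambda>\<omega>. \<phi> \<omega> - \<phi>' B \<omega>)" using \<phi> int' by simp
    have "(\<integral>\<omega>. \<bar>(push ^^ n) \<phi> \<omega> - \<alpha> * env_f \<omega>\<bar> \<partial>P) \<le>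
       (\<integral>\<omega>. \<bar>(push ^^ n) (\<lambda>\<omega>. \<phi> \<omega> - \<phi>' B \<omega>) \<omega>\<bar> + \<bar>(push ^^ n) (\<phi>' B) \<omega> - \<beta> * env_f \<omega>\<bar> + \<bar>\<beta> - \<alpha>\<bar> * env_f \<omega> \<partial>P)"
    proof (rule integral_mono_AE)
      show "AE \<omega> in P. \<bar>(push ^^ n) \<phi> \<omega> - \<alpha> * env_f \<omega>\<bar> \<le> \<bar>(push ^^ n) (\<lambda>\<omega>. \<phi> \<omega> - \<phi>' B \<omega>) \<omega>\<bar> + \<bar>(push ^^ n) (\<phi>' B) \<omega> - \<beta> * env_f \<omega>\<bar> + \<bar>\<beta> - \<alpha>\<bar> * env_f \<omega>"
        using AE_good
      proof eventually_elim
        case (elim \<omega>)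
        have "\<bar>\<beta> - \<alpha>\<bar> * env_f \<omega> = \<bar>\<beta> * env_f \<omega> - \<alpha> * env_f \<omega>\<bar>"
          using env_f_pos[OF elim] by (simp add: left_diff_distrib[symmetric] abs_mult)
        then show ?case unfolding push_pow_diff by linarith
      qed
    qed (intro integrable_abs Bochner_Integration.integrable_diff Bochner_Integration.integrable_add
          integrable_mult_right integrable_push_pow \<phi> int' integrable_env_f)+
    also have "\<dots> = (\<integral>\<omega>. \<bar>(push ^^ n) (\<lambda>\<omega>. \<phi> \<omega> - \<phi>' B \<omega>) \<omega>\<bar> \<partial>P) + (\<integral>\<omega>. \<bar>(push ^^ n) (\<phi>' B) \<omega> - \<beta> * env_f \<omega>\<bar> \<partial>P) + \<bar>\<beta> - \<alpha>\<bar> * (1 / speed P)"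
      using integrable_push_pow[OF d, of n] integrable_push_pow[OF int', of n B] integrable_env_f by (simp add: integral_env_f)
    also have "(\<integral>\<omega>. \<bar>(push ^^ n) (\<lambda>\<omega>. \<phi> \<omega> - \<phi>' B \<omega>) \<omega>\<bar> \<partial>P) \<le> (\<integral>\<omega>. \<bar>\<phi> \<omega> - \<phi>' B \<omega>\<bar> \<partial>P)"
      by (rule integral_abs_push_pow_le[OF d])
    \<comment> \<open>The integral \<open>1 / speed P\<close> of \<open>env_f\<close> cancels the
      factor \<open>speed P\<close> in both constants.\<close>
    also have "\<bar>\<beta> - \<alpha>\<bar> * (1 / speed P) = \<bar>\<integral>\<omega>. \<phi> \<omega> - \<phi>' B \<omega> \<partial>P\<bar>"
      unfolding \<alpha>_def \<beta>_def using speed_pos \<phi> int'[of B]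
      by (simp add: right_diff_distrib[symmetric] abs_mult abs_minus_commute)
    also have "\<dots> \<le> (\<integral>\<omega>. \<bar>\<phi> \<omega> - \<phi>' B \<omega>\<bar> \<partial>P)"
      by (rule integral_abs_bound)
    finally show ?case using B elim \<open>e > 0\<close> by simp
  qed
  then show "\<exists>no. \<forall>n\<ge>no. norm ((\<integral>\<omega>. \<bar>(push ^^ n) \<phi> \<omega> - \<alpha> * env_f \<omega>\<bar> \<partial>P) - 0) < e"
    by (simp add: eventually_sequentially abs_of_nonneg)
qed

end

subsection \<open>Transition probabilities of the walk\<close>

primrec walk_pmf :: "env \<Rightarrow> int \<Rightarrow> nat \<Rightarrow> int pmf" where
  "walk_pmf \<omega> y 0 = return_pmf y"
| "walk_pmf \<omega> y (Suc n) = bind_pmf (walk_pmf \<omega> y n) (step \<omega>)"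

abbreviation tprob :: "env \<Rightarrow> nat \<Rightarrow> int \<Rightarrow> int \<Rightarrow> real" where
  "tprob \<omega> n y x \<equiv> pmf (walk_pmf \<omega> y n) x"

lemma trans_Suc:
  assumes "\<And>z. 0 \<le> \<omega> z \<and> \<omega> z \<le> 1"
  shows "tprob \<omega> (Suc n) y x = \<omega> (x - 1) * tprob \<omega> n y (x - 1) + (1 - \<omega> (x + 1)) * tprob \<omega> n y (x + 1)"
proof -
  have "tprob \<omega> (Suc n) y x = (\<integral>z. pmf (step \<omega> z) x \<partial>measure_pmf (walk_pmf \<omega> y n))"
    by (simp add: pmf_bind)
  also have "\<dots> = (\<integral>z. \<omega> (x - 1) * indicator {x - 1} z + (1 - \<omega> (x + 1)) * indicator {x + 1} z \<partial>measure_pmf (walk_pmf \<omega> y n))"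
    by (intro Bochner_Integration.integral_cong) (auto simp: pmf_step assms split: split_indicator)
  also have "\<dots> = \<omega> (x - 1) * tprob \<omega> n y (x - 1) + (1 - \<omega> (x + 1)) * tprob \<omega> n y (x + 1)"
    by (subst Bochner_Integration.integral_add) (auto simp: measure_pmf_single measure_pmf.emeasure_eq_measure)
  finally show ?thesis .
qed

lemma trans_eq_0: "n < \<bar>x - y\<bar> \<Longrightarrow> tprob \<omega> n y x = 0"
proof (induction n arbitrary: x)
  case (Suc n)
  have "x \<notin> set_pmf (walk_pmf \<omega> y (Suc n))"
  proof
    assume "x \<in> set_pmf (walk_pmf \<omega> y (Suc n))"
    then obtain z where z: "z \<in> set_pmf (walk_pmf \<omega> y n)" "x \<in> set_pmf (step \<omega> z)" by auto
    then have "x = z + 1 \<or> x = z - 1" by (auto simp: step_def)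
    moreover have "\<not> n < \<bar>z - y\<bar>" using Suc.IH[of z] z(1) by (auto simp: set_pmf_iff)
    ultimately show False using Suc.prems by auto
  qed
  then show ?case by (simp only: set_pmf_iff not_not)
qed (auto simp: indicator_def)

context iid_environment
begin

lemma space_P_bounds: "\<omega> \<in> space P \<Longrightarrow> 0 \<le> \<omega> z \<and> \<omega> z \<le> 1"
  by (auto simp: space_P Pi_iff)

lemma push_pow_eq_sum:
  assumes "\<omega> \<in> space P" "finite Y" "{x - int n..x + int n} \<subseteq> Y"
  shows "(push ^^ n) \<phi> (shift x \<omega>) = (\<Sum>y\<in>Y. \<phi> (shift y \<omega>) * tprob \<omega> n y x)"
  using assms(3)
proof (induction n arbitrary: x)
  case 0
  have "(\<Sum>y\<in>Y. \<phi> (shift y \<omega>) * tprob \<omega> 0 y x) = (\<Sum>y\<in>{x}. \<phi> (shift y \<omega>) * tprob \<omega> 0 y x)"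
    using 0 assms(2) by (intro sum.mono_neutral_right) (auto simp: indicator_def)
  then show ?case by simp
next
  case (Suc n)
  have "(push ^^ Suc n) \<phi> (shift x \<omega>) = \<omega> (x - 1) * (push ^^ n) \<phi> (shift (x - 1) \<omega>) + (1 - \<omega> (x + 1)) * (push ^^ n) \<phi> (shift (x + 1) \<omega>)"
    by (simp add: push_apply[of "(push ^^ n) \<phi>"]) (simp add: shift_def)
  also have "\<dots> = \<omega> (x - 1) * (\<Sum>y\<in>Y. \<phi> (shift y \<omega>) * tprob \<omega> n y (x - 1)) + (1 - \<omega> (x + 1)) * (\<Sum>y\<in>Y. \<phi> (shift y \<omega>) * tprob \<omega> n y (x + 1))"
    using Suc.prems by (subst (1 2) Suc.IH) auto
  also have "\<dots> = (\<Sum>y\<in>Y. \<phi> (shift y \<omega>) * tprob \<omega> (Suc n) y x)"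
    unfolding trans_Suc[OF space_P_bounds[OF assms(1)]]
    by (simp add: sum_distrib_left sum.distrib distrib_left mult.left_commute)
  finally show ?case .
qed

text \<open>The reversed walk in a fixed environment, with its invariant measure on the line.\<close>
definition line :: "env \<Rightarrow> int measure" where
  "line \<omega> = density (count_space UNIV) (\<lambda>x. ennreal (env_f (shift x \<omega>)))"

lemma
  fixes v :: "int \<Rightarrow> real"
  assumes "good \<omega>"
  shows integrable_line: "integrable (line \<omega>) v \<longleftrightarrow> integrable (count_space UNIV) (\<lambda>x. env_f (shift x \<omega>) * v x)"
    and integral_line: "(\<integral>x. v x \<partial>line \<omega>) = (\<integral>x. env_f (shift x \<omega>) * v x \<partial>count_space UNIV)"
  unfolding line_def using env_f_pos[OF good_shift[OF assms]]
  by (subst integrable_density integral_density; auto simp: less_imp_le)+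

lemma two_point_operator_line:
  assumes g: "good \<omega>"
  shows "two_point_operator (line \<omega>) (\<lambda>x. x + 1) (\<lambda>x. x - 1) (\<lambda>x. rev_p (shift x \<omega>)) kap"
proof
  have s: "measurable (line \<omega>) N = measurable (count_space UNIV) N" for N :: "'z measure"
    by (rule measurable_cong_sets) (simp_all add: line_def)
  have s': "measurable (line \<omega>) (line \<omega>) = measurable (count_space UNIV) (count_space UNIV)"
    by (rule measurable_cong_sets) (simp_all add: line_def)
  show "(\<lambda>x. x + 1) \<in> line \<omega> \<rightarrow>\<^sub>M line \<omega>" "(\<lambda>x. x - 1) \<in> line \<omega> \<rightarrow>\<^sub>M line \<omega>" by (simp_all add: s')
  show "(\<lambda>x. rev_p (shift x \<omega>)) \<in> borel_measurable (line \<omega>)" by (simp add: s)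
  show "0 < kap" by (rule kap_pos)
  show "kap \<le> rev_p (shift x \<omega>)" "rev_p (shift x \<omega>) \<le> 1 - kap" for x by (rule rev_p_bounds)+
  fix v :: "int \<Rightarrow> real"
  let ?f = "\<lambda>x. env_f (shift x \<omega>)" and ?p = "\<lambda>x. rev_p (shift x \<omega>)"
  let ?T = "\<lambda>x. ?p x * v (x + 1) + (1 - ?p x) * v (x - 1)"
  let ?C = "count_space (UNIV :: int set)"
  assume "integrable (line \<omega>) v"
  then have fv: "integrable ?C (\<lambda>x. ?f x * v x)" by (simp add: integrable_line[OF g])
  \<comment> \<open>\<open>a x\<close> and \<open>b x\<close> are the parts of the mass at
    \<open>x\<close> that the forward walk sends to \<open>x - 1\<close> and to
    \<open>x + 1\<close>. Translating the two sums separately recombines them into the mass at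
    \<open>x\<close>, which is the invariance claim.\<close>
  define a where "a x = (1 - \<omega> x) * (?f x * v x)" for x
  define b where "b x = \<omega> x * (?f x * v x)" for x
  have le: "\<bar>r * t\<bar> \<le> \<bar>t\<bar>" if "0 \<le> r" "r \<le> 1" for r t :: real
    using that by (simp add: abs_mult mult_left_le_one_le)
  have a: "integrable ?C a" and b: "integrable ?C b"
    unfolding a_def b_def
    by (rule Bochner_Integration.integrable_bound[OF fv];
        auto intro!: le simp: less_imp_le[OF good_bounds(3)[OF g]] less_imp_le[OF good_bounds(4)[OF g]])+
  have bij: "bij_betw (\<lambda>x::int. x + 1) UNIV UNIV" "bij_betw (\<lambda>x::int. x - 1) UNIV UNIV"
    by (rule bij_betw_byWitness[of _ "\<lambda>x. x - 1"]; simp) (rule bij_betw_byWitness[of _ "\<lambda>x. x + 1"]; simp)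
  have e: "?f x * ?T x = a (x + 1) + b (x - 1)" for x
  proof -
    note gx = good_shift[OF g, of x]
    have "?f x * ?T x = (?f x * ?p x) * v (x + 1) + (?f x * (1 - ?p x)) * v (x - 1)"
      by (simp add: algebra_simps)
    also have "?f x * ?p x = (1 - \<omega> (x + 1)) * ?f (x + 1)"
      using rev_p_fwd[OF gx] by simp (simp add: shift_def)
    also have "?f x * (1 - ?p x) = \<omega> (x - 1) * ?f (x - 1)"
      using rev_p_bwd[OF gx] by simp (simp add: shift_def)
    finally show ?thesis by (simp add: a_def b_def)
  qed
  have a': "integrable ?C (\<lambda>x. a (x + 1))" and b': "integrable ?C (\<lambda>x. b (x - 1))"
    using a b by (simp_all add: integrable_bij_count_space[OF bij(1)] integrable_bij_count_space[OF bij(2)])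
  have "(\<integral>x. a (x + 1) + b (x - 1) \<partial>?C) = (\<integral>x. a x \<partial>?C) + (\<integral>x. b x \<partial>?C)"
    using a' b' by (simp add: integral_bij_count_space[OF bij(1)] integral_bij_count_space[OF bij(2)])
  also have "\<dots> = (\<integral>x. a x + b x \<partial>?C)" using a b by simp
  also have "(\<lambda>x. a x + b x) = (\<lambda>x. ?f x * v x)" by (auto simp: a_def b_def algebra_simps)
  finally show "integrable (line \<omega>) ?T \<and> (\<integral>x. ?T x \<partial>line \<omega>) = (\<integral>x. v x \<partial>line \<omega>)"
    unfolding integrable_line[OF g] integral_line[OF g] e using a' b' by simp
qed simp_all

text \<open>\<open>env_f\<close> is at least 1 on good environments, so \<open>line \<omega>\<close>
  dominates counting measure; this turns integral bounds into pointwise ones.\<close>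

lemma sum_le_integral_line:
  fixes w :: "int \<Rightarrow> real"
  assumes g: "good \<omega>" and w: "integrable (line \<omega>) w" "\<And>x. 0 \<le> w x" and "finite S"
  shows "(\<Sum>x\<in>S. w x) \<le> (\<integral>x. w x \<partial>line \<omega>)"
proof -
  let ?f = "\<lambda>x. env_f (shift x \<omega>)" and ?C = "count_space (UNIV :: int set)"
  have fw: "integrable ?C (\<lambda>x. ?f x * w x)" using w by (simp add: integrable_line[OF g])
  have f: "1 \<le> ?f x" for x by (rule env_f_ge_1[OF good_shift[OF g]])
  have i: "integrable ?C (\<lambda>x. indicator S x * (?f x * w x))"
    by (rule Bochner_Integration.integrable_bound[OF fw]) (auto split: split_indicator)
  have "(\<Sum>x\<in>S. w x) \<le> (\<Sum>x\<in>S. ?f x * w x)"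
  proof (rule sum_mono)
    show "w x \<le> ?f x * w x" for x using mult_right_mono[OF f[of x] w(2)[of x]] by simp
  qed
  also have "\<dots> = (\<integral>x. indicator S x * (?f x * w x) \<partial>?C)"
  proof -
    have fin: "finite {x \<in> UNIV. indicator S x * (?f x * w x) \<noteq> 0}"
      by (rule finite_subset[OF _ \<open>finite S\<close>]) (auto split: split_indicator_asm)
    show ?thesis
      unfolding lebesgue_integral_count_space_finite_support[OF fin]
      by (rule sum.mono_neutral_cong_right[OF \<open>finite S\<close>]) (auto split: split_indicator split_indicator_asm)
  qed
  also have "\<dots> \<le> (\<integral>x. ?f x * w x \<partial>?C)"
    using f w(2) by (intro integral_mono i fw) (auto split: split_indicator intro: mult_nonneg_nonneg order_trans[OF zero_le_one])
  also have "\<dots> = (\<integral>x. w x \<partial>line \<omega>)" by (simp add: integral_line[OF g])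
  finally show ?thesis .
qed

text \<open>A heat-kernel bound from energy: the weighted gradient energies over \<open>n\<close>
  steps sum to at most 1, so at some time \<open>k < n\<close> the gradient is small and the profile
  nearly flat, and a nearly flat profile of mass 1 has a small maximum. \<open>K\<close> is the
  number of sites along which flatness is used.\<close>

lemma trans_le_aux:
  fixes K :: nat
  assumes g: "good \<omega>" and "n > 0" "K > 0"
  shows "(tprob \<omega> n y x / env_f (shift x \<omega>))\<^sup>2 \<le> 1 / K + K / (kap * sqrt n)"
proof -
  let ?f = "\<lambda>x. env_f (shift x \<omega>)" and ?C = "count_space (UNIV :: int set)"
  interpret L: two_point_operator "line \<omega>" "\<lambda>x. x + 1" "\<lambda>x. x - 1" "\<lambda>x. rev_p (shift x \<omega>)" kap
    by (rule two_point_operator_line[OF g])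
  have f: "1 \<le> ?f x" for x by (rule env_f_ge_1[OF good_shift[OF g]])
  then have f0: "0 < ?f x" for x by (rule less_le_trans[OF zero_less_one])
  have bd: "0 \<le> \<omega> z \<and> \<omega> z \<le> 1" for z using good_bounds[OF g, of z] by auto
  define v where "v k x = tprob \<omega> k y x / ?f x" for k x
  have v_nonneg: "0 \<le> v k x" for k x using f0[of x] by (simp add: v_def)
  have v_pow: "(L.T ^^ k) (v 0) = v k" for k
  proof (induction k)
    case (Suc k)
    have "L.T (v k) x = v (Suc k) x" for x
    proof -
      note gx = good_shift[OF g, of x]
      have p1: "?f x * rev_p (shift x \<omega>) = (1 - \<omega> (x + 1)) * ?f (x + 1)"
        using rev_p_fwd[OF gx] by simp (simp add: shift_def)
      have p2: "?f x * (1 - rev_p (shift x \<omega>)) = \<omega> (x - 1) * ?f (x - 1)"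
        using rev_p_bwd[OF gx] by simp (simp add: shift_def)
      have "?f x * L.T (v k) x = (?f x * rev_p (shift x \<omega>)) * v k (x + 1) + (?f x * (1 - rev_p (shift x \<omega>))) * v k (x - 1)"
        by (simp add: L.T_def algebra_simps)
      also have "\<dots> = tprob \<omega> (Suc k) y x"
        unfolding p1 p2 trans_Suc[OF bd] v_def using f0[of "x + 1"] f0[of "x - 1"] by simp
      finally show ?thesis using f0[of x] by (simp add: v_def field_simps)
    qed
    then show ?case using Suc by auto
  qed simp
  have line_integral: "integrable (line \<omega>) w \<and> (\<integral>x. w x \<partial>line \<omega>) = ?f y * w y" if "\<And>x. x \<noteq> y \<Longrightarrow> w x = 0" for w
  proof -
    have fin: "finite {x \<in> UNIV. ?f x * w x \<noteq> 0}"
      by (rule finite_subset[of _ "{y}"]) (use that in auto)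
    have "integrable ?C (\<lambda>x. ?f x * w x)"
    proof -
      have "integrable (count_space {y}) (\<lambda>x. ?f x * w x)" by (rule integrable_count_space) simp
      then have "integrable ?C (\<lambda>x. indicator {y} x *\<^sub>R (?f x * w x))"
        by (subst integrable_restrict_space[symmetric]) (simp_all add: restrict_count_space)
      also have "(\<lambda>x. indicator {y} x *\<^sub>R (?f x * w x)) = (\<lambda>x. ?f x * w x)"
      proof
        show "indicator {y} x *\<^sub>R (?f x * w x) = ?f x * w x" for x using that[of x] by (cases "x = y") auto
      qed
      finally show ?thesis .
    qed
    moreover have "(\<integral>x. ?f x * w x \<partial>?C) = (\<Sum>x\<in>{y}. ?f x * w x)"
      unfolding lebesgue_integral_count_space_finite_support[OF fin]
      by (rule sum.mono_neutral_cong_left) (use that in auto)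
    ultimately show ?thesis by (simp add: integrable_line[OF g] integral_line[OF g])
  qed
  have v0: "v 0 x = 0" if "x \<noteq> y" for x using that by (simp add: v_def indicator_def)
  have v0y: "v 0 y = 1 / ?f y" by (simp add: v_def)
  have meas: "v k \<in> borel_measurable (line \<omega>)" for k by (simp add: line_def)
  have iv0: "integrable (line \<omega>) (v 0)" "(\<integral>x. v 0 x \<partial>line \<omega>) = 1"
    using line_integral[OF v0] f0[of y] by (auto simp: v0y)
  \<comment> \<open>The initial profile is a point mass divided by \<open>?f y\<close>; its energy
    is \<open>1 / ?f y\<close>, hence at most 1.\<close>
  have sq0: "integrable (line \<omega>) (\<lambda>x. (v 0 x)\<^sup>2)" "(\<integral>x. (v 0 x)\<^sup>2 \<partial>line \<omega>) \<le> 1"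
    using line_integral[of "\<lambda>x. (v 0 x)\<^sup>2"] v0 f0[of y] f[of y] by (auto simp: v0y power2_eq_square)
  have iv: "integrable (line \<omega>) (v k)" "(\<integral>x. v k x \<partial>line \<omega>) = 1" for k
    using L.integrable_T_pow[OF iv0(1), of k] L.integral_T_pow[OF iv0(1), of k] iv0(2) unfolding v_pow by auto
  have sq: "integrable (line \<omega>) (\<lambda>x. (v k x)\<^sup>2)" for k
    using L.integrable_T_pow_square[OF meas sq0(1), of k] unfolding v_pow .
  \<comment> \<open>Pigeonhole: the \<open>n\<close> gradient energies add up to at most 1 over the
    square of \<open>kap\<close>.\<close>
  have "\<exists>k<n. (\<integral>x. (L.grad (v k) x)\<^sup>2 \<partial>line \<omega>) \<le> 1 / (kap\<^sup>2 * n)"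
  proof (rule ccontr)
    assume "\<not> (\<exists>k<n. (\<integral>x. (L.grad (v k) x)\<^sup>2 \<partial>line \<omega>) \<le> 1 / (kap\<^sup>2 * n))"
    then have "(\<Sum>k<n. 1 / (kap\<^sup>2 * n)) < (\<Sum>k<n. \<integral>x. (L.grad (v k) x)\<^sup>2 \<partial>line \<omega>)"
      using \<open>n > 0\<close> by (intro sum_strict_mono) (auto simp: not_le)
    then have "kap\<^sup>2 * (\<Sum>k<n. 1 / (kap\<^sup>2 * n)) < kap\<^sup>2 * (\<Sum>k<n. \<integral>x. (L.grad (v k) x)\<^sup>2 \<partial>line \<omega>)"
      using kap_pos by simp
    moreover have "kap\<^sup>2 * (\<Sum>k<n. 1 / (kap\<^sup>2 * n)) = 1" using kap_pos \<open>n > 0\<close> by simp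
    moreover have "0 \<le> (\<integral>x. (v n x)\<^sup>2 \<partial>line \<omega>)" by simp
    moreover have "(\<integral>x. (v n x)\<^sup>2 \<partial>line \<omega>) + kap\<^sup>2 * (\<Sum>k<n. \<integral>x. (L.grad (v k) x)\<^sup>2 \<partial>line \<omega>) \<le> (\<integral>x. (v 0 x)\<^sup>2 \<partial>line \<omega>)"
      using L.sum_energy_dissipation[OF meas sq0(1), of n] unfolding v_pow .
    ultimately show False using sq0(2) by linarith
  qed
  then obtain k where k: "k < n" "(\<integral>x. (L.grad (v k) x)\<^sup>2 \<partial>line \<omega>) \<le> 1 / (kap\<^sup>2 * n)" by blast
  define \<eta> where "\<eta> = 1 / (kap * sqrt n)"
  have \<eta>0: "0 \<le> \<eta>" using kap_pos by (simp add: \<eta>_def)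
  have \<eta>: "\<bar>v k (x + 1) - v k (x - 1)\<bar> \<le> \<eta>" for x
  proof -
    have "(\<Sum>x\<in>{x}. (L.grad (v k) x)\<^sup>2) \<le> (\<integral>x. (L.grad (v k) x)\<^sup>2 \<partial>line \<omega>)"
      by (rule sum_le_integral_line[OF g L.integrable_grad_square[OF meas sq]]) auto
    then have "(v k (x + 1) - v k (x - 1))\<^sup>2 \<le> \<eta>\<^sup>2"
      using k(2) by (simp add: L.grad_def \<eta>_def power_mult_distrib power_divide)
    then show ?thesis using \<eta>0 by (simp add: abs_le_square_iff[symmetric])
  qed
  \<comment> \<open>The gradient compares \<open>x + 1\<close> with \<open>x - 1\<close>, so the
    comparison has to run along sites of one parity.\<close>
  have step: "v k x \<le> v k (x + 2 * int j) + j * \<eta>" for x j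
  proof (induction j)
    case (Suc j)
    have "v k (x + 2 * int j) \<le> v k (x + 2 * int (Suc j)) + \<eta>"
      using \<eta>[of "x + 2 * int j + 1"] by (simp add: algebra_simps)
    with Suc show ?case by (simp add: algebra_simps)
  qed simp
  \<comment> \<open>A value at \<open>x\<close> is compared with the mean over \<open>K\<close>
    sites to its right, whose values sum to at most 1.\<close>
  have sup: "v k x \<le> 1 / K + K * \<eta>" for x
  proof -
    have "(\<Sum>j<K. v k x) \<le> (\<Sum>j<K. v k (x + 2 * int j) + K * \<eta>)"
    proof (rule sum_mono)
      fix j assume "j \<in> {..<K}"
      then have "j * \<eta> \<le> K * \<eta>" using \<eta>0 by (intro mult_right_mono) auto
      then show "v k x \<le> v k (x + 2 * int j) + K * \<eta>" using step[of x j] by linarith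
    qed
    also have "\<dots> = (\<Sum>z\<in>(\<lambda>j. x + 2 * int j) ` {..<K}. v k z) + K * (K * \<eta>)"
      by (subst sum.reindex) (auto simp: sum.distrib inj_on_def)
    also have "(\<Sum>z\<in>(\<lambda>j. x + 2 * int j) ` {..<K}. v k z) \<le> 1"
      using sum_le_integral_line[OF g iv(1)[of k] v_nonneg] iv(2)[of k] by simp
    finally have "K * v k x \<le> 1 + K * (K * \<eta>)" by simp
    then have "v k x \<le> (1 + K * (K * \<eta>)) / K" using \<open>K > 0\<close> by (simp add: field_simps)
    also have "\<dots> = 1 / K + K * \<eta>" using \<open>K > 0\<close> by (simp add: add_divide_distrib)
    finally show ?thesis .
  qed
  \<comment> \<open>The flat time \<open>k\<close> depends on \<open>n\<close>; monotonicity of the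
    energy carries the bound on to time \<open>n\<close>, where the energy dominates a single
    square. At time \<open>k\<close> the energy is at most the maximum of the profile times its
    mass.\<close>
  have "(\<Sum>x\<in>{x}. (v n x)\<^sup>2) \<le> (\<integral>x. (v n x)\<^sup>2 \<partial>line \<omega>)"
    by (rule sum_le_integral_line[OF g sq]) auto
  also have "\<dots> \<le> (\<integral>x. (v k x)\<^sup>2 \<partial>line \<omega>)"
    using L.integral_T_pow_square_antimono[OF meas sq0(1), of k n] k(1) unfolding v_pow by simp
  also have "\<dots> \<le> (\<integral>x. (1 / K + K * \<eta>) * v k x \<partial>line \<omega>)"
    using sup v_nonneg by (intro integral_mono sq integrable_mult_right iv) (auto simp: power2_eq_square intro: mult_right_mono)
  also have "\<dots> = 1 / K + K * \<eta>" by (simp add: iv)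
  finally show ?thesis by (simp add: v_def \<eta>_def)
qed

lemma trans_uniformly_small:
  assumes "\<epsilon> > 0"
  shows "\<exists>N. \<forall>n\<ge>N. \<forall>\<omega>. good \<omega> \<longrightarrow> (\<forall>y x. tprob \<omega> n y x \<le> \<epsilon> * env_f (shift x \<omega>))"
proof -
  \<comment> \<open>\<open>K\<close> is chosen so that \<open>1 / K\<close> takes at most half of
    the square of \<open>\<epsilon>\<close>. The other term involves only \<open>kap\<close> and
    \<open>n\<close>, so one threshold works for all good environments.\<close>
  define K where "K = nat \<lceil>2 / \<epsilon>\<^sup>2\<rceil>"
  have K: "real K \<ge> 2 / \<epsilon>\<^sup>2" by (simp add: K_def)
  have "0 < 2 / \<epsilon>\<^sup>2" using assms by simp
  with K have K0: "K > 0" by (metis gr0I less_le_trans not_less_iff_gr_or_eq of_nat_0)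
  have "1 / K \<le> \<epsilon>\<^sup>2 / 2" using K K0 assms by (simp add: field_simps)
  have "(\<lambda>n. real K / (kap * sqrt (real n))) \<longlonglongrightarrow> 0" using kap_pos by real_asymp
  then have "\<forall>\<^sub>F n in sequentially. real K / (kap * sqrt (real n)) < \<epsilon>\<^sup>2 / 2"
    using assms by (intro order_tendstoD) auto
  then have "\<forall>\<^sub>F n in sequentially. \<forall>\<omega>. good \<omega> \<longrightarrow> (\<forall>y x. tprob \<omega> n y x \<le> \<epsilon> * env_f (shift x \<omega>))"
    using eventually_gt_at_top[of 0]
  proof (eventually_elim, intro allI impI)
    fix n :: nat and \<omega> y x
    assume n: "real K / (kap * sqrt (real n)) < \<epsilon>\<^sup>2 / 2" "0 < n" and g: "good \<omega>"
    have "(tprob \<omega> n y x / env_f (shift x \<omega>))\<^sup>2 \<le> \<epsilon>\<^sup>2"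
      using trans_le_aux[OF g n(2) K0, of y x] n(1) \<open>1 / K \<le> \<epsilon>\<^sup>2 / 2\<close> by linarith
    then have "tprob \<omega> n y x / env_f (shift x \<omega>) \<le> \<epsilon>"
      by (rule power2_le_imp_le) (use assms in simp)
    then show "tprob \<omega> n y x \<le> \<epsilon> * env_f (shift x \<omega>)"
      using env_f_pos[OF good_shift[OF g]] by (simp add: field_simps)
  qed
  then show ?thesis by (simp add: eventually_sequentially)
qed

end

text \<open>\<open>walk_law\<close> is known through cylinder probabilities, so an event at one time
  is cut into the countably many paths leading to it; one further step multiplies the weight of each
  path by a transition probability.\<close>

lemma emeasure_walk_law_coordinate: "emeasure (walk_law \<omega> y) {p. p n = x} = tprob \<omega> n y x"
proof (induction n arbitrary: x)
  case 0
  have "{p. p 0 = x} = {p :: nat \<Rightarrow> int. \<forall>k\<le>0. p k = x}" by simp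
  then show ?case
    using emeasure_walk_law_cylinder[of \<omega> y 0 "\<lambda>_. x"] by (auto simp: indicator_def)
next
  case (Suc n)
  let ?M = "walk_law \<omega> y"
  have [measurable]: "(\<lambda>p. p k) \<in> ?M \<rightarrow>\<^sub>M count_space UNIV" for k
    unfolding measurable_cong_sets[OF sets_walk_law refl] by measurable
  have sets: "{p. R p} \<in> sets ?M" if "Measurable.pred ?M R" for R
    using predE[OF that] by simp
  \<comment> \<open>Paths up to time \<open>n\<close> that end in \<open>z\<close>, coded as lists
    of length \<open>Suc n\<close> so that the index set is countable.\<close>
  define I where "I z = {xs :: int list. length xs = Suc n \<and> xs ! n = z}" for z
  have c: "countable (I z)" for z by (rule countableI_type)
  have disj: "xs = ys" if "xs \<in> I z" "ys \<in> I z" "\<forall>k\<le>n. xs ! k = ys ! k" for xs ys z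
    using that by (intro nth_equalityI) (auto simp: I_def)
  have path: "map p [0..<Suc n] \<in> I z" "\<forall>k\<le>n. p k = map p [0..<Suc n] ! k" if "p n = z" for p z
    using that by (auto simp: I_def nth_append simp del: upt_Suc)
  have eq1: "{p. p n = z} = (\<Union>xs\<in>I z. {p. \<forall>k\<le>n. p k = xs ! k})" for z
  proof
    show "{p. p n = z} \<subseteq> (\<Union>xs\<in>I z. {p. \<forall>k\<le>n. p k = xs ! k})"
    proof
      fix p :: "nat \<Rightarrow> int" assume "p \<in> {p. p n = z}"
      then have "p n = z" by simp
      then have "map p [0..<Suc n] \<in> I z" "\<forall>k\<le>n. p k = map p [0..<Suc n] ! k"
        using path[of p z] by blast+
      then show "p \<in> (\<Union>xs\<in>I z. {p. \<forall>k\<le>n. p k = xs ! k})"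
        by (intro UN_I CollectI)
    qed
  qed (auto simp: I_def)
  have eq2: "{p. p n = z \<and> p (Suc n) = x} = (\<Union>xs\<in>I z. {p. \<forall>k\<le>Suc n. p k = (xs @ [x]) ! k})" for z
  proof -
    have "(\<forall>k\<le>Suc n. p k = (xs @ [x]) ! k) \<longleftrightarrow> (\<forall>k\<le>n. p k = xs ! k) \<and> p (Suc n) = x" if "xs \<in> I z" for p xs
      using that by (auto simp: I_def nth_append le_Suc_eq)
    then have "(\<Union>xs\<in>I z. {p. \<forall>k\<le>Suc n. p k = (xs @ [x]) ! k}) = (\<Union>xs\<in>I z. {p. \<forall>k\<le>n. p k = xs ! k}) \<inter> {p. p (Suc n) = x}"
      by auto
    then show ?thesis unfolding eq1[symmetric] by auto
  qed
  have joint: "emeasure ?M {p. p n = z \<and> p (Suc n) = x} = tprob \<omega> n y z * ennreal (pmf (step \<omega> z) x)" for z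
  proof -
    have "emeasure ?M {p. p n = z \<and> p (Suc n) = x} = (\<integral>\<^sup>+xs. emeasure ?M {p. \<forall>k\<le>Suc n. p k = (xs @ [x]) ! k} \<partial>count_space (I z))"
      unfolding eq2
    proof (rule emeasure_UN_countable[OF _ c])
      show "disjoint_family_on (\<lambda>xs. {p. \<forall>k\<le>Suc n. p k = (xs @ [x]) ! k}) (I z)"
      proof (unfold disjoint_family_on_def, intro ballI impI)
        fix xs ys assume xy: "xs \<in> I z" "ys \<in> I z" "xs \<noteq> ys"
        then obtain k where k: "k \<le> n" "xs ! k \<noteq> ys ! k" using disj by blast
        then have "(xs @ [x]) ! k \<noteq> (ys @ [x]) ! k" using xy by (simp add: nth_append I_def)
        then show "{p. \<forall>k\<le>Suc n. p k = (xs @ [x]) ! k} \<inter> {p. \<forall>k\<le>Suc n. p k = (ys @ [x]) ! k} = {}"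
          using k(1) le_SucI by auto
      qed
    qed (intro sets, measurable)
    also have "\<dots> = (\<integral>\<^sup>+xs. emeasure ?M {p. \<forall>k\<le>n. p k = xs ! k} * ennreal (pmf (step \<omega> z) x) \<partial>count_space (I z))"
    proof (rule nn_integral_cong)
      fix xs assume "xs \<in> space (count_space (I z))"
      then have xs: "length xs = Suc n" "xs ! n = z" by (auto simp: I_def)
      have "(\<Prod>k<n. ennreal (pmf (step \<omega> ((xs @ [x]) ! k)) ((xs @ [x]) ! Suc k))) = (\<Prod>k<n. ennreal (pmf (step \<omega> (xs ! k)) (xs ! Suc k)))"
        using xs by (intro prod.cong) (auto simp: nth_append)
      then show "emeasure ?M {p. \<forall>k\<le>Suc n. p k = (xs @ [x]) ! k} = emeasure ?M {p. \<forall>k\<le>n. p k = xs ! k} * ennreal (pmf (step \<omega> z) x)"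
        unfolding emeasure_walk_law_cylinder[of \<omega> y _ "\<lambda>k. (xs @ [x]) ! k"] emeasure_walk_law_cylinder[of \<omega> y _ "\<lambda>k. xs ! k"]
        using xs by (simp add: nth_append mult.assoc)
    qed
    also have "\<dots> = (\<integral>\<^sup>+xs. emeasure ?M {p. \<forall>k\<le>n. p k = xs ! k} \<partial>count_space (I z)) * ennreal (pmf (step \<omega> z) x)"
      by (rule nn_integral_multc) simp
    also have "(\<integral>\<^sup>+xs. emeasure ?M {p. \<forall>k\<le>n. p k = xs ! k} \<partial>count_space (I z)) = emeasure ?M {p. p n = z}"
      unfolding eq1
    proof (rule emeasure_UN_countable[OF _ c, symmetric])
      show "disjoint_family_on (\<lambda>xs. {p. \<forall>k\<le>n. p k = xs ! k}) (I z)"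
        unfolding disjoint_family_on_def using disj by fastforce
    qed (intro sets, measurable)
    finally show ?thesis by (simp add: Suc)
  qed
  have "{p. p (Suc n) = x} = (\<Union>z\<in>UNIV. {p. p n = z \<and> p (Suc n) = x})" by auto
  then have "emeasure ?M {p. p (Suc n) = x} = emeasure ?M (\<Union>z\<in>UNIV. {p. p n = z \<and> p (Suc n) = x})" by simp
  also have "\<dots> = (\<integral>\<^sup>+z. emeasure ?M {p. p n = z \<and> p (Suc n) = x} \<partial>count_space UNIV)"
  proof (rule emeasure_UN_countable)
    show "{p. p n = z \<and> p (Suc n) = x} \<in> sets ?M" for z by (intro sets) measurable
  qed (auto simp: disjoint_family_on_def)
  also have "\<dots> = (\<integral>\<^sup>+z. ennreal (pmf (step \<omega> z) x) \<partial>measure_pmf (walk_pmf \<omega> y n))"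
    unfolding joint by (simp add: nn_integral_measure_pmf)
  also have "\<dots> = ennreal (tprob \<omega> (Suc n) y x)"
    by (simp add: ennreal_pmf_bind)
  finally show ?case .
qed

text \<open>Positions out of reach have probability 0, and there are countably many of them. This
  reduces the infinite sum in \<open>eta\<close> to finitely many starting sites, away from its
  default value.\<close>

lemma AE_walk_law_range: "AE p in walk_law \<omega> y. \<bar>p n - y\<bar> \<le> int n"
proof -
  have [measurable]: "(\<lambda>p. p n) \<in> walk_law \<omega> y \<rightarrow>\<^sub>M count_space UNIV"
    unfolding measurable_cong_sets[OF sets_walk_law refl] by measurable
  have "AE p in walk_law \<omega> y. p n \<noteq> x" if "int n < \<bar>x - y\<bar>" for x
  proof (rule AE_I)
    show "emeasure (walk_law \<omega> y) {p. p n = x} = 0"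
      using trans_eq_0[OF that] by (simp add: emeasure_walk_law_coordinate)
    have "{p \<in> space (walk_law \<omega> y). p n = x} \<in> sets (walk_law \<omega> y)" by measurable
    then show "{p. p n = x} \<in> sets (walk_law \<omega> y)" by simp
  qed auto
  then have "AE p in walk_law \<omega> y. \<forall>x. int n < \<bar>x - y\<bar> \<longrightarrow> p n \<noteq> x"
    unfolding AE_all_countable by (auto intro: AE_impI)
  then show ?thesis by eventually_elim (metis not_le_imp_less)
qed

text \<open>The integrand sees only the coordinates in \<open>J\<close>, so the infinite product is
  pushed forward to the finite one.\<close>

lemma (in product_prob_space) nn_integral_PiM_prod:
  assumes J: "finite J" "J \<subseteq> I" and f: "\<And>i. i \<in> J \<Longrightarrow> f i \<in> borel_measurable (M i)"
  shows "(\<integral>\<^sup>+x. (\<Prod>i\<in>J. f i (x i)) \<partial>PiM I M) = (\<Prod>i\<in>J. \<integral>\<^sup>+y. f i y \<partial>M i)"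
proof -
  have [measurable]: "(\<lambda>x. \<Prod>i\<in>J. f i (x i)) \<in> borel_measurable (PiM J M)"
  proof (rule borel_measurable_prod_ennreal)
    fix i assume "i \<in> J"
    then show "(\<lambda>x. f i (x i)) \<in> borel_measurable (PiM J M)"
      by (intro measurable_compose[OF measurable_component_singleton] f)
  qed
  have "(\<integral>\<^sup>+x. (\<Prod>i\<in>J. f i (x i)) \<partial>PiM I M) = (\<integral>\<^sup>+x. (\<Prod>i\<in>J. f i (restrict x J i)) \<partial>PiM I M)"
    by (intro nn_integral_cong prod.cong) auto
  also have "\<dots> = (\<integral>\<^sup>+x. (\<Prod>i\<in>J. f i (x i)) \<partial>distr (PiM I M) (PiM J M) (\<lambda>x. restrict x J))"
    by (subst nn_integral_distr) (use J in \<open>auto intro: measurable_restrict_subset\<close>)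
  also have "\<dots> = (\<Prod>i\<in>J. \<integral>\<^sup>+y. f i y \<partial>M i)"
    unfolding distr_PiM_restrict_finite[OF J] by (rule product_nn_integral_prod[OF J(1) f])
  finally show ?thesis .
qed

subsection \<open>Generating functions\<close>

text \<open>In \<open>\<Prod>x\<in>J. s x ^ \<eta> x\<close> a particle at \<open>z\<close> contributes the factor \<open>weight J s z\<close>; \<open>loss \<omega> n J s y\<close> is
  one minus the expected contribution at time \<open>n\<close> of a particle started at \<open>y\<close>.\<close>
definition weight :: "int set \<Rightarrow> (int \<Rightarrow> real) \<Rightarrow> int \<Rightarrow> real" where
  "weight J s z = (if z \<in> J then s z else 1)"

definition loss :: "env \<Rightarrow> nat \<Rightarrow> int set \<Rightarrow> (int \<Rightarrow> real) \<Rightarrow> int \<Rightarrow> real" where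
  "loss \<omega> n J s y = (\<Sum>x\<in>J. (1 - s x) * tprob \<omega> n y x)"

lemma weight_bounds: "(\<And>x. 0 \<le> s x \<and> s x \<le> 1) \<Longrightarrow> 0 \<le> weight J s z \<and> weight J s z \<le> 1"
  by (auto simp: weight_def)

lemma sum_trans_le_1: "finite J \<Longrightarrow> (\<Sum>x\<in>J. tprob \<omega> n y x) \<le> 1"
  using sum_pmf_eq_1[of J] measure_pmf.prob_le_1[of "walk_pmf \<omega> y n" J]
  by (simp add: measure_measure_pmf_finite)

lemma loss_bounds:
  assumes "finite J" "\<And>x. 0 \<le> s x \<and> s x \<le> 1"
  shows "0 \<le> loss \<omega> n J s y" "loss \<omega> n J s y \<le> 1" "loss \<omega> n J s y \<le> (\<Sum>x\<in>J. tprob \<omega> n y x)"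
proof -
  show "0 \<le> loss \<omega> n J s y" unfolding loss_def using assms by (intro sum_nonneg mult_nonneg_nonneg) auto
  show *: "loss \<omega> n J s y \<le> (\<Sum>x\<in>J. tprob \<omega> n y x)"
    unfolding loss_def using assms by (intro sum_mono mult_left_le_one_le) auto
  show "loss \<omega> n J s y \<le> 1" using * sum_trans_le_1[OF assms(1), of \<omega> y n] by linarith
qed

lemma nn_integral_weight:
  assumes J: "finite J" and s: "\<And>x. 0 \<le> s x \<and> s x \<le> 1"
  shows "(\<integral>\<^sup>+p. ennreal (weight J s (p n)) \<partial>walk_law \<omega> y) = ennreal (1 - loss \<omega> n J s y)"
proof -
  interpret prob_space "walk_law \<omega> y" by (rule prob_space_walk_law)
  have [measurable]: "(\<lambda>p. p n) \<in> walk_law \<omega> y \<rightarrow>\<^sub>M count_space UNIV"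
    unfolding measurable_cong_sets[OF sets_walk_law refl] by measurable
  have m: "(\<lambda>p. g (p n)) \<in> borel_measurable (walk_law \<omega> y)" for g :: "int \<Rightarrow> real"
    by measurable
  have sets: "{p. p n = x} \<in> sets (walk_law \<omega> y)" for x
  proof -
    have "{p \<in> space (walk_law \<omega> y). p n = x} \<in> sets (walk_law \<omega> y)" by measurable
    then show ?thesis by simp
  qed
  have prob: "measure (walk_law \<omega> y) {p. p n = x} = tprob \<omega> n y x" for x
    using emeasure_walk_law_coordinate[of \<omega> y n x] by (simp add: emeasure_eq_measure)
  have w: "weight J s z = 1 - (\<Sum>x\<in>J. (1 - s x) * indicator {x} z)" for z
  proof -
    have "(\<Sum>x\<in>J. (1 - s x) * indicator {x} z) = (\<Sum>x\<in>J. if x = z then 1 - s x else 0)"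
      by (intro sum.cong) (auto simp: indicator_def)
    then show ?thesis using J by (simp add: weight_def)
  qed
  have ind: "indicator {x} (p n) = (indicator {p. p n = x} p :: real)" for x and p :: "nat \<Rightarrow> int"
    by (auto simp: indicator_def)
  have int: "integrable (walk_law \<omega> y) (\<lambda>p. (1 - s x) * indicator {p. p n = x} p)" for x
    using sets[of x] by (auto simp: emeasure_eq_measure)
  have "(\<integral>p. weight J s (p n) \<partial>walk_law \<omega> y) = 1 - loss \<omega> n J s y"
    unfolding w ind loss_def using int sets prob
    by (subst Bochner_Integration.integral_diff) (use prob_space in auto)
  moreover have "(\<integral>\<^sup>+p. ennreal (weight J s (p n)) \<partial>walk_law \<omega> y) = ennreal (\<integral>p. weight J s (p n) \<partial>walk_law \<omega> y)"
  proof (rule nn_integral_eq_integral)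
    show "integrable (walk_law \<omega> y) (\<lambda>p. weight J s (p n))"
      by (rule integrable_const_bound[of _ 1]) (use weight_bounds[OF s] m in auto)
  qed (use weight_bounds[OF s] in auto)
  ultimately show ?thesis by simp
qed

abbreviation system_space :: "(config \<times> walks) measure" where
  "system_space \<equiv> (\<Pi>\<^sub>M x\<in>UNIV. count_space UNIV) \<Otimes>\<^sub>M (\<Pi>\<^sub>M j\<in>UNIV \<times> {1..}. \<Pi>\<^sub>M n\<in>UNIV. count_space UNIV)"

lemma sets_quenched: "sets (quenched \<nu> \<omega>) = sets system_space"
  unfolding quenched_def by (intro sets_pair_measure_cong sets_PiM_cong) auto

lemma measurable_config_coordinate: "(\<lambda>\<eta> :: config. \<eta> x) \<in> borel \<rightarrow>\<^sub>M count_space UNIV"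
  unfolding measurable_cong_sets[OF refl sets_borel_eq_count_space[symmetric]] by measurable

lemma measurable_prod_power:
  assumes X: "X \<in> M \<rightarrow>\<^sub>M (borel :: config measure)"
  shows "(\<lambda>\<sigma>. \<Prod>x\<in>J. s x ^ X \<sigma> x :: real) \<in> borel_measurable M"
  by (intro borel_measurable_prod measurable_compose[OF measurable_compose[OF X measurable_config_coordinate]]) simp

lemma eta_eq_sum:
  assumes X: "\<And>y i. i \<ge> 1 \<Longrightarrow> \<bar>X (y, i) n - y\<bar> \<le> int n" and Y: "finite Y" "{x - int n..x + int n} \<subseteq> Y"
  shows "eta n (\<eta>, X) x = (\<Sum>y\<in>Y. \<Sum>i=1..\<eta> y. of_bool (X (y, i) n = x))"
proof -
  have "(\<Sum>\<^sub>\<infinity>y. \<Sum>i=1..\<eta> y. of_bool (X (y, i) n = x) :: nat) = (\<Sum>\<^sub>\<infinity>y\<in>Y. \<Sum>i=1..\<eta> y. of_bool (X (y, i) n = x))"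
  proof (rule infsum_cong_neutral)
    fix y assume "y \<in> UNIV - Y"
    then have "y \<notin> {x - int n..x + int n}" using Y(2) by blast
    then have "X (y, i) n \<noteq> x" if "i \<ge> 1" for i using X[OF that, of y] by auto
    then show "(\<Sum>i=1..\<eta> y. of_bool (X (y, i) n = x) :: nat) = 0" by simp
  qed auto
  then show ?thesis using Y(1) by (simp add: eta_def)
qed

text \<open>Regrouping by particles instead of sites: a particle occupies exactly one site at time
  \<open>n\<close>, so at most one of its factors over \<open>J\<close> differs from 1.\<close>

lemma prod_power_eta:
  assumes X: "\<And>y i. i \<ge> 1 \<Longrightarrow> \<bar>X (y, i) n - y\<bar> \<le> int n"
    and J: "finite J" and Y: "finite Y" "\<And>x. x \<in> J \<Longrightarrow> {x - int n..x + int n} \<subseteq> Y"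
  shows "(\<Prod>x\<in>J. s x ^ eta n (\<eta>, X) x) = (\<Prod>(y, i)\<in>Sigma Y (\<lambda>y. {1..\<eta> y}). weight J s (X (y, i) n))"
proof -
  have "(\<Prod>x\<in>J. s x ^ eta n (\<eta>, X) x) = (\<Prod>x\<in>J. \<Prod>y\<in>Y. \<Prod>i=1..\<eta> y. s x ^ of_bool (X (y, i) n = x))"
  proof (intro prod.cong refl)
    fix x assume "x \<in> J"
    then have "eta n (\<eta>, X) x = (\<Sum>y\<in>Y. \<Sum>i=1..\<eta> y. of_bool (X (y, i) n = x))"
      by (intro eta_eq_sum X Y)
    then show "s x ^ eta n (\<eta>, X) x = (\<Prod>y\<in>Y. \<Prod>i=1..\<eta> y. s x ^ of_bool (X (y, i) n = x))"
      by (simp only: power_sum)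
  qed
  also have "\<dots> = (\<Prod>y\<in>Y. \<Prod>i=1..\<eta> y. \<Prod>x\<in>J. s x ^ of_bool (X (y, i) n = x))"
    by (subst prod.swap) (intro prod.cong refl prod.swap)
  also have "\<dots> = (\<Prod>y\<in>Y. \<Prod>i=1..\<eta> y. weight J s (X (y, i) n))"
  proof (intro prod.cong refl)
    fix y i
    have "(\<Prod>x\<in>J. s x ^ of_bool (X (y, i) n = x)) = (\<Prod>x\<in>J. if X (y, i) n = x then s x else 1)"
      by (intro prod.cong) auto
    also have "\<dots> = weight J s (X (y, i) n)" using J by (simp add: weight_def)
    finally show "(\<Prod>x\<in>J. s x ^ of_bool (X (y, i) n = x)) = weight J s (X (y, i) n)" .
  qed
  also have "\<dots> = (\<Prod>(y, i)\<in>Sigma Y (\<lambda>y. {1..\<eta> y}). weight J s (X (y, i) n))"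
    using Y by (subst prod.Sigma) auto
  finally show ?thesis .
qed

text \<open>Fubini with the walks first: given the configuration, distinct particles contribute
  independent factors of mean \<open>1 - loss\<close>. Then the occupation numbers are independent
  over sites, and each yields its generating function at \<open>1 - loss\<close>.\<close>

lemma nn_integral_quenched_eta:
  assumes J: "finite J" and s: "\<And>x. 0 \<le> s x \<and> s x \<le> 1"
    and Y: "finite Y" "\<And>x. x \<in> J \<Longrightarrow> {x - int n..x + int n} \<subseteq> Y"
  shows "(\<integral>\<^sup>+\<sigma>. ennreal (\<Prod>x\<in>J. s x ^ eta n \<sigma> x) \<partial>quenched \<nu> \<omega>) =
    ennreal (\<Prod>y\<in>Y. \<integral>k. (1 - loss \<omega> n J s y) ^ k \<partial>measure_pmf (\<nu> (shift y \<omega>)))"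
proof -
  let ?W = "\<lambda>(x, i). walk_law \<omega> x" and ?I = "(UNIV :: int set) \<times> {1::nat..}"
  let ?N = "\<lambda>x. measure_pmf (\<nu> (shift x \<omega>))"
  interpret W: product_prob_space ?W ?I
    by (intro product_prob_spaceI) (auto simp: prob_space_walk_law)
  interpret N: product_prob_space ?N UNIV
    by (intro product_prob_spaceI) (simp add: prob_space_measure_pmf)
  have q: "0 \<le> loss \<omega> n J s y" "loss \<omega> n J s y \<le> 1" for y
    by (rule loss_bounds[OF J s])+
  let ?q = "\<lambda>y. ennreal (1 - loss \<omega> n J s y)"
  have F: "(\<lambda>\<sigma>. ennreal (\<Prod>x\<in>J. s x ^ eta n \<sigma> x)) \<in> borel_measurable (PiM UNIV ?N \<Otimes>\<^sub>M PiM ?I ?W)"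
    unfolding measurable_cong_sets[OF sets_quenched[of \<nu> \<omega>, unfolded quenched_def] refl]
    by (intro measurable_compose[OF _ measurable_ennreal] measurable_prod_power measurable_eta)
  have AE: "AE X in PiM ?I ?W. \<forall>y i. i \<ge> 1 \<longrightarrow> \<bar>X (y, i) n - y\<bar> \<le> int n"
    unfolding AE_all_countable
  proof (intro allI)
    fix y :: int and i :: nat
    show "AE X in PiM ?I ?W. i \<ge> 1 \<longrightarrow> \<bar>X (y, i) n - y\<bar> \<le> int n"
    proof (cases "i \<ge> 1")
      case True
      then have "AE X in PiM ?I ?W. \<bar>X (y, i) n - y\<bar> \<le> int n"
        by (intro AE_PiM_component[of ?I ?W "(y, i)" "\<lambda>p. \<bar>p n - y\<bar> \<le> int n"])
           (auto simp: prob_space_walk_law AE_walk_law_range)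
      then show ?thesis by eventually_elim simp
    qed simp
  qed
  have inner: "(\<integral>\<^sup>+X. ennreal (\<Prod>x\<in>J. s x ^ eta n (\<eta>, X) x) \<partial>PiM ?I ?W) = (\<Prod>y\<in>Y. ?q y ^ \<eta> y)" for \<eta>
  proof -
    let ?A = "Sigma Y (\<lambda>y. {1..\<eta> y})"
    have "(\<integral>\<^sup>+X. ennreal (\<Prod>x\<in>J. s x ^ eta n (\<eta>, X) x) \<partial>PiM ?I ?W) =
        (\<integral>\<^sup>+X. (\<Prod>j\<in>?A. ennreal (weight J s (X j n))) \<partial>PiM ?I ?W)"
    proof (rule nn_integral_cong_AE)
      show "AE X in PiM ?I ?W. ennreal (\<Prod>x\<in>J. s x ^ eta n (\<eta>, X) x) = (\<Prod>j\<in>?A. ennreal (weight J s (X j n)))"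
        using AE
      proof eventually_elim
        case (elim X)
        then have "(\<Prod>x\<in>J. s x ^ eta n (\<eta>, X) x) = (\<Prod>j\<in>?A. weight J s (X j n))"
          using prod_power_eta[OF _ J Y, of X s \<eta>] by (simp add: case_prod_unfold)
        then show ?case using weight_bounds[OF s] by (simp add: prod_ennreal)
      qed
    qed
    also have "\<dots> = (\<Prod>j\<in>?A. \<integral>\<^sup>+p. ennreal (weight J s (p n)) \<partial>?W j)"
    proof (rule W.nn_integral_PiM_prod)
      show "finite ?A" using Y(1) by auto
      fix j assume "j \<in> ?A"
      have "(\<lambda>p. p n) \<in> walk_law \<omega> (fst j) \<rightarrow>\<^sub>M count_space UNIV"
        unfolding measurable_cong_sets[OF sets_walk_law refl] by measurable
      then show "(\<lambda>p. ennreal (weight J s (p n))) \<in> borel_measurable (?W j)"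
        by (simp add: case_prod_unfold)
    qed auto
    also have "\<dots> = (\<Prod>j\<in>?A. ?q (fst j))"
      by (intro prod.cong) (auto simp: nn_integral_weight[OF J s])
    also have "\<dots> = (\<Prod>y\<in>Y. \<Prod>i=1..\<eta> y. ?q y)"
      using Y(1) by (subst prod.Sigma) (auto simp: case_prod_unfold)
    finally show ?thesis by simp
  qed
  have "(\<integral>\<^sup>+\<sigma>. ennreal (\<Prod>x\<in>J. s x ^ eta n \<sigma> x) \<partial>quenched \<nu> \<omega>) = (\<integral>\<^sup>+\<eta>. (\<Prod>y\<in>Y. ?q y ^ \<eta> y) \<partial>PiM UNIV ?N)"
    unfolding quenched_def W.P.nn_integral_fst[OF F, symmetric] inner ..
  also have "\<dots> = (\<Prod>y\<in>Y. \<integral>\<^sup>+k. ?q y ^ k \<partial>?N y)"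
    by (rule N.nn_integral_PiM_prod[OF Y(1)]) auto
  also have "\<dots> = (\<Prod>y\<in>Y. ennreal (\<integral>k. (1 - loss \<omega> n J s y) ^ k \<partial>?N y))"
  proof (intro prod.cong refl)
    fix y
    have "(\<integral>\<^sup>+k. ennreal ((1 - loss \<omega> n J s y) ^ k) \<partial>?N y) = ennreal (\<integral>k. (1 - loss \<omega> n J s y) ^ k \<partial>?N y)"
      using q(1,2)[of y] by (intro nn_integral_eq_integral measure_pmf.integrable_const_bound[of _ 1]) (auto simp: power_le_one)
    then show "(\<integral>\<^sup>+k. ?q y ^ k \<partial>?N y) = ennreal (\<integral>k. (1 - loss \<omega> n J s y) ^ k \<partial>?N y)"
      using q(2)[of y] by (simp add: ennreal_power)
  qed
  also have "\<dots> = ennreal (\<Prod>y\<in>Y. \<integral>k. (1 - loss \<omega> n J s y) ^ k \<partial>?N y)"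
    using q(2) by (intro prod_ennreal integral_nonneg_AE) auto
  finally show ?thesis .
qed

lemma nn_integral_quenched_eta0:
  fixes g :: "int \<Rightarrow> nat \<Rightarrow> ennreal"
  assumes J: "finite J"
  shows "(\<integral>\<^sup>+\<sigma>. (\<Prod>x\<in>J. g x (eta0 \<sigma> x)) \<partial>quenched \<nu> \<omega>) = (\<Prod>x\<in>J. \<integral>\<^sup>+k. g x k \<partial>measure_pmf (\<nu> (shift x \<omega>)))"
proof -
  let ?W = "\<lambda>(x, i). walk_law \<omega> x" and ?I = "(UNIV :: int set) \<times> {1::nat..}"
  let ?N = "\<lambda>x. measure_pmf (\<nu> (shift x \<omega>))"
  interpret W: product_prob_space ?W ?I
    by (intro product_prob_spaceI) (auto simp: prob_space_walk_law)
  interpret N: product_prob_space ?N UNIV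
    by (intro product_prob_spaceI) (simp add: prob_space_measure_pmf)
  have F: "(\<lambda>\<sigma>. \<Prod>x\<in>J. g x (eta0 \<sigma> x)) \<in> borel_measurable (PiM UNIV ?N \<Otimes>\<^sub>M PiM ?I ?W)"
  proof (intro borel_measurable_prod_ennreal)
    fix x
    have "(\<lambda>\<sigma>. eta0 \<sigma> x) \<in> (PiM UNIV ?N \<Otimes>\<^sub>M PiM ?I ?W) \<rightarrow>\<^sub>M ?N x"
      by (rule measurable_compose[OF measurable_fst measurable_component_singleton]) simp
    then show "(\<lambda>\<sigma>. g x (eta0 \<sigma> x)) \<in> borel_measurable (PiM UNIV ?N \<Otimes>\<^sub>M PiM ?I ?W)"
      by (rule measurable_compose) simp
  qed
  have "(\<integral>\<^sup>+\<sigma>. (\<Prod>x\<in>J. g x (eta0 \<sigma> x)) \<partial>quenched \<nu> \<omega>) = (\<integral>\<^sup>+\<eta>. (\<Prod>x\<in>J. g x (\<eta> x)) \<partial>PiM UNIV ?N)"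
    unfolding quenched_def W.P.nn_integral_fst[OF F, symmetric] by (simp only: nn_integral_const W.P.emeasure_space_1 mult_1_right fst_conv)
  also have "\<dots> = (\<Prod>x\<in>J. \<integral>\<^sup>+k. g x k \<partial>?N x)"
    by (rule N.nn_integral_PiM_prod[OF J]) auto
  finally show ?thesis .
qed

subsection \<open>Convergence of generating functions implies weak convergence\<close>

text \<open>Point probabilities are read off from the generating function near 0: after subtracting
  the terms of order below \<open>m\<close> and dividing by \<open>t ^ m\<close>, the power differs
  from the indicator of \<open>X z = m\<close> by at most \<open>t\<close>, uniformly in
  \<open>X\<close>. The subtracted terms converge by induction. \<open>G\<close> carries the other
  coordinates.\<close>

lemma power_moments_imp_indicator_moments:
  fixes M :: "nat \<Rightarrow> 'a measure" and X :: "'a \<Rightarrow> nat" and G :: "'a \<Rightarrow> real"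
  assumes M: "\<And>n. prob_space (M n)" "\<And>n. sets (M n) = sets M'" "prob_space M'"
    and X: "X \<in> M' \<rightarrow>\<^sub>M count_space UNIV" and G: "G \<in> borel_measurable M'" "\<And>z. \<bar>G z\<bar> \<le> 1"
    and conv: "\<And>t. 0 \<le> t \<Longrightarrow> t \<le> 1 \<Longrightarrow> (\<lambda>n. \<integral>z. t ^ X z * G z \<partial>M n) \<longlonglongrightarrow> (\<integral>z. t ^ X z * G z \<partial>M')"
  shows "(\<lambda>n. \<integral>z. of_bool (X z = m) * G z \<partial>M n) \<longlonglongrightarrow> (\<integral>z. of_bool (X z = m) * G z \<partial>M')"
proof (induction m rule: less_induct)
  case (less m)
  note [measurable] = X G(1)
  have int: "integrable L (\<lambda>z. \<phi> (X z) * G z)"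
    if "sets L = sets M'" "prob_space L" "\<And>k. \<bar>\<phi> k\<bar> \<le> B" for L and \<phi> :: "nat \<Rightarrow> real" and B
  proof -
    interpret L: prob_space L by fact
    have "(\<lambda>z. \<phi> (X z) * G z) \<in> borel_measurable L"
      unfolding measurable_cong_sets[OF that(1) refl] by measurable
    moreover have "\<bar>\<phi> (X z) * G z\<bar> \<le> B" for z
      using mult_mono[OF that(3)[of "X z"] G(2)[of z]] order_trans[OF abs_ge_zero that(3)[of 0]] by (simp add: abs_mult)
    ultimately show ?thesis by (intro L.integrable_const_bound[of _ B]) auto
  qed
  have approx: "\<bar>(\<integral>z. \<phi> (X z) * G z \<partial>L) - (\<integral>z. \<psi> (X z) * G z \<partial>L)\<bar> \<le> d"
    if L: "sets L = sets M'" "prob_space L" and B: "\<And>k. \<bar>\<phi> k\<bar> \<le> B" "\<And>k. \<bar>\<psi> k\<bar> \<le> B" and d: "\<And>k. \<bar>\<phi> k - \<psi> k\<bar> \<le> d"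
    for L and \<phi> \<psi> :: "nat \<Rightarrow> real" and B d
  proof -
    interpret L: prob_space L by fact
    have i: "integrable L (\<lambda>z. \<phi> (X z) * G z)" "integrable L (\<lambda>z. \<psi> (X z) * G z)"
      by (rule int[OF L B(1)], rule int[OF L B(2)])
    have "\<bar>(\<integral>z. \<phi> (X z) * G z \<partial>L) - (\<integral>z. \<psi> (X z) * G z \<partial>L)\<bar> = \<bar>\<integral>z. \<phi> (X z) * G z - \<psi> (X z) * G z \<partial>L\<bar>"
      using i by simp
    also have "\<dots> \<le> (\<integral>z. \<bar>\<phi> (X z) * G z - \<psi> (X z) * G z\<bar> \<partial>L)" by (rule integral_abs_bound)
    also have "\<dots> \<le> (\<integral>z. d \<partial>L)"
    proof (rule integral_mono)
      fix z
      have "\<bar>\<phi> (X z) * G z - \<psi> (X z) * G z\<bar> = \<bar>\<phi> (X z) - \<psi> (X z)\<bar> * \<bar>G z\<bar>"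
        by (simp add: left_diff_distrib[symmetric] abs_mult)
      also have "\<dots> \<le> d * 1"
        using d[of "X z"] G(2)[of z] order_trans[OF abs_ge_zero d[of 0]] by (intro mult_mono) auto
      finally show "\<bar>\<phi> (X z) * G z - \<psi> (X z) * G z\<bar> \<le> d" by simp
    qed (use i in auto)
    finally show ?thesis by (simp add: L.prob_space)
  qed
  show ?case
  proof (rule LIMSEQ_I)
    fix e :: real assume "e > 0"
    \<comment> \<open>The error \<open>t\<close> occurs once under \<open>M n\<close> and once under
      \<open>M'\<close>; with \<open>e / 2\<close> from the convergence of the
      \<open>r\<close>-integrals the total stays below \<open>e\<close>.\<close>
    define t where "t = min (1 / 2) (e / 4)"
    have t: "0 < t" "t \<le> 1" "t \<le> e / 4" using \<open>e > 0\<close> by (auto simp: t_def)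
    define r where "r k = (t ^ k - (\<Sum>i<m. t ^ i * of_bool (k = i))) / t ^ m" for k :: nat
    have r_eq: "r k = (if k < m then 0 else t ^ (k - m))" for k
    proof -
      have "(\<Sum>i<m. t ^ i * of_bool (k = i)) = (\<Sum>i<m. if i = k then t ^ k else 0)"
        by (intro sum.cong) auto
      then have "(\<Sum>i<m. t ^ i * of_bool (k = i)) = (if k < m then t ^ k else 0)" by simp
      then show ?thesis using t by (simp add: r_def power_diff)
    qed
    have r_le: "\<bar>r k\<bar> \<le> 1" for k using t by (simp add: r_eq power_le_one)
    have r_approx: "\<bar>of_bool (k = m) - r k\<bar> \<le> t" for k
    proof (cases "k \<le> m")
      case False
      then have "t ^ (k - m) \<le> t ^ 1" using t by (intro power_decreasing) auto
      then show ?thesis using False t by (simp add: r_eq)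
    qed (use t in \<open>auto simp: r_eq\<close>)
    have r_int: "(\<integral>z. r (X z) * G z \<partial>L) = ((\<integral>z. t ^ X z * G z \<partial>L) - (\<Sum>i<m. t ^ i * (\<integral>z. of_bool (X z = i) * G z \<partial>L))) / t ^ m"
      if L: "sets L = sets M'" "prob_space L" for L
    proof -
      have i1: "integrable L (\<lambda>z. t ^ X z * G z)" by (rule int[OF L, of _ 1]) (use t in \<open>simp add: power_le_one\<close>)
      have i2: "integrable L (\<lambda>z. of_bool (X z = i) * G z)" for i by (rule int[OF L, of _ 1]) simp
      have "(\<integral>z. r (X z) * G z \<partial>L) = (\<integral>z. (t ^ X z * G z - (\<Sum>i<m. t ^ i * (of_bool (X z = i) * G z))) / t ^ m \<partial>L)"
        by (intro Bochner_Integration.integral_cong) (simp_all only: r_def left_diff_distrib sum_distrib_right mult.assoc times_divide_eq_left)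
      also have "\<dots> = ((\<integral>z. t ^ X z * G z \<partial>L) - (\<integral>z. (\<Sum>i<m. t ^ i * (of_bool (X z = i) * G z)) \<partial>L)) / t ^ m"
        using i1 i2 by (subst integral_divide_zero, subst Bochner_Integration.integral_diff) auto
      also have "(\<integral>z. (\<Sum>i<m. t ^ i * (of_bool (X z = i) * G z)) \<partial>L) = (\<Sum>i<m. t ^ i * (\<integral>z. of_bool (X z = i) * G z \<partial>L))"
        using i2 by (subst Bochner_Integration.integral_sum) auto
      finally show ?thesis .
    qed
    have "(\<lambda>n. \<integral>z. r (X z) * G z \<partial>M n) \<longlonglongrightarrow> (\<integral>z. r (X z) * G z \<partial>M')"
      unfolding r_int[OF M(2,1)] r_int[OF refl M(3)]
      using t by (intro tendsto_intros conv less.IH) auto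
    from LIMSEQ_D[OF this, of "e / 2"] \<open>e > 0\<close> obtain n0 where
      n0: "\<And>n. n \<ge> n0 \<Longrightarrow> \<bar>(\<integral>z. r (X z) * G z \<partial>M n) - (\<integral>z. r (X z) * G z \<partial>M')\<bar> < e / 2" by auto
    have a: "\<bar>(\<integral>z. of_bool (X z = m) * G z \<partial>L) - (\<integral>z. r (X z) * G z \<partial>L)\<bar> \<le> t"
      if L: "sets L = sets M'" "prob_space L" for L
      by (rule approx[OF L, of "\<lambda>k. of_bool (k = m)" 1]) (use r_le r_approx in auto)
    have "\<bar>(\<integral>z. of_bool (X z = m) * G z \<partial>M n) - (\<integral>z. of_bool (X z = m) * G z \<partial>M')\<bar> < e" if "n \<ge> n0" for n
      using n0[OF that] a[OF M(2,1), of n] a[OF refl M(3)] t(3) by linarith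
    then show "\<exists>n0. \<forall>n\<ge>n0. norm ((\<integral>z. of_bool (X z = m) * G z \<partial>M n) - (\<integral>z. of_bool (X z = m) * G z \<partial>M')) < e"
      by auto
  qed
qed

text \<open>Coordinates are switched from powers to indicators one at a time; in \<open>h\<close>,
  the set \<open>A\<close> collects those already switched.\<close>

lemma generating_functions_imp_cylinders:
  fixes \<mu> :: "nat \<Rightarrow> config measure"
  assumes M: "\<And>n. prob_space (\<mu> n)" "\<And>n. sets (\<mu> n) = sets borel" "prob_space \<mu>'" "sets \<mu>' = sets borel"
    and J: "finite J"
    and conv: "\<And>s :: int \<Rightarrow> real. (\<And>x. 0 \<le> s x \<and> s x \<le> 1) \<Longrightarrow>
      (\<lambda>n. \<integral>\<eta>. (\<Prod>x\<in>J. s x ^ \<eta> x) \<partial>\<mu> n) \<longlonglongrightarrow> (\<integral>\<eta>. (\<Prod>x\<in>J. s x ^ \<eta> x) \<partial>\<mu>')"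
  shows "(\<lambda>n. \<integral>\<eta>. (\<Prod>x\<in>J. of_bool (\<eta> x = m x)) \<partial>\<mu> n) \<longlonglongrightarrow> (\<integral>\<eta>. (\<Prod>x\<in>J. of_bool (\<eta> x = m x)) \<partial>\<mu>' :: real)"
proof -
  define h where "h A s x k = (if x \<in> A then of_bool (k = m x) else s x ^ k :: real)" for A and s :: "int \<Rightarrow> real" and x k
  have h_bound: "0 \<le> h A s x k \<and> h A s x k \<le> 1" if "\<And>x. 0 \<le> s x \<and> s x \<le> 1" for A s x k
    using that by (auto simp: h_def power_le_one)
  have "(\<lambda>n. \<integral>\<eta>. (\<Prod>x\<in>J. h A s x (\<eta> x)) \<partial>\<mu> n) \<longlonglongrightarrow> (\<integral>\<eta>. (\<Prod>x\<in>J. h A s x (\<eta> x)) \<partial>\<mu>')"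
    if "finite A" "A \<subseteq> J" "\<And>x. 0 \<le> s x \<and> s x \<le> 1" for A s
    using that
  proof (induction A arbitrary: s rule: finite_induct)
    case empty
    then show ?case using conv[of s] by (simp add: h_def)
  next
    case (insert x0 A)
    have x0: "x0 \<in> J" using insert.prems by simp
    define G where "G \<eta> = (\<Prod>x\<in>J - {x0}. h A s x (\<eta> x))" for \<eta> :: config
    have split: "(\<Prod>x\<in>J. h A' s' x (\<eta> x)) = h A' s' x0 (\<eta> x0) * G \<eta>"
      if "\<And>x k. x \<noteq> x0 \<Longrightarrow> h A' s' x k = h A s x k" for A' s' and \<eta> :: config
    proof -
      have "(\<Prod>x\<in>J. h A' s' x (\<eta> x)) = h A' s' x0 (\<eta> x0) * (\<Prod>x\<in>J - {x0}. h A' s' x (\<eta> x))"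
        using x0 J by (rule prod.remove[rotated])
      also have "(\<Prod>x\<in>J - {x0}. h A' s' x (\<eta> x)) = G \<eta>"
        unfolding G_def by (intro prod.cong) (auto simp: that)
      finally show ?thesis .
    qed
    have "(\<lambda>n. \<integral>\<eta>. of_bool (\<eta> x0 = m x0) * G \<eta> \<partial>\<mu> n) \<longlonglongrightarrow> (\<integral>\<eta>. of_bool (\<eta> x0 = m x0) * G \<eta> \<partial>\<mu>')"
    proof (rule power_moments_imp_indicator_moments[where M=\<mu> and M'=\<mu>' and X="\<lambda>\<eta>. \<eta> x0" and m="m x0"])
      show "(\<lambda>\<eta>. \<eta> x0) \<in> \<mu>' \<rightarrow>\<^sub>M count_space UNIV"
        using measurable_config_coordinate by (simp add: measurable_cong_sets[OF M(4) refl])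
      show "G \<in> borel_measurable \<mu>'"
        unfolding G_def measurable_cong_sets[OF M(4) refl]
        by (intro borel_measurable_prod measurable_compose[OF measurable_config_coordinate]) simp
      show "\<bar>G \<eta>\<bar> \<le> 1" for \<eta>
        unfolding G_def abs_prod using h_bound[OF insert.prems(2)] by (intro prod_le_1) auto
      fix t :: real assume t: "0 \<le> t" "t \<le> 1"
      \<comment> \<open>\<open>s\<close> is arbitrary in the induction, so the parameter at
        \<open>x0\<close> may run through all \<open>t\<close> while the others stay fixed.\<close>
      define s' where "s' = s(x0 := t)"
      have eq: "(\<Prod>x\<in>J. h A s' x (\<eta> x)) = t ^ \<eta> x0 * G \<eta>" for \<eta> :: config
        using insert.hyps by (subst split) (auto simp: h_def s'_def)
      have "(\<lambda>n. \<integral>\<eta>. (\<Prod>x\<in>J. h A s' x (\<eta> x)) \<partial>\<mu> n) \<longlonglongrightarrow> (\<integral>\<eta>. (\<Prod>x\<in>J. h A s' x (\<eta> x)) \<partial>\<mu>')"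
        using insert.prems t by (intro insert.IH) (auto simp: s'_def)
      then show "(\<lambda>n. \<integral>\<eta>. t ^ \<eta> x0 * G \<eta> \<partial>\<mu> n) \<longlonglongrightarrow> (\<integral>\<eta>. t ^ \<eta> x0 * G \<eta> \<partial>\<mu>')" unfolding eq .
    qed (use M in simp_all)
    moreover have "(\<Prod>x\<in>J. h (insert x0 A) s x (\<eta> x)) = of_bool (\<eta> x0 = m x0) * G \<eta>" for \<eta> :: config
      by (subst split) (auto simp: h_def)
    ultimately show ?case by simp
  qed
  from this[OF J subset_refl, of "\<lambda>_. 0"]
  have "(\<lambda>n. \<integral>\<eta>. (\<Prod>x\<in>J. h J (\<lambda>_. 0) x (\<eta> x)) \<partial>\<mu> n) \<longlonglongrightarrow> (\<integral>\<eta>. (\<Prod>x\<in>J. h J (\<lambda>_. 0) x (\<eta> x)) \<partial>\<mu>')" by simp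
  moreover have "(\<Prod>x\<in>J. h J (\<lambda>_. 0) x (\<eta> x)) = (\<Prod>x\<in>J. of_bool (\<eta> x = m x))" for \<eta> :: config
    by (intro prod.cong) (auto simp: h_def)
  ultimately show ?thesis by simp
qed

lemma open_config_contains_cylinder:
  fixes \<eta> :: config
  assumes "open U" "\<eta> \<in> U"
  shows "\<exists>m::nat. \<forall>\<zeta>. (\<forall>x\<in>{- int m..int m}. \<zeta> x = \<eta> x) \<longrightarrow> \<zeta> \<in> U"
proof -
  have "openin (product_topology (\<lambda>i::int. euclidean :: nat topology) UNIV) U"
    using assms(1) by (simp add: open_fun_def)
  from product_topology_open_contains_basis[OF this assms(2)] obtain X where
    X: "\<eta> \<in> (\<Pi>\<^sub>E i\<in>UNIV. X i)" "finite {i. X i \<noteq> topspace (euclidean :: nat topology)}" "(\<Pi>\<^sub>E i\<in>UNIV. X i) \<subseteq> U" by blast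
  have fin: "finite {i. X i \<noteq> UNIV}" using X(2) by simp
  \<comment> \<open>The sum dominates each summand, so the window contains every restricted
    coordinate.\<close>
  define m where "m = (\<Sum>i | X i \<noteq> UNIV. nat \<bar>i\<bar>)"
  have "i \<in> {- int m..int m}" if "X i \<noteq> UNIV" for i
  proof -
    have "nat \<bar>i\<bar> \<le> m" unfolding m_def by (rule member_le_sum) (use that fin in auto)
    then show ?thesis by auto
  qed
  note in_W = this
  have "\<zeta> \<in> U" if \<zeta>: "\<forall>x\<in>{- int m..int m}. \<zeta> x = \<eta> x" for \<zeta>
  proof -
    have "\<zeta> i \<in> X i" for i
    proof (cases "X i = UNIV")
      case False
      with in_W \<zeta> have "\<zeta> i = \<eta> i" by blast
      moreover have "\<eta> i \<in> X i" using X(1) by (simp add: PiE_iff)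
      ultimately show ?thesis by simp
    qed simp
    then have "\<zeta> \<in> (\<Pi>\<^sub>E i\<in>UNIV. X i)" by (simp add: PiE_iff)
    then show ?thesis using X(3) by (rule subsetD[rotated])
  qed
  then show ?thesis by blast
qed

text \<open>A nonnegative continuous function is an increasing limit of functions of finitely many
  coordinates: take the infimum over cylinders (\<open>low m\<close>), then cut off large occupation numbers.\<close>
lemma cylinders_imp_integral_lower:
  fixes \<mu> :: "nat \<Rightarrow> config measure" and F :: "config \<Rightarrow> real"
  assumes M: "\<And>n. prob_space (\<mu> n)" "\<And>n. sets (\<mu> n) = sets borel" "prob_space \<mu>'" "sets \<mu>' = sets borel"
    and cyl: "\<And>J m. finite J \<Longrightarrow>
      (\<lambda>n. \<integral>\<eta>. (\<Prod>x\<in>J. of_bool (\<eta> x = m x)) \<partial>\<mu> n) \<longlonglongrightarrow> (\<integral>\<eta>. (\<Prod>x\<in>J. of_bool (\<eta> x = m x)) \<partial>\<mu>' :: real)"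
    and F: "continuous_on UNIV F" "\<And>\<eta>. 0 \<le> F \<eta>" "\<And>\<eta>. F \<eta> \<le> B" and "e > 0"
  shows "\<forall>\<^sub>F n in sequentially. (\<integral>\<eta>. F \<eta> \<partial>\<mu>') - e < (\<integral>\<eta>. F \<eta> \<partial>\<mu> n)"
proof -
  interpret \<mu>': prob_space \<mu>' by fact
  define W where "W m = {- int m..int m}" for m :: nat
  have fW: "finite (W m)" for m by (simp add: W_def)
  define low where "low m \<eta> = Inf (F ` {\<zeta>. \<forall>x\<in>W m. \<zeta> x = \<eta> x})" for m and \<eta> :: config
  \<comment> \<open>Bounded occupation numbers on the window leave finitely many patterns, so
    \<open>cut m L\<close> is a finite combination of cylinder indicators, whose integrals converge
    by \<open>cyl\<close>.\<close>
  define cut where "cut m L \<eta> = (if \<forall>x\<in>W m. \<eta> x \<le> L then low m \<eta> else 0)" for m L and \<eta> :: config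
  have bdd: "bdd_below (F ` A)" for A by (rule bdd_belowI[of _ 0]) (use F in auto)
  have low_le: "low m \<eta> \<le> F \<eta>" for m \<eta> unfolding low_def by (rule cInf_lower[OF _ bdd]) auto
  have low_nonneg: "0 \<le> low m \<eta>" for m \<eta> unfolding low_def by (rule cInf_greatest) (use F in auto)
  have low_cong: "low m \<eta> = low m \<zeta>" if "\<And>x. x \<in> W m \<Longrightarrow> \<eta> x = \<zeta> x" for m \<eta> \<zeta>
    unfolding low_def using that by (intro arg_cong[where f=Inf] arg_cong[where f="(`) F"]) auto
  have low_lim: "(\<lambda>m. low m \<eta>) \<longlonglongrightarrow> F \<eta>" for \<eta>
  proof (rule LIMSEQ_I)
    fix r :: real assume "r > 0"
    have "open (F -` {F \<eta> - r / 2<..})" by (rule open_vimage[OF open_greaterThan F(1)])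
    from open_config_contains_cylinder[OF this, of \<eta>] \<open>r > 0\<close> obtain m0 :: nat where
      m0: "\<And>\<zeta>. (\<forall>x\<in>{- int m0..int m0}. \<zeta> x = \<eta> x) \<Longrightarrow> F \<eta> - r / 2 < F \<zeta>" by auto
    have "F \<eta> - r / 2 \<le> low m \<eta>" if "m \<ge> m0" for m
      unfolding low_def
    proof (rule cInf_greatest)
      fix z assume "z \<in> F ` {\<zeta>. \<forall>x\<in>W m. \<zeta> x = \<eta> x}"
      then show "F \<eta> - r / 2 \<le> z" using that by (auto simp: W_def intro!: less_imp_le m0)
    qed auto
    then have "norm (low m \<eta> - F \<eta>) < r" if "m \<ge> m0" for m
      using that low_le[of m \<eta>] \<open>r > 0\<close> by (fastforce simp: abs_if)
    then show "\<exists>no. \<forall>m\<ge>no. norm (low m \<eta> - F \<eta>) < r" by blast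
  qed
  have cut_le: "cut m L \<eta> \<le> low m \<eta>" "0 \<le> cut m L \<eta>" for m L \<eta> using low_nonneg by (auto simp: cut_def)
  have cut_lim: "(\<lambda>L. cut m L \<eta>) \<longlonglongrightarrow> low m \<eta>" for m \<eta>
  proof (rule tendsto_eventually, rule eventually_sequentiallyI)
    fix L assume L: "Max (\<eta> ` W m) \<le> L"
    have "\<eta> x \<le> L" if "x \<in> W m" for x
      using L that fW by (meson Max_ge finite_imageI image_eqI order_trans)
    then show "cut m L \<eta> = low m \<eta>" by (simp add: cut_def)
  qed
  define K where "K m L = PiE (W m) (\<lambda>_. {..L})" for m and L :: nat
  have fK: "finite (K m L)" for m L unfolding K_def by (intro finite_PiE fW) auto
  have cut_eq: "cut m L \<eta> = (\<Sum>k\<in>K m L. low m k * (\<Prod>x\<in>W m. of_bool (\<eta> x = k x)))" for m L \<eta>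
  proof -
    have p: "(\<Prod>x\<in>W m. of_bool (\<eta> x = k x) :: real) = of_bool (\<forall>x\<in>W m. \<eta> x = k x)" for k
      using fW[of m] by (induction rule: finite_induct) auto
    have "(\<Sum>k\<in>K m L. low m k * (\<Prod>x\<in>W m. of_bool (\<eta> x = k x))) = (\<Sum>k\<in>K m L. if k = restrict \<eta> (W m) then low m \<eta> else 0)"
    proof (rule sum.cong)
      fix k assume k: "k \<in> K m L"
      have "(\<forall>x\<in>W m. \<eta> x = k x) \<longleftrightarrow> k = restrict \<eta> (W m)"
        using k by (auto simp: K_def PiE_iff extensional_def fun_eq_iff)
      moreover have "low m (restrict \<eta> (W m)) = low m \<eta>" by (rule low_cong) simp
      ultimately show "low m k * (\<Prod>x\<in>W m. of_bool (\<eta> x = k x)) = (if k = restrict \<eta> (W m) then low m \<eta> else 0)"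
        unfolding p by auto
    qed simp
    also have "\<dots> = (if restrict \<eta> (W m) \<in> K m L then low m \<eta> else 0)"
      using fK by simp
    also have "\<dots> = cut m L \<eta>" by (auto simp: cut_def K_def PiE_iff)
    finally show ?thesis by simp
  qed
  have ind_meas: "(\<lambda>\<eta>. \<Prod>x\<in>J. of_bool (\<eta> x = k x) :: real) \<in> borel_measurable borel" for J and k :: config
    by (intro borel_measurable_prod measurable_compose[OF measurable_config_coordinate]) simp
  have cut_meas: "cut m L \<in> borel_measurable borel" for m L
    unfolding cut_eq[abs_def] by (intro borel_measurable_sum borel_measurable_times borel_measurable_const ind_meas)
  have low_meas: "low m \<in> borel_measurable borel" for m
    by (rule borel_measurable_LIMSEQ_real[OF cut_lim cut_meas])
  have F_meas: "F \<in> borel_measurable borel" by (rule borel_measurable_continuous_onI[OF F(1)])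
  have meas: "g \<in> borel_measurable \<mu>'" "g \<in> borel_measurable (\<mu> n)" if "g \<in> borel_measurable borel" for g :: "config \<Rightarrow> real" and n
    using that by (simp_all add: measurable_cong_sets[OF M(4) refl] measurable_cong_sets[OF M(2) refl])
  \<comment> \<open>\<open>m\<close> and \<open>L\<close> are chosen from the limit law alone, with
    losses \<open>e / 2\<close> and \<open>e / 4\<close>; the last \<open>e / 4\<close> pays for the
    passage to \<open>\<mu> n\<close>. Under \<open>\<mu> n\<close> only the inequality
    \<open>cut m L \<eta> \<le> F \<eta>\<close> enters.\<close>
  have "(\<lambda>m. \<integral>\<eta>. low m \<eta> \<partial>\<mu>') \<longlonglongrightarrow> (\<integral>\<eta>. F \<eta> \<partial>\<mu>')"
    by (rule integral_dominated_convergence[of _ _ _ "\<lambda>_. B"])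
       (use low_lim low_nonneg low_le F(3) order_trans[OF low_le F(3)] in \<open>auto intro!: meas F_meas low_meas AE_I2\<close>)
  from order_tendstoD(1)[OF this, of "(\<integral>\<eta>. F \<eta> \<partial>\<mu>') - e / 2"] \<open>e > 0\<close> obtain m where
    m: "(\<integral>\<eta>. F \<eta> \<partial>\<mu>') - e / 2 < (\<integral>\<eta>. low m \<eta> \<partial>\<mu>')" by (auto dest: eventually_happens)
  have "(\<lambda>L. \<integral>\<eta>. cut m L \<eta> \<partial>\<mu>') \<longlonglongrightarrow> (\<integral>\<eta>. low m \<eta> \<partial>\<mu>')"
    by (rule integral_dominated_convergence[of _ _ _ "\<lambda>_. B"])
       (use cut_lim cut_le order_trans[OF cut_le(1) order_trans[OF low_le F(3)]] in \<open>auto intro!: meas cut_meas low_meas AE_I2\<close>)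
  from order_tendstoD(1)[OF this, of "(\<integral>\<eta>. low m \<eta> \<partial>\<mu>') - e / 4"] \<open>e > 0\<close> obtain L where
    L: "(\<integral>\<eta>. low m \<eta> \<partial>\<mu>') - e / 4 < (\<integral>\<eta>. cut m L \<eta> \<partial>\<mu>')" by (auto dest: eventually_happens)
  have ind_int: "integrable N (\<lambda>\<eta>. \<Prod>x\<in>J. of_bool (\<eta> x = k x) :: real)"
    if "prob_space N" "sets N = sets borel" for N :: "config measure" and J k
  proof -
    interpret N: prob_space N by fact
    have "(\<lambda>\<eta>. \<Prod>x\<in>J. of_bool (\<eta> x = k x) :: real) \<in> borel_measurable N"
      using ind_meas by (simp add: measurable_cong_sets[OF that(2) refl])
    moreover have "\<bar>\<Prod>x\<in>J. of_bool (\<eta> x = k x) :: real\<bar> \<le> 1" for \<eta>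
      unfolding abs_prod by (intro prod_le_1) auto
    ultimately show ?thesis by (intro N.integrable_const_bound[of _ 1]) auto
  qed
  have cut_int: "(\<integral>\<eta>. cut m L \<eta> \<partial>N) = (\<Sum>k\<in>K m L. low m k * (\<integral>\<eta>. (\<Prod>x\<in>W m. of_bool (\<eta> x = k x)) \<partial>N))"
    if "prob_space N" "sets N = sets borel" for N :: "config measure"
    unfolding cut_eq using ind_int[OF that] by simp
  have "(\<lambda>n. \<integral>\<eta>. cut m L \<eta> \<partial>\<mu> n) \<longlonglongrightarrow> (\<integral>\<eta>. cut m L \<eta> \<partial>\<mu>')"
    unfolding cut_int[OF M(1,2)] cut_int[OF M(3,4)] by (intro tendsto_intros cyl fW)
  from order_tendstoD(1)[OF this, of "(\<integral>\<eta>. cut m L \<eta> \<partial>\<mu>') - e / 4"] \<open>e > 0\<close>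
  have "\<forall>\<^sub>F n in sequentially. (\<integral>\<eta>. cut m L \<eta> \<partial>\<mu>') - e / 4 < (\<integral>\<eta>. cut m L \<eta> \<partial>\<mu> n)" by simp
  then show ?thesis
  proof eventually_elim
    case (elim n)
    interpret \<mu>: prob_space "\<mu> n" by fact
    have "(\<integral>\<eta>. cut m L \<eta> \<partial>\<mu> n) \<le> (\<integral>\<eta>. F \<eta> \<partial>\<mu> n)"
    proof (rule integral_mono)
      show "integrable (\<mu> n) (cut m L)"
        by (rule \<mu>.integrable_const_bound[of _ B])
           (use cut_le order_trans[OF cut_le(1) order_trans[OF low_le F(3)]] in \<open>auto intro!: meas cut_meas AE_I2\<close>)
      show "integrable (\<mu> n) F"
        by (rule \<mu>.integrable_const_bound[of _ B]) (use F in \<open>auto intro!: meas F_meas AE_I2\<close>)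
      show "cut m L \<eta> \<le> F \<eta>" for \<eta> by (rule order_trans[OF cut_le(1) low_le])
    qed
    then show ?case using elim m L by linarith
  qed
qed

text \<open>The lower bound applied to the nonnegative functions \<open>F + B\<close> and
  \<open>B - F\<close> gives the two halves of the limit; as all measures have mass 1, the constants
  cancel.\<close>

theorem weakly_converges_generating_functions:
  fixes \<mu> :: "nat \<Rightarrow> config measure"
  assumes M: "\<And>n. prob_space (\<mu> n)" "\<And>n. sets (\<mu> n) = sets borel" "prob_space \<mu>'" "sets \<mu>' = sets borel"
    and conv: "\<And>J s. finite J \<Longrightarrow> (\<And>x. 0 \<le> s x \<and> s x \<le> 1) \<Longrightarrow>
      (\<lambda>n. \<integral>\<eta>. (\<Prod>x\<in>J. s x ^ \<eta> x) \<partial>\<mu> n) \<longlonglongrightarrow> (\<integral>\<eta>. (\<Prod>x\<in>J. s x ^ \<eta> x) \<partial>\<mu>' :: real)"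
  shows "weakly_converges \<mu> \<mu>'"
  unfolding weakly_converges_def
proof (intro conjI allI impI; (elim conjE)?)
  fix F :: "config \<Rightarrow> real"
  assume F: "continuous_on UNIV F" "bounded (range F)"
  then obtain B where B: "\<And>\<eta>. \<bar>F \<eta>\<bar> \<le> B" by (auto simp: bounded_iff)
  note cyl = generating_functions_imp_cylinders[OF M _ conv]
  have int: "integrable N F" if "prob_space N" "sets N = sets borel" for N :: "config measure"
  proof -
    interpret N: prob_space N by fact
    have "F \<in> borel_measurable N"
      using borel_measurable_continuous_onI[OF F(1)] by (simp add: measurable_cong_sets[OF that(2) refl])
    then show ?thesis using B by (intro N.integrable_const_bound[of _ B]) auto
  qed
  have plus: "(\<integral>\<eta>. F \<eta> + B \<partial>N) = (\<integral>\<eta>. F \<eta> \<partial>N) + B" and minus: "(\<integral>\<eta>. B - F \<eta> \<partial>N) = B - (\<integral>\<eta>. F \<eta> \<partial>N)"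
    if "prob_space N" "sets N = sets borel" for N :: "config measure"
  proof -
    interpret N: prob_space N by fact
    show "(\<integral>\<eta>. F \<eta> + B \<partial>N) = (\<integral>\<eta>. F \<eta> \<partial>N) + B" using int[OF that] by (simp add: N.prob_space)
    show "(\<integral>\<eta>. B - F \<eta> \<partial>N) = B - (\<integral>\<eta>. F \<eta> \<partial>N)" using int[OF that] by (simp add: N.prob_space)
  qed
  show "(\<lambda>n. \<integral>\<eta>. F \<eta> \<partial>\<mu> n) \<longlonglongrightarrow> (\<integral>\<eta>. F \<eta> \<partial>\<mu>')"
  proof (rule LIMSEQ_I)
    fix e :: real assume "e > 0"
    have "\<forall>\<^sub>F n in sequentially. (\<integral>\<eta>. F \<eta> + B \<partial>\<mu>') - e < (\<integral>\<eta>. F \<eta> + B \<partial>\<mu> n)"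
    proof (rule cylinders_imp_integral_lower[OF M cyl, where B="2 * B"])
      show "0 \<le> F \<eta> + B" "F \<eta> + B \<le> 2 * B" for \<eta> using B[of \<eta>] by linarith+
    qed (use F \<open>e > 0\<close> in \<open>auto intro!: continuous_intros\<close>)
    moreover have "\<forall>\<^sub>F n in sequentially. (\<integral>\<eta>. B - F \<eta> \<partial>\<mu>') - e < (\<integral>\<eta>. B - F \<eta> \<partial>\<mu> n)"
    proof (rule cylinders_imp_integral_lower[OF M cyl, where B="2 * B"])
      show "0 \<le> B - F \<eta>" "B - F \<eta> \<le> 2 * B" for \<eta> using B[of \<eta>] by linarith+
    qed (use F \<open>e > 0\<close> in \<open>auto intro!: continuous_intros\<close>)
    ultimately have "\<forall>\<^sub>F n in sequentially. norm ((\<integral>\<eta>. F \<eta> \<partial>\<mu> n) - (\<integral>\<eta>. F \<eta> \<partial>\<mu>')) < e"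
      by eventually_elim (simp add: plus[OF M(1,2)] plus[OF M(3,4)] minus[OF M(1,2)] minus[OF M(3,4)] abs_if)
    then show "\<exists>no. \<forall>n\<ge>no. norm ((\<integral>\<eta>. F \<eta> \<partial>\<mu> n) - (\<integral>\<eta>. F \<eta> \<partial>\<mu>')) < e"
      by (simp add: eventually_sequentially)
  qed
qed (use M in auto)

subsection \<open>Poisson approximation\<close>

definition pmf_mean :: "nat pmf \<Rightarrow> real" where
  "pmf_mean p = measure_pmf.expectation p real"

text \<open>A truncated second moment. A second moment may be infinite here, whereas
  \<open>u * min 1 (u * \<delta>)\<close> is dominated by \<open>u\<close> and tends to 0 with
  \<open>\<delta>\<close>, so a finite mean allows dominated convergence.\<close>

definition pgf_err :: "real \<Rightarrow> nat pmf \<Rightarrow> real" where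
  "pgf_err \<delta> p = measure_pmf.expectation p (\<lambda>k. real k * min 1 (real k * \<delta>)) + pmf_mean p * min 1 (pmf_mean p * \<delta>)"

lemma pmf_mean_nonneg: "0 \<le> pmf_mean p"
  unfolding pmf_mean_def by (intro integral_nonneg_AE) auto

text \<open>The error is quadratic for small \<open>u\<close> but only linear for large
  \<open>u\<close>, which keeps it integrable when just the first moment is finite.\<close>

lemma exp_minus_bounds:
  fixes u :: real
  assumes "0 \<le> u"
  shows "1 - u \<le> exp (- u)" "exp (- u) \<le> 1 - u + u * min 1 u"
proof -
  show "1 - u \<le> exp (- u)" using exp_ge_add_one_self[of "- u"] by simp
  show "exp (- u) \<le> 1 - u + u * min 1 u"
  proof (cases "u \<le> 1")
    case True
    have "exp (- u) = 1 / exp u" by (simp only: exp_minus inverse_eq_divide)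
    also have "\<dots> \<le> 1 / (1 + u)" using assms by (intro divide_left_mono exp_ge_add_one_self) auto
    also have "\<dots> \<le> 1 - u + u * u"
    proof -
      have "(1 - u + u * u) * (1 + u) = 1 + u * u * u" by (simp add: algebra_simps)
      moreover have "0 \<le> u * u * u" using assms by simp
      ultimately have "1 \<le> (1 - u + u * u) * (1 + u)" by linarith
      then show ?thesis using assms by (simp add: divide_le_eq)
    qed
    finally show ?thesis using True by (simp add: min_def)
  next
    case False
    then show ?thesis using assms by (simp add: min_def)
  qed
qed

lemma power_bounds:
  fixes \<epsilon> :: real
  assumes "0 \<le> \<epsilon>" "\<epsilon> \<le> 1"
  shows "1 - real k * \<epsilon> \<le> (1 - \<epsilon>) ^ k" "(1 - \<epsilon>) ^ k \<le> 1 - real k * \<epsilon> + real k * \<epsilon> * min 1 (real k * \<epsilon>)"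
proof -
  show "1 - real k * \<epsilon> \<le> (1 - \<epsilon>) ^ k" using Bernoulli_inequality[of "- \<epsilon>" k] assms by simp
  have "(1 - \<epsilon>) ^ k \<le> exp (- \<epsilon>) ^ k"
  proof (rule power_mono)
    show "1 - \<epsilon> \<le> exp (- \<epsilon>)" using exp_ge_add_one_self[of "- \<epsilon>"] by linarith
  qed (use assms in simp)
  also have "exp (- \<epsilon>) ^ k = exp (real k * (- \<epsilon>))" by (rule exp_of_nat_mult[symmetric])
  also have "\<dots> = exp (- (real k * \<epsilon>))" by simp
  also have "\<dots> \<le> 1 - real k * \<epsilon> + real k * \<epsilon> * min 1 (real k * \<epsilon>)"
    using assms by (intro exp_minus_bounds) simp
  finally show "(1 - \<epsilon>) ^ k \<le> 1 - real k * \<epsilon> + real k * \<epsilon> * min 1 (real k * \<epsilon>)" .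
qed

lemma mult_min_bounds:
  fixes u :: real
  assumes "0 \<le> u" "0 \<le> \<delta>"
  shows "0 \<le> u * min 1 (u * \<delta>)" "u * min 1 (u * \<delta>) \<le> u"
proof -
  show "0 \<le> u * min 1 (u * \<delta>)" using assms by (intro mult_nonneg_nonneg) simp_all
  show "u * min 1 (u * \<delta>) \<le> u" using assms by (intro mult_left_le) simp_all
qed

lemma integrable_mult_min:
  assumes "integrable (measure_pmf p) real" "0 \<le> \<delta>"
  shows "integrable (measure_pmf p) (\<lambda>k. real k * min 1 (real k * \<delta>))"
proof (rule Bochner_Integration.integrable_bound[OF assms(1)])
  show "AE k in measure_pmf p. norm (real k * min 1 (real k * \<delta>)) \<le> norm (real k)"
    unfolding real_norm_def abs_of_nat abs_of_nonneg[OF mult_min_bounds(1)[OF of_nat_0_le_iff assms(2)]]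
    by (intro AE_I2 mult_min_bounds(2)[OF of_nat_0_le_iff assms(2)])
qed simp

text \<open>Both quantities lie above the tangent \<open>1 - pmf_mean p * \<epsilon>\<close>, by
  Bernoulli's inequality and by convexity, and exceed it by at most \<open>\<epsilon>\<close> times
  one summand of \<open>pgf_err\<close> each.\<close>

lemma pgf_exp_bound:
  assumes p: "integrable (measure_pmf p) real" and \<epsilon>: "0 \<le> \<epsilon>" "\<epsilon> \<le> 1" "\<epsilon> \<le> \<delta>"
  shows "\<bar>measure_pmf.expectation p (\<lambda>k. (1 - \<epsilon>) ^ k) - exp (- (pmf_mean p * \<epsilon>))\<bar> \<le> \<epsilon> * pgf_err \<delta> p"
proof -
  have \<delta>: "0 \<le> \<delta>" using \<epsilon> by linarith
  \<comment> \<open>Only the \<open>\<epsilon>\<close> inside the minimum is replaced by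
    \<open>\<delta>\<close>: the remaining linear factor later becomes the weight
    \<open>loss\<close> when errors are summed over starting sites.\<close>
  have mono: "u * \<epsilon> * min 1 (u * \<epsilon>) \<le> \<epsilon> * (u * min 1 (u * \<delta>))" if "0 \<le> u" for u :: real
  proof -
    have "min 1 (u * \<epsilon>) \<le> min 1 (u * \<delta>)"
      by (intro min.mono order_refl mult_left_mono \<epsilon>(3) that)
    then have "u * \<epsilon> * min 1 (u * \<epsilon>) \<le> u * \<epsilon> * min 1 (u * \<delta>)"
      by (rule mult_left_mono) (intro mult_nonneg_nonneg that \<epsilon>(1))
    then show ?thesis by (simp only: mult_ac)
  qed
  define h where "h u = u * min 1 (u * \<delta>)" for u
  have h_nonneg: "0 \<le> h u" if "0 \<le> u" for u
    unfolding h_def by (rule mult_min_bounds(1)[OF that \<delta>])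
  have i: "integrable (measure_pmf p) (\<lambda>k. h (real k))"
    unfolding h_def by (rule integrable_mult_min[OF p \<delta>])
  have err: "pgf_err \<delta> p = measure_pmf.expectation p (\<lambda>k. h (real k)) + h (pmf_mean p)"
    unfolding pgf_err_def h_def ..
  have upper: "u * \<epsilon> * min 1 (u * \<epsilon>) \<le> \<epsilon> * h u" if "0 \<le> u" for u
    unfolding h_def by (rule mono[OF that])
  have ip: "integrable (measure_pmf p) (\<lambda>k. (1 - \<epsilon>) ^ k)"
    by (rule measure_pmf.integrable_const_bound[of _ 1]) (use \<epsilon> in \<open>auto simp: power_le_one\<close>)
  have il: "integrable (measure_pmf p) (\<lambda>k. 1 - real k * \<epsilon>)" using p by simp
  have lin: "measure_pmf.expectation p (\<lambda>k. 1 - real k * \<epsilon>) = 1 - pmf_mean p * \<epsilon>"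
    using p by (simp add: pmf_mean_def)
  have 1: "1 - pmf_mean p * \<epsilon> \<le> measure_pmf.expectation p (\<lambda>k. (1 - \<epsilon>) ^ k)"
    unfolding lin[symmetric] by (intro integral_mono il ip power_bounds(1) \<epsilon>)
  have "measure_pmf.expectation p (\<lambda>k. (1 - \<epsilon>) ^ k) \<le>
      measure_pmf.expectation p (\<lambda>k. 1 - real k * \<epsilon> + \<epsilon> * h (real k))"
  proof (rule integral_mono)
    show "(1 - \<epsilon>) ^ k \<le> 1 - real k * \<epsilon> + \<epsilon> * h (real k)" for k
      using power_bounds(2)[OF \<epsilon>(1,2), of k] upper[OF of_nat_0_le_iff, of k] by linarith
  qed (use ip il i in auto)
  also have "\<dots> = 1 - pmf_mean p * \<epsilon> + \<epsilon> * measure_pmf.expectation p (\<lambda>k. h (real k))"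
    using il i lin by simp
  finally have 2: "measure_pmf.expectation p (\<lambda>k. (1 - \<epsilon>) ^ k) \<le>
      1 - pmf_mean p * \<epsilon> + \<epsilon> * measure_pmf.expectation p (\<lambda>k. h (real k))" .
  have 3: "1 - pmf_mean p * \<epsilon> \<le> exp (- (pmf_mean p * \<epsilon>))"
    by (intro exp_minus_bounds(1) mult_nonneg_nonneg pmf_mean_nonneg \<epsilon>(1))
  have 4: "exp (- (pmf_mean p * \<epsilon>)) \<le> 1 - pmf_mean p * \<epsilon> + \<epsilon> * h (pmf_mean p)"
    using exp_minus_bounds(2)[OF mult_nonneg_nonneg[OF pmf_mean_nonneg[of p] \<epsilon>(1)]] upper[OF pmf_mean_nonneg, of p] by linarith
  have 5: "0 \<le> \<epsilon> * measure_pmf.expectation p (\<lambda>k. h (real k))"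
    by (intro mult_nonneg_nonneg[OF \<epsilon>(1)] integral_nonneg_AE AE_I2 h_nonneg of_nat_0_le_iff)
  have 6: "0 \<le> \<epsilon> * h (pmf_mean p)"
    by (intro mult_nonneg_nonneg[OF \<epsilon>(1)] h_nonneg pmf_mean_nonneg)
  show ?thesis
    unfolding err distrib_left abs_le_iff using 1 2 3 4 5 6 by linarith
qed

lemma pgf_err_nonneg: "0 \<le> \<delta> \<Longrightarrow> 0 \<le> pgf_err \<delta> p"
  unfolding pgf_err_def
  by (intro add_nonneg_nonneg integral_nonneg_AE AE_I2 mult_min_bounds(1) pmf_mean_nonneg of_nat_0_le_iff)

lemma pgf_err_le:
  assumes p: "integrable (measure_pmf p) real" and "0 \<le> \<delta>"
  shows "pgf_err \<delta> p \<le> 2 * pmf_mean p"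
proof -
  have "measure_pmf.expectation p (\<lambda>k. real k * min 1 (real k * \<delta>)) \<le> pmf_mean p"
    unfolding pmf_mean_def
    by (intro integral_mono integrable_mult_min mult_min_bounds(2) assms of_nat_0_le_iff)
  then show ?thesis
    unfolding pgf_err_def using mult_min_bounds(2)[OF pmf_mean_nonneg assms(2), of p] by linarith
qed

lemma pgf_err_tendsto_0:
  assumes p: "integrable (measure_pmf p) real"
  shows "(\<lambda>N. pgf_err (1 / real (Suc N)) p) \<longlonglongrightarrow> 0"
proof -
  have lim: "(\<lambda>N. u * min 1 (u * (1 / real (Suc N)))) \<longlonglongrightarrow> 0" for u :: real
  proof -
    have "(\<lambda>N. 1 / real (Suc N)) \<longlonglongrightarrow> 0" using LIMSEQ_inverse_real_of_nat by (simp add: inverse_eq_divide)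
    then have "(\<lambda>N. u * min 1 (u * (1 / real (Suc N)))) \<longlonglongrightarrow> u * min 1 (u * 0)"
      by (rule tendsto_mult[OF tendsto_const tendsto_min[OF tendsto_const tendsto_mult[OF tendsto_const]]])
    then show ?thesis by simp
  qed
  have "(\<lambda>N. measure_pmf.expectation p (\<lambda>k. real k * min 1 (real k * (1 / real (Suc N))))) \<longlonglongrightarrow> measure_pmf.expectation p (\<lambda>k. 0)"
  proof (rule integral_dominated_convergence[where w=real])
    show "AE k in measure_pmf p. norm (real k * min 1 (real k * (1 / real (Suc N)))) \<le> real k" for N
    proof -
      have N: "0 \<le> 1 / real (Suc N)" by simp
      show ?thesis
        unfolding real_norm_def abs_of_nonneg[OF mult_min_bounds(1)[OF of_nat_0_le_iff N]]
        by (intro AE_I2 mult_min_bounds(2)[OF of_nat_0_le_iff N])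
    qed
    show "AE k in measure_pmf p. (\<lambda>N. real k * min 1 (real k * (1 / real (Suc N)))) \<longlonglongrightarrow> 0"
      using lim by (intro AE_I2)
  qed (use p in auto)
  from tendsto_add[OF this lim[of "pmf_mean p"]] show ?thesis by (simp add: pgf_err_def)
qed

lemma poisson_pgf:
  assumes "0 \<le> r" "0 \<le> t"
  shows "(\<integral>\<^sup>+k. ennreal (t ^ k) \<partial>measure_pmf (poisson r)) = ennreal (exp (- (r * (1 - t))))"
proof (cases "r = 0")
  case True
  then show ?thesis by (simp add: poisson_def)
next
  case False
  then have r: "0 < r" using assms by simp
  have "(\<lambda>k. (r * t) ^ k / fact k) sums exp (r * t)"
    using exp_converges[of "r * t"] by (simp add: divide_inverse mult.commute)
  then have s: "(\<lambda>k. exp (- r) * ((r * t) ^ k / fact k)) sums (exp (- r) * exp (r * t))"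
    by (rule sums_mult)
  have "(\<integral>\<^sup>+k. ennreal (t ^ k) \<partial>measure_pmf (poisson r)) = (\<Sum>k. ennreal (pmf (poisson r) k) * ennreal (t ^ k))"
    by (simp only: nn_integral_measure_pmf nn_integral_count_space_nat)
  also have "\<dots> = (\<Sum>k. ennreal (exp (- r) * ((r * t) ^ k / fact k)))"
  proof (rule suminf_cong)
    fix k
    have "ennreal (pmf (poisson r) k) * ennreal (t ^ k) = ennreal (pmf (poisson r) k * t ^ k)"
      using assms by (intro ennreal_mult[symmetric]) auto
    also have "pmf (poisson r) k * t ^ k = exp (- r) * ((r * t) ^ k / fact k)"
      using r by (simp add: poisson_def power_mult_distrib)
    finally show "ennreal (pmf (poisson r) k) * ennreal (t ^ k) = ennreal (exp (- r) * ((r * t) ^ k / fact k))" .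
  qed
  also have "\<dots> = ennreal (exp (- r) * exp (r * t))"
    using s assms by (intro suminf_ennreal_eq) auto
  also have "exp (- r) * exp (r * t) = exp (- (r * (1 - t)))"
    by (simp only: exp_add[symmetric]) (simp add: right_diff_distrib)
  finally show ?thesis .
qed

subsection \<open>The annealed system\<close>

context iid_environment
begin

lemma kernel_P:
  assumes "(\<lambda>\<omega>. measure_pmf (\<nu> \<omega>)) \<in> env_space \<rightarrow>\<^sub>M prob_algebra (count_space UNIV)"
  shows "(\<lambda>\<omega>. measure_pmf (\<nu> \<omega>)) \<in> P \<rightarrow>\<^sub>M subprob_algebra (count_space UNIV)"
  using measurable_prob_algebraD[OF assms] by (simp add: measurable_cong_sets[OF sets_P refl])

lemma quenched_P:
  assumes "(\<lambda>\<omega>. measure_pmf (\<nu> \<omega>)) \<in> env_space \<rightarrow>\<^sub>M prob_algebra (count_space UNIV)"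
  shows "quenched \<nu> \<in> P \<rightarrow>\<^sub>M subprob_algebra system_space"
  using measurable_prob_algebraD[OF measurable_quenched[OF assms]] by (simp add: measurable_cong_sets[OF sets_P refl])

lemma nn_integral_annealed:
  assumes "(\<lambda>\<omega>. measure_pmf (\<nu> \<omega>)) \<in> env_space \<rightarrow>\<^sub>M prob_algebra (count_space UNIV)"
    and "g \<in> borel_measurable system_space"
  shows "(\<integral>\<^sup>+\<sigma>. g \<sigma> \<partial>annealed P \<nu>) = (\<integral>\<^sup>+\<omega>. \<integral>\<^sup>+\<sigma>. g \<sigma> \<partial>quenched \<nu> \<omega> \<partial>P)"
  unfolding annealed_def by (rule nn_integral_bind[OF assms(2) quenched_P[OF assms(1)]])

text \<open>The quenched identity is asked almost everywhere because the Poisson formula is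
  available on good environments.\<close>

lemma generating_function_annealed:
  fixes X :: "config \<times> walks \<Rightarrow> config" and s :: "int \<Rightarrow> real"
  assumes K: "(\<lambda>\<omega>. measure_pmf (\<nu> \<omega>)) \<in> env_space \<rightarrow>\<^sub>M prob_algebra (count_space UNIV)"
    and X: "X \<in> system_space \<rightarrow>\<^sub>M borel" and s: "\<And>x. 0 \<le> s x"
    and W: "AE \<omega> in P. (\<integral>\<^sup>+\<sigma>. ennreal (\<Prod>x\<in>J. s x ^ X \<sigma> x) \<partial>quenched \<nu> \<omega>) = ennreal (W \<omega>)"
    and W_meas: "W \<in> borel_measurable P" and W_nonneg: "AE \<omega> in P. 0 \<le> W \<omega>"
  shows "(\<integral>\<eta>. (\<Prod>x\<in>J. s x ^ \<eta> x) \<partial>distr (annealed P \<nu>) borel X) = (\<integral>\<omega>. W \<omega> \<partial>P)"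
proof -
  have sets: "sets (annealed P \<nu>) = sets system_space"
    by (rule sets_annealed[OF prob_space_axioms sets_P K])
  have X': "X \<in> annealed P \<nu> \<rightarrow>\<^sub>M borel" using X by (simp add: measurable_cong_sets[OF sets refl])
  have F: "(\<lambda>\<sigma>. \<Prod>x\<in>J. s x ^ X \<sigma> x) \<in> borel_measurable system_space"
    by (rule measurable_prod_power[OF X])
  have "(\<integral>\<eta>. (\<Prod>x\<in>J. s x ^ \<eta> x) \<partial>distr (annealed P \<nu>) borel X) = (\<integral>\<sigma>. (\<Prod>x\<in>J. s x ^ X \<sigma> x) \<partial>annealed P \<nu>)"
    by (rule integral_distr[OF X' measurable_prod_power[OF measurable_ident_sets[OF refl]]])
  also have "\<dots> = enn2real (\<integral>\<^sup>+\<sigma>. ennreal (\<Prod>x\<in>J. s x ^ X \<sigma> x) \<partial>annealed P \<nu>)"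
    using F s by (intro integral_eq_nn_integral AE_I2 prod_nonneg) (auto simp: measurable_cong_sets[OF sets refl])
  also have "(\<integral>\<^sup>+\<sigma>. ennreal (\<Prod>x\<in>J. s x ^ X \<sigma> x) \<partial>annealed P \<nu>) = (\<integral>\<^sup>+\<omega>. ennreal (W \<omega>) \<partial>P)"
    using F by (subst nn_integral_annealed[OF K]) (auto intro!: nn_integral_cong_AE W)
  also have "enn2real \<dots> = (\<integral>\<omega>. W \<omega> \<partial>P)"
    by (rule integral_eq_nn_integral[OF W_meas W_nonneg, symmetric])
  finally show ?thesis .
qed

lemma generating_function_pi_alpha:
  assumes J: "finite J" and s: "\<And>x. 0 \<le> s x \<and> s x \<le> 1" and "0 \<le> \<alpha>"
  shows "(\<integral>\<eta>. (\<Prod>x\<in>J. s x ^ \<eta> x) \<partial>distr (annealed P (pi_alpha \<alpha>)) borel eta0) =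
    (\<integral>\<omega>. exp (- (\<Sum>x\<in>J. (1 - s x) * (\<alpha> * env_f (shift x \<omega>)))) \<partial>P)"
proof (rule generating_function_annealed[OF measurable_pi_alpha measurable_eta0])
  show "AE \<omega> in P. (\<integral>\<^sup>+\<sigma>. ennreal (\<Prod>x\<in>J. s x ^ eta0 \<sigma> x) \<partial>quenched (pi_alpha \<alpha>) \<omega>) =
      ennreal (exp (- (\<Sum>x\<in>J. (1 - s x) * (\<alpha> * env_f (shift x \<omega>)))))"
    using AE_good
  proof eventually_elim
    case (elim \<omega>)
    have "(\<integral>\<^sup>+\<sigma>. ennreal (\<Prod>x\<in>J. s x ^ eta0 \<sigma> x) \<partial>quenched (pi_alpha \<alpha>) \<omega>) =
        (\<integral>\<^sup>+\<sigma>. (\<Prod>x\<in>J. ennreal (s x ^ eta0 \<sigma> x)) \<partial>quenched (pi_alpha \<alpha>) \<omega>)"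
      using s by (intro nn_integral_cong prod_ennreal[symmetric]) auto
    also have "\<dots> = (\<Prod>x\<in>J. \<integral>\<^sup>+k. ennreal (s x ^ k) \<partial>measure_pmf (pi_alpha \<alpha> (shift x \<omega>)))"
      by (rule nn_integral_quenched_eta0[OF J])
    also have "\<dots> = (\<Prod>x\<in>J. ennreal (exp (- (\<alpha> * env_f (shift x \<omega>) * (1 - s x)))))"
      unfolding pi_alpha_def using s \<open>0 \<le> \<alpha>\<close> env_f_pos[OF good_shift[OF elim]]
      by (intro prod.cong refl poisson_pgf) (auto simp: less_imp_le)
    also have "\<dots> = ennreal (\<Prod>x\<in>J. exp (- (\<alpha> * env_f (shift x \<omega>) * (1 - s x))))"
      by (rule prod_ennreal) simp
    also have "(\<Prod>x\<in>J. exp (- (\<alpha> * env_f (shift x \<omega>) * (1 - s x)))) = exp (- (\<Sum>x\<in>J. (1 - s x) * (\<alpha> * env_f (shift x \<omega>))))"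
      using J by (simp add: exp_sum[symmetric] sum_negf mult_ac)
    finally show ?case .
  qed
qed (use s in auto)

end

section \<open>The particle system with a general initial law\<close>

locale particle_system = iid_environment +
  fixes \<nu> :: "env \<Rightarrow> nat pmf"
  assumes kernel: "(\<lambda>\<omega>. measure_pmf (\<nu> \<omega>)) \<in> env_space \<rightarrow>\<^sub>M prob_algebra (count_space UNIV)"
    and finite_density: "(\<integral>\<^sup>+\<omega>. \<integral>\<^sup>+k. of_nat k \<partial>measure_pmf (\<nu> \<omega>) \<partial>P) < \<infinity>"
begin

lemma measurable_nn_expectation [measurable]:
  fixes g :: "nat \<Rightarrow> ennreal"
  shows "(\<lambda>\<omega>. \<integral>\<^sup>+k. g k \<partial>measure_pmf (\<nu> \<omega>)) \<in> borel_measurable P"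
  by (rule measurable_compose[OF kernel_P[OF kernel] nn_integral_measurable_subprob_algebra]) simp

lemma measurable_expectation:
  fixes g :: "nat \<Rightarrow> real"
  assumes "\<And>k. 0 \<le> g k"
  shows "(\<lambda>\<omega>. measure_pmf.expectation (\<nu> \<omega>) g) \<in> borel_measurable P"
proof -
  have "measure_pmf.expectation (\<nu> \<omega>) g = enn2real (\<integral>\<^sup>+k. ennreal (g k) \<partial>measure_pmf (\<nu> \<omega>))" for \<omega>
    using assms by (intro integral_eq_nn_integral) auto
  then show ?thesis by simp
qed

abbreviation mean_mass :: "env \<Rightarrow> real" where "mean_mass \<omega> \<equiv> pmf_mean (\<nu> \<omega>)"

lemma measurable_mean_mass [measurable]: "mean_mass \<in> borel_measurable P"
  unfolding pmf_mean_def by (rule measurable_expectation) simp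

lemma AE_integrable_particles: "AE \<omega> in P. integrable (measure_pmf (\<nu> \<omega>)) real"
proof -
  have "AE \<omega> in P. (\<integral>\<^sup>+k. of_nat k \<partial>measure_pmf (\<nu> \<omega>)) \<noteq> \<infinity>"
    using finite_density by (intro nn_integral_PInf_AE) auto
  then show ?thesis
    by eventually_elim (auto simp: integrable_iff_bounded ennreal_of_nat_eq_real_of_nat less_top)
qed

lemma ennreal_mean_mass: "integrable (measure_pmf (\<nu> \<omega>)) real \<Longrightarrow> ennreal (mean_mass \<omega>) = (\<integral>\<^sup>+k. of_nat k \<partial>measure_pmf (\<nu> \<omega>))"
  unfolding pmf_mean_def
  by (subst nn_integral_eq_integral[symmetric]) (auto intro!: nn_integral_cong simp: ennreal_of_nat_eq_real_of_nat)

lemma nn_integral_mean_mass: "(\<integral>\<^sup>+\<omega>. ennreal (mean_mass \<omega>) \<partial>P) = (\<integral>\<^sup>+\<omega>. \<integral>\<^sup>+k. of_nat k \<partial>measure_pmf (\<nu> \<omega>) \<partial>P)"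
  using AE_integrable_particles by (intro nn_integral_cong_AE) (auto elim!: eventually_mono simp: ennreal_mean_mass)

lemma integrable_mean_mass: "integrable P mean_mass"
  using finite_density by (intro integrableI_nonneg) (auto simp: pmf_mean_nonneg nn_integral_mean_mass)

lemma integral_mean_mass: "(\<integral>\<sigma>. real (eta0 \<sigma> 0) \<partial>annealed P \<nu>) = (\<integral>\<omega>. mean_mass \<omega> \<partial>P)"
proof -
  have sets: "sets (annealed P \<nu>) = sets system_space"
    by (rule sets_annealed[OF prob_space_axioms sets_P kernel])
  have m: "(\<lambda>\<sigma>. eta0 \<sigma> 0) \<in> system_space \<rightarrow>\<^sub>M count_space UNIV"
    by (rule measurable_compose[OF measurable_eta0 measurable_config_coordinate])
  have "(\<integral>\<sigma>. real (eta0 \<sigma> 0) \<partial>annealed P \<nu>) = enn2real (\<integral>\<^sup>+\<sigma>. ennreal (real (eta0 \<sigma> 0)) \<partial>annealed P \<nu>)"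
    by (rule integral_eq_nn_integral)
       (use measurable_compose[OF m, of real borel] in \<open>auto simp: measurable_cong_sets[OF sets refl]\<close>)
  also have "(\<integral>\<^sup>+\<sigma>. ennreal (real (eta0 \<sigma> 0)) \<partial>annealed P \<nu>) = (\<integral>\<^sup>+\<omega>. \<integral>\<^sup>+k. of_nat k \<partial>measure_pmf (\<nu> \<omega>) \<partial>P)"
    using nn_integral_quenched_eta0[where J="{0}" and g="\<lambda>_ k. of_nat k" and \<nu>=\<nu>] measurable_compose[OF m, of "\<lambda>k. ennreal (real k)" borel]
    by (subst nn_integral_annealed[OF kernel]) (auto intro!: nn_integral_cong simp: ennreal_of_nat_eq_real_of_nat)
  also have "enn2real \<dots> = (\<integral>\<omega>. mean_mass \<omega> \<partial>P)"
    unfolding nn_integral_mean_mass[symmetric] by (rule integral_eq_nn_integral[symmetric]) (auto simp: pmf_mean_nonneg)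
  finally show ?thesis .
qed

definition err :: "real \<Rightarrow> env \<Rightarrow> real" where
  "err \<delta> \<omega> = pgf_err \<delta> (\<nu> \<omega>)"

lemma measurable_err: 
  assumes "0 \<le> \<delta>"
  shows "err \<delta> \<in> borel_measurable P"
proof -
  have "(\<lambda>\<omega>. measure_pmf.expectation (\<nu> \<omega>) (\<lambda>k. real k * min 1 (real k * \<delta>))) \<in> borel_measurable P"
    using assms by (intro measurable_expectation) auto
  then show ?thesis unfolding err_def[abs_def] pgf_err_def by measurable
qed

lemma integrable_err:
  assumes "0 \<le> \<delta>"
  shows "integrable P (err \<delta>)"
proof (rule Bochner_Integration.integrable_bound[of _ "\<lambda>\<omega>. 2 * mean_mass \<omega>"])
  show "AE \<omega> in P. norm (err \<delta> \<omega>) \<le> norm (2 * mean_mass \<omega>)"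
    using AE_integrable_particles
  proof eventually_elim
    case (elim \<omega>)
    from pgf_err_le[OF elim assms] pgf_err_nonneg[OF assms, of "\<nu> \<omega>"]
    show ?case unfolding err_def real_norm_def by linarith
  qed
qed (use integrable_mean_mass assms in \<open>auto intro: measurable_err\<close>)

lemma integral_err_tendsto_0: "(\<lambda>N. \<integral>\<omega>. err (1 / real (Suc N)) \<omega> \<partial>P) \<longlonglongrightarrow> 0"
proof -
  have "(\<lambda>N. \<integral>\<omega>. err (1 / real (Suc N)) \<omega> \<partial>P) \<longlonglongrightarrow> (\<integral>\<omega>. 0 \<partial>P)"
  proof (rule integral_dominated_convergence[where w="\<lambda>\<omega>. 2 * mean_mass \<omega>"])
    show "AE \<omega> in P. norm (err (1 / real (Suc N)) \<omega>) \<le> 2 * mean_mass \<omega>" for N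
      using AE_integrable_particles
    proof eventually_elim
      case (elim \<omega>)
      from pgf_err_le[OF elim, of "1 / real (Suc N)"] pgf_err_nonneg[of "1 / real (Suc N)" "\<nu> \<omega>"]
      show ?case unfolding err_def real_norm_def by (subst abs_of_nonneg) auto
    qed
    show "AE \<omega> in P. (\<lambda>N. err (1 / real (Suc N)) \<omega>) \<longlonglongrightarrow> 0"
      using AE_integrable_particles unfolding err_def by eventually_elim (rule pgf_err_tendsto_0)
  qed (use integrable_mean_mass in \<open>auto intro!: measurable_err\<close>)
  then show ?thesis by simp
qed

definition limit_density :: real where
  "limit_density = speed P * (\<integral>\<omega>. mean_mass \<omega> \<partial>P)"

lemma limit_density_nonneg: "0 \<le> limit_density"
  unfolding limit_density_def using speed_pos pmf_mean_nonneg
  by (intro mult_nonneg_nonneg integral_nonneg_AE AE_I2) auto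

text \<open>The starting sites from which some point of \<open>J\<close> is within reach by time
  \<open>n\<close>; particles from elsewhere contribute the factor 1.\<close>

definition sites :: "nat \<Rightarrow> int set \<Rightarrow> int set" where
  "sites n J = (\<Union>x\<in>J. {x - int n..x + int n})"

definition quenched_gf :: "nat \<Rightarrow> int set \<Rightarrow> (int \<Rightarrow> real) \<Rightarrow> env \<Rightarrow> real" where
  "quenched_gf n J s \<omega> = (\<Prod>y\<in>sites n J. measure_pmf.expectation (\<nu> (shift y \<omega>)) (\<lambda>k. (1 - loss \<omega> n J s y) ^ k))"

definition limit_gf :: "int set \<Rightarrow> (int \<Rightarrow> real) \<Rightarrow> env \<Rightarrow> real" where
  "limit_gf J s \<omega> = exp (- (\<Sum>x\<in>J. (1 - s x) * (limit_density * env_f (shift x \<omega>))))"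

lemma finite_sites: "finite J \<Longrightarrow> finite (sites n J)"
  by (simp add: sites_def)

lemma quenched_gf_bounds:
  assumes "finite J" "\<And>x. 0 \<le> s x \<and> s x \<le> 1"
  shows "0 \<le> quenched_gf n J s \<omega>" "quenched_gf n J s \<omega> \<le> 1"
proof -
  have l: "0 \<le> loss \<omega> n J s y" "loss \<omega> n J s y \<le> 1" for y by (rule loss_bounds[OF assms])+
  have *: "0 \<le> measure_pmf.expectation p (\<lambda>k. (1 - loss \<omega> n J s y) ^ k) \<and>
      measure_pmf.expectation p (\<lambda>k. (1 - loss \<omega> n J s y) ^ k) \<le> 1" for p y
  proof
    show "0 \<le> measure_pmf.expectation p (\<lambda>k. (1 - loss \<omega> n J s y) ^ k)"
      using l[of y] by (intro integral_nonneg_AE) auto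
    have "integrable (measure_pmf p) (\<lambda>k. (1 - loss \<omega> n J s y) ^ k)"
      by (rule measure_pmf.integrable_const_bound[of _ 1]) (use l[of y] in \<open>auto simp: power_le_one\<close>)
    then have "measure_pmf.expectation p (\<lambda>k. (1 - loss \<omega> n J s y) ^ k) \<le> measure_pmf.expectation p (\<lambda>k. 1)"
      using l[of y] by (intro integral_mono) (auto simp: power_le_one)
    then show "measure_pmf.expectation p (\<lambda>k. (1 - loss \<omega> n J s y) ^ k) \<le> 1" by simp
  qed
  show "0 \<le> quenched_gf n J s \<omega>" unfolding quenched_gf_def using * by (intro prod_nonneg) auto
  show "quenched_gf n J s \<omega> \<le> 1" unfolding quenched_gf_def using * by (intro prod_le_1) auto
qed

lemma nn_integral_quenched_gf:
  assumes "finite J" "\<And>x. 0 \<le> s x \<and> s x \<le> 1"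
  shows "(\<integral>\<^sup>+\<sigma>. ennreal (\<Prod>x\<in>J. s x ^ eta n \<sigma> x) \<partial>quenched \<nu> \<omega>) = ennreal (quenched_gf n J s \<omega>)"
  unfolding quenched_gf_def by (rule nn_integral_quenched_eta) (use assms in \<open>auto simp: sites_def\<close>)

lemma measurable_quenched_gf:
  assumes "finite J" "\<And>x. 0 \<le> s x \<and> s x \<le> 1"
  shows "quenched_gf n J s \<in> borel_measurable P"
proof -
  have F: "(\<lambda>\<sigma>. ennreal (\<Prod>x\<in>J. s x ^ eta n \<sigma> x)) \<in> borel_measurable system_space"
    by (intro measurable_compose[OF _ measurable_ennreal] measurable_prod_power measurable_eta)
  have "(\<lambda>\<omega>. enn2real (\<integral>\<^sup>+\<sigma>. ennreal (\<Prod>x\<in>J. s x ^ eta n \<sigma> x) \<partial>quenched \<nu> \<omega>)) \<in> borel_measurable P"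
    using measurable_compose[OF quenched_P[OF kernel] nn_integral_measurable_subprob_algebra[OF F]] by measurable
  then show ?thesis by (simp add: nn_integral_quenched_gf[OF assms] quenched_gf_bounds[OF assms])
qed

text \<open>Two errors are separated: the Poisson approximation at the actual quenched means, and
  the distance of these means from their limit.\<close>

lemma quenched_gf_approx:
  assumes J: "finite J" and s: "\<And>x. 0 \<le> s x \<and> s x \<le> 1"
    and g: "good \<omega>" and i: "\<And>y. integrable (measure_pmf (\<nu> (shift y \<omega>))) real"
    and small: "\<And>y x. tprob \<omega> n y x \<le> \<epsilon> * env_f (shift x \<omega>)"
    and \<delta>: "\<epsilon> * (\<Sum>x\<in>J. env_f (shift x \<omega>)) \<le> \<delta>"
  shows "\<bar>quenched_gf n J s \<omega> - limit_gf J s \<omega>\<bar> \<le>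
    (\<Sum>x\<in>J. (push ^^ n) (err \<delta>) (shift x \<omega>)) + (\<Sum>x\<in>J. \<bar>(push ^^ n) mean_mass (shift x \<omega>) - limit_density * env_f (shift x \<omega>)\<bar>)"
proof -
  let ?Y = "sites n J" and ?l = "loss \<omega> n J s"
  have \<omega>: "\<omega> \<in> space P" using g by (simp add: good_def)
  have l: "0 \<le> ?l y" "?l y \<le> 1" "?l y \<le> (\<Sum>x\<in>J. tprob \<omega> n y x)" for y by (rule loss_bounds[OF J s])+
  have l_le: "?l y \<le> \<delta>" for y
  proof -
    have "(\<Sum>x\<in>J. tprob \<omega> n y x) \<le> (\<Sum>x\<in>J. \<epsilon> * env_f (shift x \<omega>))" by (intro sum_mono small)
    then show ?thesis using l(3)[of y] \<delta> by (simp add: sum_distrib_left)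
  qed
  have \<delta>0: "0 \<le> \<delta>" using l(1) l_le order_trans by blast
  have push: "(push ^^ n) \<phi> (shift x \<omega>) = (\<Sum>y\<in>?Y. \<phi> (shift y \<omega>) * tprob \<omega> n y x)" if "x \<in> J" for \<phi> x
    using that by (intro push_pow_eq_sum \<omega> finite_sites J) (auto simp: sites_def)
  \<comment> \<open>\<open>D\<close> is the exponent of the approximating Poisson system. Exchanging
    the sums over starting sites and over \<open>J\<close> expresses it through the quenched means
    \<open>(push ^^ n) mean_mass\<close>.\<close>
  define D where "D = (\<Sum>y\<in>?Y. mean_mass (shift y \<omega>) * ?l y)"
  have D_eq: "D = (\<Sum>x\<in>J. (1 - s x) * (push ^^ n) mean_mass (shift x \<omega>))"
  proof -
    have "D = (\<Sum>y\<in>?Y. \<Sum>x\<in>J. (1 - s x) * (mean_mass (shift y \<omega>) * tprob \<omega> n y x))"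
      unfolding D_def loss_def by (simp add: sum_distrib_left mult_ac)
    also have "\<dots> = (\<Sum>x\<in>J. (1 - s x) * (push ^^ n) mean_mass (shift x \<omega>))"
      by (subst sum.swap) (simp add: push sum_distrib_left)
    finally show ?thesis .
  qed
  have "\<bar>quenched_gf n J s \<omega> - exp (- D)\<bar> \<le> (\<Sum>x\<in>J. (push ^^ n) (err \<delta>) (shift x \<omega>))"
  proof -
    have e: "exp (- D) = (\<Prod>y\<in>?Y. exp (- (mean_mass (shift y \<omega>) * ?l y)))"
      unfolding D_def by (simp add: exp_sum[symmetric] finite_sites[OF J] sum_negf)
    have "\<bar>quenched_gf n J s \<omega> - exp (- D)\<bar> \<le>
       (\<Sum>y\<in>?Y. \<bar>measure_pmf.expectation (\<nu> (shift y \<omega>)) (\<lambda>k. (1 - ?l y) ^ k) - exp (- (mean_mass (shift y \<omega>) * ?l y))\<bar>)"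
      unfolding quenched_gf_def e real_norm_def[symmetric]
    \<comment> \<open>All factors lie in the unit interval, so replacing them one at a time costs
      the sum of the individual errors.\<close>
    proof (rule norm_prod_diff)
      fix y
      have "norm (measure_pmf.expectation (\<nu> (shift y \<omega>)) (\<lambda>k. (1 - ?l y) ^ k)) \<le> measure_pmf.expectation (\<nu> (shift y \<omega>)) (\<lambda>k. norm ((1 - ?l y) ^ k))"
        by (rule integral_norm_bound)
      also have "\<dots> \<le> measure_pmf.expectation (\<nu> (shift y \<omega>)) (\<lambda>k. 1)"
        by (intro integral_mono measure_pmf.integrable_const_bound[of _ 1]) (use l[of y] in \<open>auto simp: power_le_one\<close>)
      finally show "norm (measure_pmf.expectation (\<nu> (shift y \<omega>)) (\<lambda>k. (1 - ?l y) ^ k)) \<le> 1" by simp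
      show "norm (exp (- (mean_mass (shift y \<omega>) * ?l y))) \<le> 1"
        using l(1)[of y] pmf_mean_nonneg[of "\<nu> (shift y \<omega>)"] by simp
    qed
    also have "\<dots> \<le> (\<Sum>y\<in>?Y. ?l y * err \<delta> (shift y \<omega>))"
      unfolding err_def by (intro sum_mono pgf_exp_bound i l l_le)
    \<comment> \<open>With \<open>loss\<close> bounded by transition probabilities, the sum over
      starting sites becomes \<open>push ^^ n\<close> of \<open>err \<delta>\<close>, whose mean is
      the same for all \<open>n\<close>.\<close>
    also have "\<dots> \<le> (\<Sum>y\<in>?Y. (\<Sum>x\<in>J. tprob \<omega> n y x) * err \<delta> (shift y \<omega>))"
      unfolding err_def by (intro sum_mono mult_right_mono l pgf_err_nonneg \<delta>0)
    also have "\<dots> = (\<Sum>x\<in>J. (push ^^ n) (err \<delta>) (shift x \<omega>))"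
      by (simp add: push sum_distrib_left mult.commute) (rule sum.swap)
    finally show ?thesis .
  qed
  moreover have "\<bar>exp (- D) - limit_gf J s \<omega>\<bar> \<le> (\<Sum>x\<in>J. \<bar>(push ^^ n) mean_mass (shift x \<omega>) - limit_density * env_f (shift x \<omega>)\<bar>)"
  proof -
    let ?L = "\<Sum>x\<in>J. (1 - s x) * (limit_density * env_f (shift x \<omega>))"
    have exp_diff: "\<bar>exp (- a) - exp (- b)\<bar> \<le> \<bar>a - b\<bar>" if "0 \<le> a" "0 \<le> b" for a b :: real
    proof -
      have "exp (- a) - exp (- b) \<le> b - a" if "0 \<le> a" "a \<le> b" for a b :: real
      proof -
        have "exp (- a) - exp (- b) = exp (- a) * (1 - exp (- (b - a)))" by (simp add: algebra_simps exp_add[symmetric])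
        also have "\<dots> \<le> 1 * (b - a)"
        proof (rule mult_mono)
          show "1 - exp (- (b - a)) \<le> b - a" using exp_ge_add_one_self[of "- (b - a)"] by linarith
        qed (use that in auto)
        finally show ?thesis by simp
      qed
      from this[of a b] this[of b a] that show ?thesis by (cases "a \<le> b") (auto simp: abs_if)
    qed
    have "0 \<le> D" unfolding D_def using l(1) pmf_mean_nonneg by (intro sum_nonneg mult_nonneg_nonneg) auto
    moreover have "0 \<le> ?L"
      using s limit_density_nonneg env_f_pos[OF good_shift[OF g]] by (intro sum_nonneg mult_nonneg_nonneg) (auto simp: less_imp_le)
    ultimately have "\<bar>exp (- D) - limit_gf J s \<omega>\<bar> \<le> \<bar>D - ?L\<bar>" unfolding limit_gf_def by (rule exp_diff)
    also have "D - ?L = (\<Sum>x\<in>J. (1 - s x) * ((push ^^ n) mean_mass (shift x \<omega>) - limit_density * env_f (shift x \<omega>)))"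
      unfolding D_eq by (simp add: sum_subtractf right_diff_distrib)
    also have "\<bar>\<dots>\<bar> \<le> (\<Sum>x\<in>J. \<bar>(1 - s x) * ((push ^^ n) mean_mass (shift x \<omega>) - limit_density * env_f (shift x \<omega>))\<bar>)"
      by (rule sum_abs)
    also have "\<dots> \<le> (\<Sum>x\<in>J. \<bar>(push ^^ n) mean_mass (shift x \<omega>) - limit_density * env_f (shift x \<omega>)\<bar>)"
      using s by (intro sum_mono) (simp add: abs_mult mult_left_le_one_le)
    finally show ?thesis .
  qed
  ultimately show ?thesis by linarith
qed

lemma quenched_gf_converges:
  assumes J: "finite J" and s: "\<And>x. 0 \<le> s x \<and> s x \<le> 1"
  shows "(\<lambda>n. \<integral>\<omega>. quenched_gf n J s \<omega> \<partial>P) \<longlonglongrightarrow> (\<integral>\<omega>. limit_gf J s \<omega> \<partial>P)"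
proof (rule LIMSEQ_I)
  fix e :: real assume "e > 0"
  \<comment> \<open>One more than the number of sites, so that dividing by \<open>c\<close> is
    legitimate for empty \<open>J\<close> too.\<close>
  define c where "c = real (card J) + 1"
  have c: "c > 0" "real (card J) \<le> c" by (auto simp: c_def)
  define F where "F \<omega> = (\<Sum>x\<in>J. env_f (shift x \<omega>))" for \<omega>
  have F_int: "integrable P F" unfolding F_def by (intro Bochner_Integration.integrable_sum integrable_shift integrable_env_f)
  have [measurable]: "F \<in> borel_measurable P" using F_int by (rule borel_measurable_integrable)
  have F_nonneg: "AE \<omega> in P. 0 \<le> F \<omega>"
    using AE_good by eventually_elim (auto simp: F_def less_imp_le[OF env_f_pos[OF good_shift]] intro!: sum_nonneg)
  \<comment> \<open>The bound of \<open>trans_uniformly_small\<close> is a multiple of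
    \<open>env_f\<close>, which has no common bound over environments. Markov's inequality confines
    large values of \<open>F\<close> to an event \<open>A\<close>; the summand 1 makes its
    probability strictly less than \<open>e / 4\<close> and keeps \<open>R\<close> positive.\<close>
  define R where "R = 4 * (\<integral>\<omega>. F \<omega> \<partial>P) / e + 1"
  have IF: "0 \<le> (\<integral>\<omega>. F \<omega> \<partial>P)" by (rule integral_nonneg_AE[OF F_nonneg])
  then have R: "R > 0" using \<open>e > 0\<close> by (simp add: R_def add_nonneg_pos)
  define A where "A = {\<omega> \<in> space P. F \<omega> \<ge> R}"
  have [measurable]: "A \<in> sets P" unfolding A_def by measurable
  have "prob A \<le> (\<integral>\<omega>. F \<omega> \<partial>P) / R"
    unfolding A_def by (rule integral_Markov_inequality_measure[OF F_int sets.top F_nonneg R])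
  also have "\<dots> < e / 4"
  proof -
    have "(\<integral>\<omega>. F \<omega> \<partial>P) < e / 4 * R" using \<open>e > 0\<close> by (simp add: R_def distrib_left)
    then show ?thesis using R by (simp add: divide_less_eq)
  qed
  finally have A: "prob A < e / 4" .
  from order_tendstoD(2)[OF integral_err_tendsto_0, of "e / 4 / c"] \<open>e > 0\<close> c
  obtain N where N: "(\<integral>\<omega>. err (1 / real (Suc N)) \<omega> \<partial>P) < e / 4 / c" by (auto dest: eventually_happens)
  define \<delta> where "\<delta> = 1 / real (Suc N)"
  have \<delta>: "\<delta> > 0" by (simp add: \<delta>_def)
  have err_c: "real (card J) * (\<integral>\<omega>. err \<delta> \<omega> \<partial>P) \<le> e / 4"
  proof -
    have "0 \<le> (\<integral>\<omega>. err \<delta> \<omega> \<partial>P)" unfolding err_def using \<delta> by (intro integral_nonneg_AE AE_I2 pgf_err_nonneg) auto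
    then have "real (card J) * (\<integral>\<omega>. err \<delta> \<omega> \<partial>P) \<le> c * (e / 4 / c)"
      using N c by (intro mult_mono) (auto simp: \<delta>_def)
    then show ?thesis using c by simp
  qed
  \<comment> \<open>Off \<open>A\<close> this scale makes every loss at most
    \<open>\<delta>\<close>. Hence \<open>R\<close> and \<open>\<delta>\<close> are fixed before
    \<open>n\<close> is taken large.\<close>
  have "0 < \<delta> / R" using \<delta> R by simp
  from trans_uniformly_small[OF this] obtain n1 where
    n1: "\<forall>n\<ge>n1. \<forall>\<omega>. good \<omega> \<longrightarrow> (\<forall>y x. tprob \<omega> n y x \<le> \<delta> / R * env_f (shift x \<omega>))" by blast
  define b where "b n \<omega> = \<bar>(push ^^ n) mean_mass \<omega> - limit_density * env_f \<omega>\<bar>" for n \<omega>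
  have b_int: "integrable P (b n)" for n
    unfolding b_def by (intro integrable_abs Bochner_Integration.integrable_diff integrable_push_pow integrable_mean_mass integrable_mult_right integrable_env_f)
  have "(\<lambda>n. \<integral>\<omega>. b n \<omega> \<partial>P) \<longlonglongrightarrow> 0"
    unfolding b_def limit_density_def by (rule push_pow_converges[OF integrable_mean_mass])
  from order_tendstoD(2)[OF this, of "e / 4 / c"] \<open>e > 0\<close> c
  obtain n2 where n2: "\<And>n. n \<ge> n2 \<Longrightarrow> (\<integral>\<omega>. b n \<omega> \<partial>P) < e / 4 / c" by (auto simp: eventually_sequentially)
  have gf_int: "integrable P (quenched_gf n J s)" for n
    by (rule integrable_const_bound[of _ 1]) (auto simp: quenched_gf_bounds[OF J s] intro: measurable_quenched_gf[OF J s])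
  have limit_bounds: "AE \<omega> in P. 0 \<le> limit_gf J s \<omega> \<and> limit_gf J s \<omega> \<le> 1"
    using AE_good
  proof eventually_elim
    case (elim \<omega>)
    have "0 \<le> (\<Sum>x\<in>J. (1 - s x) * (limit_density * env_f (shift x \<omega>)))"
      using s limit_density_nonneg env_f_pos[OF good_shift[OF elim]] by (intro sum_nonneg mult_nonneg_nonneg) (auto simp: less_imp_le)
    then show ?case by (simp add: limit_gf_def)
  qed
  have limit_meas: "limit_gf J s \<in> borel_measurable P" unfolding limit_gf_def[abs_def] by measurable
  have limit_int: "integrable P (limit_gf J s)"
  proof (rule integrable_const_bound[of _ 1])
    show "AE \<omega> in P. norm (limit_gf J s \<omega>) \<le> 1" using limit_bounds by eventually_elim auto
  qed (rule limit_meas)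
  have AE_i: "AE \<omega> in P. \<forall>y. integrable (measure_pmf (\<nu> (shift y \<omega>))) real"
    unfolding AE_all_countable using AE_shift[OF AE_integrable_particles] by blast
  have E_int: "integrable P ((push ^^ n) (err \<delta>))" for n
    using \<delta> by (intro integrable_push_pow integrable_err) auto
  have "\<bar>(\<integral>\<omega>. quenched_gf n J s \<omega> \<partial>P) - (\<integral>\<omega>. limit_gf J s \<omega> \<partial>P)\<bar> < e" if n: "n \<ge> max n1 n2" for n
  proof -
    have iA: "integrable P (indicator A :: env \<Rightarrow> real)" by (rule integrable_real_indicator) (auto simp: emeasure_eq_measure)
    have iE: "integrable P (\<lambda>\<omega>. (push ^^ n) (err \<delta>) (shift x \<omega>))" for x by (rule integrable_shift[OF E_int])
    have iB: "integrable P (\<lambda>\<omega>. b n (shift x \<omega>))" for x by (rule integrable_shift[OF b_int])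
    have "\<bar>(\<integral>\<omega>. quenched_gf n J s \<omega> \<partial>P) - (\<integral>\<omega>. limit_gf J s \<omega> \<partial>P)\<bar> = \<bar>\<integral>\<omega>. quenched_gf n J s \<omega> - limit_gf J s \<omega> \<partial>P\<bar>"
      using gf_int limit_int by simp
    also have "\<dots> \<le> (\<integral>\<omega>. \<bar>quenched_gf n J s \<omega> - limit_gf J s \<omega>\<bar> \<partial>P)" by (rule integral_abs_bound)
    also have "\<dots> \<le> (\<integral>\<omega>. indicator A \<omega> + (\<Sum>x\<in>J. (push ^^ n) (err \<delta>) (shift x \<omega>)) + (\<Sum>x\<in>J. b n (shift x \<omega>)) \<partial>P)"
    proof (rule integral_mono_AE)
      show "AE \<omega> in P. \<bar>quenched_gf n J s \<omega> - limit_gf J s \<omega>\<bar> \<le>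
          indicator A \<omega> + (\<Sum>x\<in>J. (push ^^ n) (err \<delta>) (shift x \<omega>)) + (\<Sum>x\<in>J. b n (shift x \<omega>))"
        using AE_good AE_i limit_bounds
      proof eventually_elim
        case (elim \<omega>)
        have sp: "\<omega> \<in> space P" using elim(1) by (simp add: good_def)
        show ?case
        proof (cases "\<omega> \<in> A")
          \<comment> \<open>Both generating functions lie in the unit interval, so the indicator of
            \<open>A\<close> alone covers their difference.\<close>
          case True
          have "0 \<le> (push ^^ n) (err \<delta>) (shift x \<omega>)" for x
          proof -
            have "\<bar>(push ^^ n) (err \<delta>) (shift x \<omega>)\<bar> \<le> (push ^^ n) (\<lambda>\<omega>. \<bar>err \<delta> \<omega>\<bar>) (shift x \<omega>)"
              using sp by (intro abs_push_pow_le) (simp add: shift_in_space)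
            also have "(\<lambda>\<omega>. \<bar>err \<delta> \<omega>\<bar>) = err \<delta>" using \<delta> by (auto simp: err_def pgf_err_nonneg)
            finally show ?thesis by simp
          qed
          then have "0 \<le> (\<Sum>x\<in>J. (push ^^ n) (err \<delta>) (shift x \<omega>))" by (intro sum_nonneg)
          moreover have "0 \<le> (\<Sum>x\<in>J. b n (shift x \<omega>))" by (intro sum_nonneg) (simp add: b_def)
          moreover have "0 \<le> quenched_gf n J s \<omega>" "quenched_gf n J s \<omega> \<le> 1"
            by (rule quenched_gf_bounds[OF J s])+
          then have "\<bar>quenched_gf n J s \<omega> - limit_gf J s \<omega>\<bar> \<le> 1"
            using elim(3) by (auto simp: abs_if)
          ultimately show ?thesis using True by simp
        next
          case False
          then have "F \<omega> \<le> R" using sp by (simp add: A_def)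
          have "\<bar>quenched_gf n J s \<omega> - limit_gf J s \<omega>\<bar> \<le> (\<Sum>x\<in>J. (push ^^ n) (err \<delta>) (shift x \<omega>)) + (\<Sum>x\<in>J. b n (shift x \<omega>))"
            unfolding b_def
          proof (rule quenched_gf_approx[OF J s elim(1)])
            show "integrable (measure_pmf (\<nu> (shift y \<omega>))) real" for y using elim(2) by blast
            show "tprob \<omega> n y x \<le> \<delta> / R * env_f (shift x \<omega>)" for y x using n1 elim(1) n by auto
            have "\<delta> / R * F \<omega> \<le> \<delta> / R * R" using \<open>F \<omega> \<le> R\<close> \<delta> R by (intro mult_left_mono) auto
            then show "\<delta> / R * (\<Sum>x\<in>J. env_f (shift x \<omega>)) \<le> \<delta>" using R by (simp add: F_def)
          qed
          then show ?thesis using False by simp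
        qed
      qed
    next
      show "integrable P (\<lambda>\<omega>. \<bar>quenched_gf n J s \<omega> - limit_gf J s \<omega>\<bar>)"
        by (intro integrable_abs Bochner_Integration.integrable_diff gf_int limit_int)
      show "integrable P (\<lambda>\<omega>. indicator A \<omega> + (\<Sum>x\<in>J. (push ^^ n) (err \<delta>) (shift x \<omega>)) + (\<Sum>x\<in>J. b n (shift x \<omega>)))"
        by (intro Bochner_Integration.integrable_add Bochner_Integration.integrable_sum iA iE iB)
    qed
    also have "\<dots> = prob A + (\<Sum>x\<in>J. \<integral>\<omega>. (push ^^ n) (err \<delta>) (shift x \<omega>) \<partial>P) + (\<Sum>x\<in>J. \<integral>\<omega>. b n (shift x \<omega>) \<partial>P)"
      by (simp only: Bochner_Integration.integral_add Bochner_Integration.integrable_add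
          Bochner_Integration.integral_sum Bochner_Integration.integrable_sum iA iE iB) simp
    \<comment> \<open>Stationarity removes the shifts, and conservation of mass by
      \<open>push\<close> frees the middle term from \<open>n\<close>.\<close>
    also have "\<dots> = prob A + real (card J) * (\<integral>\<omega>. err \<delta> \<omega> \<partial>P) + real (card J) * (\<integral>\<omega>. b n \<omega> \<partial>P)"
    proof -
      have "(\<integral>\<omega>. (push ^^ n) (err \<delta>) (shift x \<omega>) \<partial>P) = (\<integral>\<omega>. err \<delta> \<omega> \<partial>P)" for x
        using integral_shift[OF borel_measurable_integrable[OF E_int], of n x] integral_push_pow[OF integrable_err, of \<delta> n] \<delta> by simp
      moreover have "(\<integral>\<omega>. b n (shift x \<omega>) \<partial>P) = (\<integral>\<omega>. b n \<omega> \<partial>P)" for x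
        by (rule integral_shift[OF borel_measurable_integrable[OF b_int]])
      ultimately show ?thesis by simp
    qed
    also have "\<dots> < e"
    proof -
      have "0 \<le> (\<integral>\<omega>. b n \<omega> \<partial>P)" by (intro integral_nonneg_AE AE_I2) (simp add: b_def)
      then have "real (card J) * (\<integral>\<omega>. b n \<omega> \<partial>P) \<le> c * (e / 4 / c)"
        using n2[of n] n c by (intro mult_mono) auto
      then show ?thesis using A err_c c \<open>e > 0\<close> by simp
    qed
    finally show ?thesis .
  qed
  then show "\<exists>no. \<forall>n\<ge>no. norm ((\<integral>\<omega>. quenched_gf n J s \<omega> \<partial>P) - (\<integral>\<omega>. limit_gf J s \<omega> \<partial>P)) < e"
    by (intro exI[of _ "max n1 n2"]) simp
qed

theorem weak_convergence:
  "weakly_converges (\<lambda>n. distr (annealed P \<nu>) borel (eta n)) (distr (annealed P (pi_alpha limit_density)) borel eta0)"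
proof (rule weakly_converges_generating_functions)
  have p: "X \<in> annealed P \<nu>' \<rightarrow>\<^sub>M borel"
    if "X \<in> system_space \<rightarrow>\<^sub>M borel" "(\<lambda>\<omega>. measure_pmf (\<nu>' \<omega>)) \<in> env_space \<rightarrow>\<^sub>M prob_algebra (count_space UNIV)"
    for X :: "config \<times> walks \<Rightarrow> config" and \<nu>'
    using that by (simp add: measurable_cong_sets[OF sets_annealed[OF prob_space_axioms sets_P] refl])
  show "prob_space (distr (annealed P \<nu>) borel (eta n))" for n
    by (intro prob_space.prob_space_distr prob_space_annealed[OF prob_space_axioms sets_P kernel] p measurable_eta kernel)
  show "prob_space (distr (annealed P (pi_alpha limit_density)) borel eta0)"
    by (intro prob_space.prob_space_distr prob_space_annealed[OF prob_space_axioms sets_P measurable_pi_alpha] p measurable_eta0 measurable_pi_alpha)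
  fix J :: "int set" and s :: "int \<Rightarrow> real"
  assume J: "finite J" and s: "\<And>x. 0 \<le> s x \<and> s x \<le> 1"
  have "(\<integral>\<eta>. (\<Prod>x\<in>J. s x ^ \<eta> x) \<partial>distr (annealed P \<nu>) borel (eta n)) = (\<integral>\<omega>. quenched_gf n J s \<omega> \<partial>P)" for n
    by (rule generating_function_annealed[OF kernel measurable_eta])
       (use s in \<open>auto simp: nn_integral_quenched_gf[OF J s] quenched_gf_bounds[OF J s] intro: measurable_quenched_gf[OF J s]\<close>)
  moreover have "(\<integral>\<eta>. (\<Prod>x\<in>J. s x ^ \<eta> x) \<partial>distr (annealed P (pi_alpha limit_density)) borel eta0) = (\<integral>\<omega>. limit_gf J s \<omega> \<partial>P)"
    unfolding limit_gf_def by (rule generating_function_pi_alpha[OF J s limit_density_nonneg])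
  ultimately show "(\<lambda>n. \<integral>\<eta>. (\<Prod>x\<in>J. s x ^ \<eta> x) \<partial>distr (annealed P \<nu>) borel (eta n)) \<longlonglongrightarrow>
      (\<integral>\<eta>. (\<Prod>x\<in>J. s x ^ \<eta> x) \<partial>distr (annealed P (pi_alpha limit_density)) borel eta0)"
    using quenched_gf_converges[OF J s] by simp
qed simp_all

end

theorem theorem1p6:
  fixes P :: "env measure" and c :: real and \<nu> :: "env \<Rightarrow> nat pmf"
  assumes "prob_space P" and "sets P = sets env_space"
    and "prob_space.indep_vars P (\<lambda>_. borel) (\<lambda>x \<omega>. \<omega> x) UNIV"
    and "\<And>x. distr P borel (\<lambda>\<omega>. \<omega> x) = distr P borel (\<lambda>\<omega>. \<omega> 0)"
    and "c > 0" and "AE \<omega> in P. \<omega> 0 \<in> {c..1 - c}"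
    and "(\<integral>\<omega>. rho \<omega> 0 \<partial>P) < 1"
    and "\<nu> \<in> env_space \<rightarrow>\<^sub>M Upsilon"
    and "(\<integral>\<^sup>+s. of_nat (eta0 s 0) \<partial>annealed P \<nu>) < \<infinity>"
  shows "weakly_converges
    (\<lambda>n. distr (annealed P \<nu>) borel (eta n))
    (distr (annealed P (pi_alpha (speed P * (\<integral>s. real (eta0 s 0) \<partial>annealed P \<nu>)))) borel eta0)"
proof -
  interpret iid_environment P c
    using assms(1-7) by (intro iid_environment.intro iid_environment_axioms.intro)
  note kernel = measurable_Upsilon_imp_kernel[OF assms(8)]
  have m: "(\<lambda>\<sigma>. of_nat (eta0 \<sigma> 0) :: ennreal) \<in> borel_measurable system_space"
    by (rule measurable_compose[OF measurable_compose[OF measurable_eta0 measurable_config_coordinate]]) simp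
  \<comment> \<open>Integrating the quenched mean at site 0 over the environment turns the
    hypothesis on \<open>eta0 s 0\<close> into \<open>finite_density\<close>.\<close>
  interpret particle_system P c \<nu>
  proof
    show "(\<integral>\<^sup>+\<omega>. \<integral>\<^sup>+k. of_nat k \<partial>measure_pmf (\<nu> \<omega>) \<partial>P) < \<infinity>"
      using assms(9) nn_integral_quenched_eta0[where J="{0}" and g="\<lambda>_ k. of_nat k" and \<nu>=\<nu>]
      unfolding nn_integral_annealed[OF kernel m] by simp
  qed (rule kernel)
  show ?thesis
    using weak_convergence unfolding limit_density_def integral_mean_mass .
qed

end
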